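(* Let $Y\subset\mathbb R^3$ be a finite set with $n$ elements. For $\lambda\ge0$ let $M_\lambda:\mathbb R^n\to\mathbb R^n$ be represented by the matrix (indexed by $y,y'\in Y$) $$(M_\lambda)_{yy'}=\frac1{4\pi}\begin{cases}\sqrt\lambda,& y=y',\\ -\dfrac{e^{-\sqrt\lambda|y-y'|}}{|y-y'|},& y\ne y'.\end{cases}$$ Let $\Theta\subset\mathbb R^n\times\mathbb R^n$ be a nonlinear maximal monotone relation of type $\gamma_0$, where $\gamma_0$ is the smallest eigenvalue of $M_0$. Then $$((-\Delta)_\Theta+\lambda)^{-1}=(-\Delta+\lambda)^{-1}+G_\lambda(\Theta+M_\lambda)^{-1}\circ G_\lambda^*,\qquad\lambda>0,$$ is the nonlinear resolvent of the nonlinear maximal monotone operator in $L^2(\mathbb R^3)$ $$(-\Delta)_\Theta\,u:=-\Delta u_0,$$ $$\mathscr D((-\Delta)_\Theta)=\{u\in L^2(\mathbb R^3):\ u=u_0+G_0\xi_u,\ u_0\in\tilde H^2(\mathbb R^3),\ (\xi_u,\tilde\tau u)\in\Theta\}.$$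
   Context: All spaces are real. $-\Delta$ on the right-hand side of the resolvent formula is the self-adjoint Laplacian with domain $H^2(\mathbb R^3)$. Vectors in $\mathbb R^n$ are written $\xi\equiv\{\xi_y\}_{y\in Y}$. For $\lambda>0$: $G_\lambda:\mathbb R^n\to L^2(\mathbb R^3)$, $[G_\lambda\xi](x)=\sum_{y\in Y}\frac{e^{-\sqrt\lambda|x-y|}}{4\pi|x-y|}\xi_y$, with adjoint $(G_\lambda^*u)_y=\int_{\mathbb R^3}\frac{e^{-\sqrt\lambda|x-y|}}{4\pi|x-y|}u(x)\,dx$. Also $G_0:\mathbb R^n\to L^2_{loc}(\mathbb R^3)$, $[G_0\xi](x)=\frac1{4\pi}\sum_{y\in Y}\frac{\xi_y}{|x-y|}$. $\tilde H^2(\mathbb R^3)=\{u\in C_b(\mathbb R^3):\ \|\nabla u\|\in L^2(\mathbb R^3),\ \Delta u\in L^2(\mathbb R^3)\}$, where $C_b$ denotes bounded continuous functions and derivatives are distributional. For $u=u_0+G_0\xi$ with $u_0\in\tilde H^2(\mathbb R^3)$, $\tilde\tau u\in\mathbb R^n$ is defined by $(\tilde\tau u)_y:=\lim_{x\to y}\big(u(x)-\frac1{4\pi}\frac{\xi_y}{|x-y|}\big)$. A relation $\Theta\subset\mathbb R^n\times\mathbb R^n$ is monotone of type $\omega$ if $(\tilde\xi-\tilde\zeta)\cdot(\xi-\zeta)\ge-\omega|\xi-\zeta|^2$ for all $(\xi,\tilde\xi),(\zeta,\tilde\zeta)\in\Theta$, and maximal monotone of type $\omega$ if it is not properly contained in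 another monotone relation of type $\omega$. $\Theta+M_\lambda=\{(\xi,\tilde\xi+M_\lambda\xi):(\xi,\tilde\xi)\in\Theta\}$, and $(\Theta+M_\lambda)^{-1}$ is the inverse relation (part of the assertion is that it is a single-valued map $\mathbb R^n\to\mathbb R^n$ for $\lambda>0$). A single-valued operator $A$ in a real Hilbert space $\mathscr H$ is maximal monotone if $\langle A(u)-A(v),u-v\rangle\ge0$ on $\mathscr D(A)$ and $\mathrm{range}(A+\lambda)=\mathscr H$ for some (equivalently any) $\lambda>0$; its nonlinear resolvent is $(A+\lambda)^{-1}:\mathscr H\to\mathscr H$, $\lambda>0$. *)

theory Defs
  imports "HOL-Analysis.Analysis"
begin

type_synonym R3 = "real^3"


section \<open>The real Hilbert space of square-integrable functions\<close>

definition square_integrable :: "(R3 \<Rightarrow> real) \<Rightarrow> bool" where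
  "square_integrable f \<longleftrightarrow> f \<in> borel_measurable lborel \<and> integrable lborel (\<lambda>x. (f x)\<^sup>2)"

lemma square_integrable_mult:
  assumes "square_integrable f" "square_integrable g"
  shows "integrable lborel (\<lambda>x. f x * g x)"
proof (rule Bochner_Integration.integrable_bound)
  show "integrable lborel (\<lambda>x. (f x)\<^sup>2 + (g x)\<^sup>2)"
    using assms by (auto simp: square_integrable_def)
  show "(\<lambda>x. f x * g x) \<in> borel_measurable lborel"
    using assms by (auto simp: square_integrable_def)
  show "AE x in lborel. norm (f x * g x) \<le> norm ((f x)\<^sup>2 + (g x)\<^sup>2)"
  proof (rule AE_I2)
    fix x
    have "0 \<le> (\<bar>f x\<bar> - \<bar>g x\<bar>)\<^sup>2" by simp
    then have "2 * \<bar>f x\<bar> * \<bar>g x\<bar> \<le> (f x)\<^sup>2 + (g x)\<^sup>2"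
      by (simp add: power2_diff)
    moreover have "0 \<le> \<bar>f x\<bar> * \<bar>g x\<bar>" by simp
    ultimately have "\<bar>f x\<bar> * \<bar>g x\<bar> \<le> (f x)\<^sup>2 + (g x)\<^sup>2" by linarith
    then show "norm (f x * g x) \<le> norm ((f x)\<^sup>2 + (g x)\<^sup>2)"
      by (simp add: abs_mult)
  qed
qed

lemma square_integrable_add:
  assumes "square_integrable f" "square_integrable g"
  shows "square_integrable (\<lambda>x. f x + g x)"
proof -
  have "integrable lborel (\<lambda>x. (f x)\<^sup>2 + (g x)\<^sup>2 + 2 * (f x * g x))"
    using assms square_integrable_mult[OF assms] unfolding square_integrable_def by auto
  then show ?thesis
    using assms by (auto simp: square_integrable_def power2_sum algebra_simps)
qed

lemma square_integrable_scale:
  "square_integrable f \<Longrightarrow> square_integrable (\<lambda>x. c * f x)"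
  by (auto simp: square_integrable_def power_mult_distrib)

lemma square_integrable_uminus:
  "square_integrable f \<Longrightarrow> square_integrable (\<lambda>x. - f x)"
  by (auto simp: square_integrable_def)

lemma square_integrable_diff:
  "square_integrable f \<Longrightarrow> square_integrable g \<Longrightarrow> square_integrable (\<lambda>x. f x - g x)"
  using square_integrable_add[OF _ square_integrable_uminus, of f g] by simp

lemma square_integrable_zero: "square_integrable (\<lambda>x. 0)"
  by (simp add: square_integrable_def)

definition L2_eq :: "(R3 \<Rightarrow> real) \<Rightarrow> (R3 \<Rightarrow> real) \<Rightarrow> bool" where
  "L2_eq f g \<longleftrightarrow> square_integrable f \<and> square_integrable g \<and> (AE x in lborel. f x = g x)"

quotient_type L2 = "R3 \<Rightarrow> real" / partial: L2_eq
proof (rule part_equivpI)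
  show "\<exists>f. L2_eq f f"
    by (rule exI[of _ "\<lambda>_. 0"]) (simp add: L2_eq_def square_integrable_zero)
  show "symp L2_eq"
    by (auto simp: symp_def L2_eq_def)
  show "transp L2_eq"
    unfolding transp_def L2_eq_def by (auto elim: AE_mp)
qed

text \<open>\<^term>\<open>rep_L2 u\<close> is an unspecified representative of the class \<open>u\<close>; it is only used in
  contexts that do not depend on the choice up to null sets.\<close>

instantiation L2 :: real_vector
begin

lift_definition zero_L2 :: L2 is "\<lambda>x. 0"
  by (simp add: L2_eq_def square_integrable_zero)

lift_definition plus_L2 :: "L2 \<Rightarrow> L2 \<Rightarrow> L2" is "\<lambda>f g x. f x + g x"
  unfolding L2_eq_def by (auto intro: square_integrable_add)

lift_definition uminus_L2 :: "L2 \<Rightarrow> L2" is "\<lambda>f x. - f x"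
  unfolding L2_eq_def by (auto intro: square_integrable_uminus)

lift_definition minus_L2 :: "L2 \<Rightarrow> L2 \<Rightarrow> L2" is "\<lambda>f g x. f x - g x"
  unfolding L2_eq_def by (auto intro: square_integrable_diff)

lift_definition scaleR_L2 :: "real \<Rightarrow> L2 \<Rightarrow> L2" is "\<lambda>c f x. c * f x"
  unfolding L2_eq_def by (auto intro: square_integrable_scale)

instance
  by standard
    (transfer; auto simp: L2_eq_def algebra_simps
       intro!: square_integrable_add square_integrable_scale square_integrable_uminus
         square_integrable_diff square_integrable_zero)+

end

instantiation L2 :: real_inner
begin

lift_definition inner_L2 :: "L2 \<Rightarrow> L2 \<Rightarrow> real" is "\<lambda>f g. \<integral>x. f x * g x \<partial>lborel"
  unfolding L2_eq_def
  by (rule integral_cong_AE) (auto simp: square_integrable_def)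

definition norm_L2 :: "L2 \<Rightarrow> real" where "norm_L2 u = sqrt (inner u u)"
definition sgn_L2 :: "L2 \<Rightarrow> L2" where "sgn_L2 u = inverse (norm u) *\<^sub>R u"
definition dist_L2 :: "L2 \<Rightarrow> L2 \<Rightarrow> real" where "dist_L2 u v = norm (u - v)"
definition uniformity_L2 :: "(L2 \<times> L2) filter"
  where "uniformity_L2 = (INF e\<in>{0<..}. principal {(x, y). dist x y < e})"
definition open_L2 :: "L2 set \<Rightarrow> bool"
  where "open_L2 U \<longleftrightarrow> (\<forall>x\<in>U. \<forall>\<^sub>F (x', y) in uniformity. x' = x \<longrightarrow> y \<in> U)"

instance
proof
  fix u v w :: L2 and c :: real
  show "dist u v = norm (u - v)" by (rule dist_L2_def)
  show "sgn u = u /\<^sub>R norm u" by (rule sgn_L2_def)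
  show "norm u = sqrt (inner u u)" by (rule norm_L2_def)
  show "uniformity = (INF e\<in>{0<..}. principal {(x::L2, y). dist x y < e})"
    by (rule uniformity_L2_def)
  show "open U \<longleftrightarrow> (\<forall>x\<in>U. \<forall>\<^sub>F (x', y) in uniformity. x' = x \<longrightarrow> y \<in> U)" for U :: "L2 set"
    by (rule open_L2_def)
  show "inner u v = inner v u"
    by transfer (simp add: mult.commute)
  show "inner (u + v) w = inner u w + inner v w"
    by transfer (simp add: L2_eq_def distrib_right square_integrable_mult)
  show "inner (c *\<^sub>R u) v = c * inner u v"
    by transfer (simp add: mult.assoc)
  show "0 \<le> inner u u"
    by transfer (simp add: integral_nonneg_AE)
  show "inner u u = 0 \<longleftrightarrow> u = 0"
  proof transfer
    fix f assume f: "L2_eq f f"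
    then have sq: "square_integrable f" by (simp add: L2_eq_def)
    have "(\<integral>x. f x * f x \<partial>lborel) = 0 \<longleftrightarrow> (AE x in lborel. f x * f x = 0)"
      by (rule integral_nonneg_eq_0_iff_AE) (use square_integrable_mult[OF sq sq] in auto)
    then show "(\<integral>x. f x * f x \<partial>lborel) = 0 \<longleftrightarrow> L2_eq f (\<lambda>x. 0)"
      using sq by (simp add: L2_eq_def square_integrable_zero)
  qed
qed

end

lemma L2_eq_rep: "L2_eq (rep_L2 u) (rep_L2 u)"
  by (simp add: Quotient3_rep_reflp[OF Quotient3_L2])

lemma square_integrable_rep: "square_integrable (rep_L2 u)"
  using L2_eq_rep by (simp add: L2_eq_def)

lemma rep_abs_L2:
  assumes "square_integrable f"
  shows "AE x in lborel. rep_L2 (abs_L2 f) x = f x"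
proof -
  have "L2_eq f f" using assms by (simp add: L2_eq_def)
  then have "L2_eq (rep_L2 (abs_L2 f)) f"
    by (rule rep_abs_rsp_left[OF Quotient3_L2])
  then show ?thesis by (simp add: L2_eq_def)
qed

lemma abs_rep_L2 [simp]: "abs_L2 (rep_L2 u) = u"
  by (rule Quotient3_abs_rep[OF Quotient3_L2])

lemma dist_L2_sq:
  assumes "square_integrable f" "square_integrable g"
  shows "ennreal ((dist (abs_L2 f) (abs_L2 g))\<^sup>2) = (\<integral>\<^sup>+x. ennreal ((f x - g x)\<^sup>2) \<partial>lborel)"
proof -
  have eq: "L2_eq f f" "L2_eq g g" using assms by (auto simp: L2_eq_def)
  have d: "square_integrable (\<lambda>x. f x - g x)" using assms by (rule square_integrable_diff)
  then have eqd: "L2_eq (\<lambda>x. f x - g x) (\<lambda>x. f x - g x)" by (auto simp: L2_eq_def)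
  have "(dist (abs_L2 f) (abs_L2 g))\<^sup>2 = inner (abs_L2 f - abs_L2 g) (abs_L2 f - abs_L2 g)"
    by (simp add: dist_norm power2_norm_eq_inner)
  also have "\<dots> = (\<integral>x. (f x - g x) * (f x - g x) \<partial>lborel)"
    using eq eqd by (simp add: minus_L2.abs_eq inner_L2.abs_eq)
  finally have "(dist (abs_L2 f) (abs_L2 g))\<^sup>2 = (\<integral>x. (f x - g x)\<^sup>2 \<partial>lborel)"
    by (simp add: power2_eq_square)
  moreover have "(\<integral>\<^sup>+x. ennreal ((f x - g x)\<^sup>2) \<partial>lborel) = ennreal (\<integral>x. (f x - g x)\<^sup>2 \<partial>lborel)"
    by (rule nn_integral_eq_integral) (use d in \<open>auto simp: square_integrable_def\<close>)
  ultimately show ?thesis by simp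
qed

lemma dist_rep_L2:
  "ennreal ((dist u v)\<^sup>2) = (\<integral>\<^sup>+x. ennreal ((rep_L2 u x - rep_L2 v x)\<^sup>2) \<partial>lborel)"
  using dist_L2_sq[OF square_integrable_rep square_integrable_rep, of u v] by simp

text \<open>Completeness (Riesz--Fischer).\<close>

lemma L2_fast_Cauchy_AE:
  fixes X :: "nat \<Rightarrow> L2"
  assumes "\<And>n. dist (X (Suc n)) (X n) \<le> (1/2)^n"
  shows "AE x in lborel. convergent (\<lambda>n. rep_L2 (X n) x)"
proof -
  define d where "d = (\<lambda>n x. rep_L2 (X (Suc n)) x - rep_L2 (X n) x)"
  have [measurable]: "rep_L2 (X n) \<in> borel_measurable borel" for n
    using square_integrable_rep[of "X n"] by (simp add: square_integrable_def)
  have [measurable]: "d n \<in> borel_measurable borel" for n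
    unfolding d_def by measurable
  have bnd: "(\<integral>\<^sup>+x. ennreal (2^n * (d n x)\<^sup>2) \<partial>lborel) \<le> ennreal ((1/2)^n)" for n
  proof -
    have "(\<integral>\<^sup>+x. ennreal (2^n * (d n x)\<^sup>2) \<partial>lborel)
        = (\<integral>\<^sup>+x. ennreal (2^n) * ennreal ((d n x)\<^sup>2) \<partial>lborel)"
      by (simp add: ennreal_mult)
    also have "\<dots> = ennreal (2^n) * (\<integral>\<^sup>+x. ennreal ((d n x)\<^sup>2) \<partial>lborel)"
      by (rule nn_integral_cmult) simp
    also have "\<dots> = ennreal (2^n) * ennreal ((dist (X (Suc n)) (X n))\<^sup>2)"
      by (simp add: dist_rep_L2 d_def)
    also have "\<dots> = ennreal (2^n * (dist (X (Suc n)) (X n))\<^sup>2)"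
      by (rule ennreal_mult[symmetric]) auto
    also have "\<dots> \<le> ennreal (2^n * ((1/2)^n)\<^sup>2)"
      by (intro ennreal_leI mult_left_mono power_mono assms) auto
    also have "2^n * ((1/2)^n)\<^sup>2 = (1/2::real)^n"
      by (simp add: power2_eq_square power_divide)
    finally show ?thesis .
  qed
  have "(\<integral>\<^sup>+x. (\<Sum>n. ennreal (2^n * (d n x)\<^sup>2)) \<partial>lborel)
      = (\<Sum>n. \<integral>\<^sup>+x. ennreal (2^n * (d n x)\<^sup>2) \<partial>lborel)"
    by (rule nn_integral_suminf) simp
  also have "\<dots> \<le> (\<Sum>n. ennreal ((1/2)^n))"
    by (intro suminf_le bnd) auto
  also have "\<dots> = ennreal (\<Sum>n. (1/2)^n)"
    by (rule suminf_ennreal2) (auto simp: summable_geometric)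
  also have "\<dots> < \<infinity>" by simp
  finally have "AE x in lborel. (\<Sum>n. ennreal (2^n * (d n x)\<^sup>2)) \<noteq> \<infinity>"
    by (intro nn_integral_PInf_AE) auto
  then show ?thesis
  proof (rule AE_mp, intro AE_I2 impI)
    fix x assume fin: "(\<Sum>n. ennreal (2^n * (d n x)\<^sup>2)) \<noteq> \<infinity>"
    then have "summable (\<lambda>n. 2^n * (d n x)\<^sup>2)"
      by (intro summable_suminf_not_top) auto
    then have "(\<lambda>n. 2^n * (d n x)\<^sup>2) \<longlonglongrightarrow> 0"
      by (rule summable_LIMSEQ_zero)
    then have "Bseq (\<lambda>n. 2^n * (d n x)\<^sup>2)"
      by (intro convergent_imp_Bseq convergentI)
    then obtain K where K: "K > 0" "\<And>n. norm (2^n * (d n x)\<^sup>2) \<le> K"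
      by (auto elim: BseqE)
    have "summable (\<lambda>n. d n x)"
    proof (rule summable_comparison_test')
      show "summable (\<lambda>n. sqrt K * (sqrt (1/2))^n)"
        by (intro summable_mult summable_geometric) (auto simp: real_sqrt_divide)
      fix n :: nat
      have "(d n x)\<^sup>2 \<le> K * (1/2)^n"
        using K(2)[of n] by (simp add: abs_mult field_simps)
      then have "sqrt ((d n x)\<^sup>2) \<le> sqrt (K * (1/2)^n)" by (rule real_sqrt_le_mono)
      then show "norm (d n x) \<le> sqrt K * (sqrt (1/2))^n"
        unfolding real_sqrt_abs real_sqrt_mult real_sqrt_power[of "1/2"] by simp
    qed
    then have "convergent (\<lambda>n. \<Sum>k<n. d k x)"
      by (simp add: summable_iff_convergent)
    moreover have "(\<Sum>k<n. d k x) = rep_L2 (X n) x - rep_L2 (X 0) x" for n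
      unfolding d_def by (rule sum_lessThan_telescope)
    ultimately have "convergent (\<lambda>n. rep_L2 (X n) x - rep_L2 (X 0) x)" by simp
    then show "convergent (\<lambda>n. rep_L2 (X n) x)"
      using convergent_add[OF _ convergent_const, of _ "rep_L2 (X 0) x"] by fastforce
  qed
qed

lemma L2_fast_Cauchy_convergent:
  fixes X :: "nat \<Rightarrow> L2"
  assumes "Cauchy X" "\<And>n. dist (X (Suc n)) (X n) \<le> (1/2)^n"
  shows "convergent X"
proof -
  have [measurable]: "rep_L2 (X n) \<in> borel_measurable borel" for n
    using square_integrable_rep[of "X n"] by (simp add: square_integrable_def)
  define f where "f = (\<lambda>x. lim (\<lambda>n. rep_L2 (X n) x))"
  have [measurable]: "f \<in> borel_measurable borel"
    unfolding f_def by measurable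
  have conv: "AE x in lborel. (\<lambda>n. rep_L2 (X n) x) \<longlonglongrightarrow> f x"
    using L2_fast_Cauchy_AE[OF assms(2)]
    by (rule AE_mp) (auto simp: f_def convergent_LIMSEQ_iff)
  have key: "(\<integral>\<^sup>+x. ennreal ((f x - rep_L2 (X n) x)\<^sup>2) \<partial>lborel) \<le> ennreal (e\<^sup>2)"
    if e: "e > 0" and n: "\<And>m. m \<ge> n \<Longrightarrow> dist (X m) (X n) \<le> e" for n e
  proof -
    have "(\<integral>\<^sup>+x. ennreal ((f x - rep_L2 (X n) x)\<^sup>2) \<partial>lborel)
       = (\<integral>\<^sup>+x. liminf (\<lambda>m. ennreal ((rep_L2 (X m) x - rep_L2 (X n) x)\<^sup>2)) \<partial>lborel)"
    proof (rule nn_integral_cong_AE, rule AE_mp[OF conv], intro AE_I2 impI)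
      fix x assume "(\<lambda>n. rep_L2 (X n) x) \<longlonglongrightarrow> f x"
      then have "(\<lambda>m. ennreal ((rep_L2 (X m) x - rep_L2 (X n) x)\<^sup>2))
          \<longlonglongrightarrow> ennreal ((f x - rep_L2 (X n) x)\<^sup>2)"
        by (intro tendsto_intros)
      then show "ennreal ((f x - rep_L2 (X n) x)\<^sup>2)
          = liminf (\<lambda>m. ennreal ((rep_L2 (X m) x - rep_L2 (X n) x)\<^sup>2))"
        by (intro lim_imp_Liminf[symmetric] trivial_limit_sequentially)
    qed
    also have "\<dots> \<le> liminf (\<lambda>m. \<integral>\<^sup>+x. ennreal ((rep_L2 (X m) x - rep_L2 (X n) x)\<^sup>2) \<partial>lborel)"
      by (rule nn_integral_liminf) simp
    also have "\<dots> = liminf (\<lambda>m. ennreal ((dist (X m) (X n))\<^sup>2))"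
      by (simp add: dist_rep_L2)
    also have "\<dots> \<le> liminf (\<lambda>m::nat. ennreal (e\<^sup>2))"
    proof (rule Liminf_mono)
      show "\<forall>\<^sub>F m in sequentially. ennreal ((dist (X m) (X n))\<^sup>2) \<le> ennreal (e\<^sup>2)"
        using eventually_ge_at_top[of n]
        by eventually_elim (auto intro!: ennreal_leI power_mono n)
    qed
    also have "\<dots> = ennreal (e\<^sup>2)"
      by (simp add: Liminf_const)
    finally show ?thesis .
  qed
  have ex: "\<exists>n0. \<forall>n\<ge>n0. \<forall>m\<ge>n. dist (X m) (X n) \<le> e" if "e > 0" for e
    using metric_CauchyD[OF assms(1) that] by (meson less_imp_le order_trans)
  obtain n1 where n1: "\<And>m. m \<ge> n1 \<Longrightarrow> dist (X m) (X n1) \<le> 1"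
    using ex[of 1] by auto
  have "(\<integral>\<^sup>+x. ennreal ((f x - rep_L2 (X n1) x)\<^sup>2) \<partial>lborel) < \<infinity>"
    using key[of 1 n1] n1 by (auto intro: le_less_trans)
  then have "square_integrable (\<lambda>x. f x - rep_L2 (X n1) x)"
    by (auto simp: square_integrable_def integrable_iff_bounded)
  from square_integrable_add[OF this square_integrable_rep[of "X n1"]]
  have sf: "square_integrable f" by simp
  have "X \<longlonglongrightarrow> abs_L2 f"
  proof (rule metric_LIMSEQ_I)
    fix r :: real assume r: "0 < r"
    obtain n0 where n0: "\<And>n m. n \<ge> n0 \<Longrightarrow> m \<ge> n \<Longrightarrow> dist (X m) (X n) \<le> r/2"
      using ex[of "r/2"] r by auto
    show "\<exists>n0. \<forall>n\<ge>n0. dist (X n) (abs_L2 f) < r"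
    proof (intro exI allI impI)
      fix n assume n: "n0 \<le> n"
      have "ennreal ((dist (abs_L2 f) (X n))\<^sup>2) \<le> ennreal ((r/2)\<^sup>2)"
        using key[of "r/2" n] n0[OF n] r dist_L2_sq[OF sf square_integrable_rep, of "X n"] by simp
      then have "(dist (abs_L2 f) (X n))\<^sup>2 \<le> (r/2)\<^sup>2" by (simp add: ennreal_le_iff)
      then have "dist (abs_L2 f) (X n) \<le> r/2" using r by (auto intro: power2_le_imp_le)
      then show "dist (X n) (abs_L2 f) < r" using r by (simp add: dist_commute)
    qed
  qed
  then show ?thesis by (rule convergentI)
qed

instance L2 :: complete_space
proof
  fix X :: "nat \<Rightarrow> L2"
  assume X: "Cauchy X"
  have "\<exists>N. \<forall>m\<ge>N. \<forall>n\<ge>N. dist (X m) (X n) < (1/2)^k" for k :: nat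
    using metric_CauchyD[OF X, of "(1/2)^k"] by auto
  then obtain N where N: "\<And>k m n. m \<ge> N k \<Longrightarrow> n \<ge> N k \<Longrightarrow> dist (X m) (X n) < (1/2)^k"
    by metis
  define r where "r = (\<lambda>k. k + (\<Sum>i\<le>k. N i))"
  have sm: "strict_mono r"
    by (auto simp: strict_mono_Suc_iff r_def)
  have rN: "r k \<ge> N k" for k
    unfolding r_def by (cases k) auto
  have "dist (X (r (Suc k))) (X (r k)) \<le> (1/2)^k" for k
    using N[of k "r (Suc k)" "r k"] rN[of k] strict_monoD[OF sm, of k "Suc k"] by auto
  moreover have "Cauchy (X \<circ> r)"
    using X sm by (rule Cauchy_subseq_Cauchy)
  ultimately have "convergent (X \<circ> r)"
    by (intro L2_fast_Cauchy_convergent) auto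
  then obtain l where "(X \<circ> r) \<longlonglongrightarrow> l" by (auto simp: convergent_def)
  then have "X \<longlonglongrightarrow> l"
    using X sm Cauchy_converges_subseq by blast
  then show "convergent X" by (rule convergentI)
qed


section \<open>Distributional derivatives and Sobolev spaces\<close>

definition partial :: "3 \<Rightarrow> (R3 \<Rightarrow> real) \<Rightarrow> R3 \<Rightarrow> real" where
  "partial i \<phi> = (\<lambda>x. frechet_derivative \<phi> (at x) (axis i 1))"

definition partials :: "3 list \<Rightarrow> (R3 \<Rightarrow> real) \<Rightarrow> R3 \<Rightarrow> real" where
  "partials is \<phi> = foldr partial is \<phi>"

definition laplace :: "(R3 \<Rightarrow> real) \<Rightarrow> R3 \<Rightarrow> real" where
  "laplace \<phi> = (\<lambda>x. \<Sum>i\<in>UNIV. partials [i, i] \<phi> x)"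

definition test_function :: "(R3 \<Rightarrow> real) \<Rightarrow> bool" where
  "test_function \<phi> \<longleftrightarrow>
     (\<forall>is x. partials is \<phi> differentiable (at x)) \<and> compact (closure {x. \<phi> x \<noteq> 0})"

definition locally_integrable :: "(R3 \<Rightarrow> real) \<Rightarrow> bool" where
  "locally_integrable f \<longleftrightarrow>
     f \<in> borel_measurable lborel \<and> (\<forall>K. compact K \<longrightarrow> set_integrable lborel K f)"

definition weak_derivative :: "3 list \<Rightarrow> (R3 \<Rightarrow> real) \<Rightarrow> (R3 \<Rightarrow> real) \<Rightarrow> bool" where
  "weak_derivative is u g \<longleftrightarrow>
     locally_integrable u \<and> locally_integrable g \<and>
     (\<forall>\<phi>. test_function \<phi> \<longrightarrow>
        (\<integral>x. u x * partials is \<phi> x \<partial>lborel) = (- 1) ^ length is * (\<integral>x. g x * \<phi> x \<partial>lborel))"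

definition weak_laplacian :: "(R3 \<Rightarrow> real) \<Rightarrow> (R3 \<Rightarrow> real) \<Rightarrow> bool" where
  "weak_laplacian u h \<longleftrightarrow>
     locally_integrable u \<and> locally_integrable h \<and>
     (\<forall>\<phi>. test_function \<phi> \<longrightarrow>
        (\<integral>x. u x * laplace \<phi> x \<partial>lborel) = (\<integral>x. h x * \<phi> x \<partial>lborel))"

definition H2 :: "L2 set" where
  "H2 = {u. \<forall>is. length is \<le> 2 \<longrightarrow> (\<exists>g. weak_derivative is (rep_L2 u) (rep_L2 g))}"

definition H2_tilde :: "(R3 \<Rightarrow> real) set" where
  "H2_tilde = {u \<in> bcontfun.
     (\<exists>g :: R3 \<Rightarrow> real^3. (\<forall>i. weak_derivative [i] u (\<lambda>x. g x $ i)) \<and>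
        square_integrable (\<lambda>x. norm (g x))) \<and>
     (\<exists>h. square_integrable h \<and> weak_laplacian u h)}"


section \<open>Nonlinear operators and relations\<close>

text \<open>Operators, including nonlinear and not everywhere defined ones, are represented by their
  graphs.\<close>

definition graph_of :: "('a \<Rightarrow> 'b) \<Rightarrow> ('a \<times> 'b) set" where
  "graph_of f = {(x, f x) | x. True}"

definition rel_add :: "('a \<times> 'b::plus) set \<Rightarrow> ('a \<times> 'b) set \<Rightarrow> ('a \<times> 'b) set" where
  "rel_add A B = {(x, a + b) | x a b. (x, a) \<in> A \<and> (x, b) \<in> B}"

definition everywhere_defined_map :: "('a \<times> 'b) set \<Rightarrow> bool" where
  "everywhere_defined_map A \<longleftrightarrow> single_valued A \<and> Domain A = UNIV"

definition monotone_of_type :: "real \<Rightarrow> ('a::real_inner \<times> 'a) set \<Rightarrow> bool" where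
  "monotone_of_type \<omega> A \<longleftrightarrow>
     (\<forall>(\<xi>, \<xi>')\<in>A. \<forall>(\<zeta>, \<zeta>')\<in>A. (\<xi>' - \<zeta>') \<bullet> (\<xi> - \<zeta>) \<ge> - \<omega> * (norm (\<xi> - \<zeta>))\<^sup>2)"

definition maximal_monotone_of_type :: "real \<Rightarrow> ('a::real_inner \<times> 'a) set \<Rightarrow> bool" where
  "maximal_monotone_of_type \<omega> A \<longleftrightarrow>
     monotone_of_type \<omega> A \<and> (\<forall>B. monotone_of_type \<omega> B \<longrightarrow> \<not> A \<subset> B)"

definition maximal_monotone_operator ::
    "('h::{real_inner, complete_space} \<times> 'h) set \<Rightarrow> bool" where
  "maximal_monotone_operator A \<longleftrightarrow>
     single_valued A \<and>
     (\<forall>(u, f)\<in>A. \<forall>(v, g)\<in>A. (f - g) \<bullet> (u - v) \<ge> 0) \<and>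
     (\<exists>l>0. Range (rel_add A (graph_of (\<lambda>u. l *\<^sub>R u))) = UNIV)"

definition resolvent :: "('h::real_vector \<times> 'h) set \<Rightarrow> real \<Rightarrow> ('h \<times> 'h) set" where
  "resolvent A l = (rel_add A (graph_of (\<lambda>u. l *\<^sub>R u)))\<inverse>"


section \<open>Point interactions\<close>

text \<open>The \<open>n\<close>-point set is given by an injective enumeration \<open>Y\<close> with a finite index type of
  cardinality \<open>n\<close>. At \<open>x = Y i\<close> the kernels below take the value \<open>0\<close> by the convention
  \<open>a / 0 = 0\<close>; this concerns a null set only.\<close>

definition M_matrix :: "('n::finite \<Rightarrow> R3) \<Rightarrow> real \<Rightarrow> real^'n^'n" where
  "M_matrix Y l = (\<chi> i j. (1 / (4 * pi)) *
     (if i = j then sqrt l else - (exp (- sqrt l * norm (Y i - Y j)) / norm (Y i - Y j))))"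

definition is_eigenvalue :: "real^'n^'n \<Rightarrow> real \<Rightarrow> bool" where
  "is_eigenvalue A c \<longleftrightarrow> (\<exists>v. v \<noteq> 0 \<and> A *v v = c *\<^sub>R v)"

definition smallest_eigenvalue :: "real^'n^'n \<Rightarrow> real \<Rightarrow> bool" where
  "smallest_eigenvalue A c \<longleftrightarrow> is_eigenvalue A c \<and> (\<forall>d. is_eigenvalue A d \<longrightarrow> c \<le> d)"

definition G :: "('n::finite \<Rightarrow> R3) \<Rightarrow> real \<Rightarrow> real^'n \<Rightarrow> L2" where
  "G Y l \<xi> =
     abs_L2 (\<lambda>x. \<Sum>i\<in>UNIV. exp (- sqrt l * norm (x - Y i)) / (4 * pi * norm (x - Y i)) * \<xi> $ i)"

definition G_adjoint :: "('n::finite \<Rightarrow> R3) \<Rightarrow> real \<Rightarrow> L2 \<Rightarrow> real^'n" where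
  "G_adjoint Y l u =
     (\<chi> i. \<integral>x. exp (- sqrt l * norm (x - Y i)) / (4 * pi * norm (x - Y i)) * rep_L2 u x \<partial>lborel)"

definition G0 :: "('n::finite \<Rightarrow> R3) \<Rightarrow> real^'n \<Rightarrow> R3 \<Rightarrow> real" where
  "G0 Y \<xi> = (\<lambda>x. 1 / (4 * pi) * (\<Sum>i\<in>UNIV. \<xi> $ i / norm (x - Y i)))"

definition tau_tilde :: "('n::finite \<Rightarrow> R3) \<Rightarrow> real^'n \<Rightarrow> (R3 \<Rightarrow> real) \<Rightarrow> real^'n" where
  "tau_tilde Y \<xi> u = (\<chi> i. Lim (at (Y i)) (\<lambda>x. u x - 1 / (4 * pi) * (\<xi> $ i / norm (x - Y i))))"

definition neg_laplacian :: "(L2 \<times> L2) set" where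
  "neg_laplacian = {(u, - h) | u h. u \<in> H2 \<and> weak_laplacian (rep_L2 u) (rep_L2 h)}"

definition neg_laplacian_Theta ::
    "('n::finite \<Rightarrow> R3) \<Rightarrow> ((real^'n) \<times> (real^'n)) set \<Rightarrow> (L2 \<times> L2) set" where
  "neg_laplacian_Theta Y \<Theta> =
     {(u, - h) | u h. \<exists>u\<^sub>0 \<xi>. u\<^sub>0 \<in> H2_tilde \<and>
        (AE x in lborel. rep_L2 u x = u\<^sub>0 x + G0 Y \<xi> x) \<and>
        (\<xi>, tau_tilde Y \<xi> (\<lambda>x. u\<^sub>0 x + G0 Y \<xi> x)) \<in> \<Theta> \<and>
        weak_laplacian u\<^sub>0 (rep_L2 h)}"

end

theory Submission
  imports Defs
begin

text \<open>The resolvent \<open>R\<^sub>l = (-\<Delta> + l)\<^sup>-\<^sup>1\<close> is convolution with the kernel \<open>exp (- sqrt l |x|) / (4 \<pi> |x|)\<close>. That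
  the kernel is a fundamental solution follows by regularising \<open>|x|\<close> to \<open>sqrt (|x|\<^sup>2 + \<epsilon>\<^sup>2)\<close>, uniqueness
  by testing with cut-off convolutions, and \<open>H\<^sup>2\<close> regularity because the functions \<open>(l - \<Delta>) \<psi>\<close> are dense
  in \<open>L\<^sup>2\<close> and control the second derivatives of \<open>\<psi>\<close>; no Fourier transform is needed.

  A function \<open>u = u\<^sub>0 + G\<^sub>0 \<xi>\<close> with \<open>-\<Delta> u\<^sub>0 + l u = f\<close> equals \<open>R\<^sub>l f + G\<^sub>l \<xi>\<close>, and its trace is
  \<open>G\<^sub>l\<^sup>* f - M\<^sub>l \<xi>\<close>. The resolvent formula thus amounts to inverting \<open>\<Theta> + M\<^sub>l\<close>, which is Minty's theorem
  for \<open>\<Theta> + \<gamma>\<^sub>0\<close> because \<open>M\<^sub>l > M\<^sub>0 \<ge> \<gamma>\<^sub>0\<close>: the first inequality comes from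
  \<open>M\<^sub>l - M\<^sub>\<mu> = (l - \<mu>) G\<^sub>l\<^sup>* G\<^sub>\<mu>\<close> and \<open>R\<^sub>\<mu> \<ge> 0\<close>. For monotonicity take \<open>(u, f)\<close>, \<open>(v, g)\<close> in the operator and set
  \<open>F = f - g + l (u - v)\<close>; then \<open>\<langle>F, u - v\<rangle> = \<langle>F, R\<^sub>l F\<rangle> + G\<^sub>l\<^sup>* F \<bullet> (\<xi> - \<zeta>) \<ge> 0\<close> for every \<open>l > 0\<close>, and \<open>l \<rightarrow> 0\<close>
  gives the claim.\<close>

section \<open>Smooth functions\<close>

text \<open>Neither \<open>u\<^sub>0\<close> nor \<open>G\<^sub>0 \<xi>\<close> need be square
  integrable, so the L2 theory cannot be applied to the two summands separately. What helps is the
  difference \<open>G\<^sub>l \<xi> - G\<^sub>0 \<xi>\<close>: the singularities cancel, leaving a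
  bounded continuous function with square integrable gradient and Laplacian
  \<open>l G\<^sub>l \<xi>\<close>. It transfers the problem to \<open>u - G\<^sub>l \<xi>\<close>,
  which is in L2, and its values at the points of \<open>Y\<close> produce the matrix
  \<open>M\<^sub>0 - M\<^sub>l\<close>.

  The trace is a point value, so identities of L2 classes have to be upgraded to pointwise ones by
  continuity of both sides.

  Strictness of \<open>M\<^sub>l > M\<^sub>0\<close> comes from
  \<open>G\<^sub>l \<xi> \<noteq> 0\<close>, that is, from the fact that a nonzero combination of
  point masses is not in L2; the same fact makes the operator single-valued. The gap between
  \<open>M\<^sub>l\<close> and \<open>\<gamma>\<^sub>0\<close> closes as l tends to 0, and
  \<open>G\<^sub>0 \<xi>\<close> is no element of L2 to work with in general; hence monotonicity is
  obtained at each positive l with an error \<open>l |u - v|\<^sup>2\<close>. There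
  \<open>G\<^sub>l\<^sup>* F \<bullet> (\<xi> - \<zeta>) \<ge> 0\<close> holds because
  \<open>G\<^sub>l\<^sup>* F\<close> is the difference of the traces plus
  \<open>M\<^sub>l (\<xi> - \<zeta>)\<close>.\<close>

lemma partial_eq:
  assumes "(f has_derivative D) (at x)"
  shows "partial i f x = D (axis i 1)"
  using frechet_derivative_at[OF assms] by (simp add: partial_def)

lemma partials_snoc: "partials (is @ [i]) f = partials is (partial i f)"
  by (simp add: partials_def)

lemma partials_Cons: "partials (i # is) f = partial i (partials is f)"
  by (simp add: partials_def)

lemma partials_Nil [simp]: "partials [] f = f"
  by (simp add: partials_def)

lemma partials_pair: "partials [i, j] f = partial i (partial j f)"
  by (simp add: partials_def)

text \<open>The hierarchy starts at differentiability instead of continuity: level k says that all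
  iterated partials of order at most k are differentiable. The closure rules then become inductions
  on k that never mention continuity.\<close>

primrec Ck :: "nat \<Rightarrow> (R3 \<Rightarrow> real) \<Rightarrow> bool" where
  "Ck 0 f \<longleftrightarrow> (\<forall>x. f differentiable (at x))"
| "Ck (Suc k) f \<longleftrightarrow> (\<forall>x. f differentiable (at x)) \<and> (\<forall>i. Ck k (partial i f))"

definition smooth :: "(R3 \<Rightarrow> real) \<Rightarrow> bool" where
  "smooth f \<longleftrightarrow> (\<forall>k. Ck k f)"

lemma Ck_differentiable: "Ck k f \<Longrightarrow> f differentiable (at x)"
  by (cases k) auto

lemma Ck_Suc_imp: "Ck (Suc k) f \<Longrightarrow> Ck k f"
  by (induction k arbitrary: f) auto

lemma smooth_differentiable: "smooth f \<Longrightarrow> f differentiable (at x)"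
  by (auto simp: smooth_def intro: Ck_differentiable)

lemma smooth_partial: "smooth f \<Longrightarrow> smooth (partial i f)"
  unfolding smooth_def by (metis Ck.simps(2))

lemma smooth_partials: "smooth f \<Longrightarrow> smooth (partials is f)"
  by (induction "is") (auto simp: partials_Cons intro: smooth_partial)

text \<open>\<open>Ck\<close> strips the innermost derivative, whereas a list in
  \<open>partials\<close> grows by the outermost one; \<open>partials_snoc\<close> recognises the
  iterated partials of \<open>partial i g\<close> among those of \<open>g\<close>. This is the link
  to the condition in \<open>test_function\<close>.\<close>

lemma smooth_iff_partials: "smooth f \<longleftrightarrow> (\<forall>is x. partials is f differentiable (at x))"
proof
  assume "smooth f"
  then show "\<forall>is x. partials is f differentiable (at x)"
    by (auto intro: smooth_differentiable smooth_partials)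
next
  assume *: "\<forall>is x. partials is f differentiable (at x)"
  have "Ck k g" if "\<forall>is x. partials is g differentiable (at x)" for k g
    using that
  proof (induction k arbitrary: g)
    case 0
    then show ?case by (auto dest: spec[of _ "[]"])
  next
    case (Suc k)
    have "\<forall>is x. partials is (partial i g) differentiable (at x)" for i
      using Suc.prems by (metis partials_snoc)
    then show ?case using Suc by (auto dest: spec[of _ "[]"])
  qed
  with * show "smooth f" by (simp add: smooth_def)
qed

lemma partial_const: "partial i (\<lambda>x. c) = (\<lambda>x. 0)"
  by (rule ext, subst partial_eq[where D = "\<lambda>_. 0"]) auto

lemma partial_add:
  assumes "f differentiable (at x)" "g differentiable (at x)"
  shows "partial i (\<lambda>x. f x + g x) x = partial i f x + partial i g x"
  by (subst partial_eq[OF has_derivative_add[OF assms[unfolded frechet_derivative_works]]])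
     (simp add: partial_def)

lemma partial_mult:
  assumes "f differentiable (at x)" "g differentiable (at x)"
  shows "partial i (\<lambda>x. f x * g x) x = partial i f x * g x + f x * partial i g x"
  by (subst partial_eq[OF has_derivative_mult[OF assms[unfolded frechet_derivative_works]]])
     (simp add: partial_def)

lemma partial_compose:
  assumes "(h has_real_derivative h') (at (f x))" "f differentiable (at x)"
  shows "partial i (\<lambda>x. h (f x)) x = h' * partial i f x"
proof -
  have "((\<lambda>x. h (f x)) has_derivative (\<lambda>v. h' * frechet_derivative f (at x) v)) (at x)"
    using has_derivative_compose[OF assms(2)[unfolded frechet_derivative_works]]
      assms(1)[unfolded has_field_derivative_def] by fastforce
  from partial_eq[OF this] show ?thesis by (simp add: partial_def)
qed

lemma Ck_const: "Ck k (\<lambda>x. c)"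
  by (induction k arbitrary: c) (auto simp: partial_const)

lemma Ck_add: "Ck k f \<Longrightarrow> Ck k g \<Longrightarrow> Ck k (\<lambda>x. f x + g x)"
proof (induction k arbitrary: f g)
  case (Suc k)
  then have "partial i (\<lambda>x. f x + g x) = (\<lambda>x. partial i f x + partial i g x)" for i
    by (intro ext partial_add) auto
  then show ?case using Suc by auto
qed auto

lemma Ck_mult: "Ck k f \<Longrightarrow> Ck k g \<Longrightarrow> Ck k (\<lambda>x. f x * g x)"
proof (induction k arbitrary: f g)
  case (Suc k)
  then have "partial i (\<lambda>x. f x * g x) = (\<lambda>x. partial i f x * g x + f x * partial i g x)" for i
    by (intro ext partial_mult) auto
  then show ?case using Suc Ck_Suc_imp[of k f] Ck_Suc_imp[of k g] by (auto intro!: Ck_add)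
qed auto

lemma differentiable_compose_real:
  assumes "(h has_real_derivative h') (at (f x))" "f differentiable (at x)"
  shows "(\<lambda>x. h (f x)) differentiable (at x)"
  using has_derivative_compose[OF assms(2)[unfolded frechet_derivative_works]]
      assms(1)[unfolded has_field_derivative_def] by (auto simp: differentiable_def)

text \<open>The outer function is given with all its derivatives as a sequence, because one
  differentiation turns \<open>h n (f x)\<close> into \<open>h (Suc n) (f x)\<close> times a partial
  of \<open>f\<close>; the induction on k therefore generalises over n.\<close>

lemma Ck_compose:
  assumes "\<And>n t. (h n has_real_derivative h (Suc n) t) (at t)" "Ck k f"
  shows "Ck k (\<lambda>x. h n (f x))"
  using assms(2)
proof (induction k arbitrary: n)
  case 0
  then show ?case using differentiable_compose_real[OF assms(1), of f] by simp
next
  case (Suc k)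
  then have "partial i (\<lambda>x. h n (f x)) = (\<lambda>x. h (Suc n) (f x) * partial i f x)" for i
    by (intro ext partial_compose[OF assms(1)]) (simp add: Ck_differentiable)
  moreover have "Ck k (\<lambda>x. h (Suc n) (f x) * partial i f x)" for i
    using Suc Ck_Suc_imp[of k f] by (intro Ck_mult) auto
  ultimately show ?case using differentiable_compose_real[OF assms(1), of f] Suc.prems by simp
qed

lemma smooth_const: "smooth (\<lambda>x. c)"
  by (simp add: smooth_def Ck_const)

lemma smooth_add: "smooth f \<Longrightarrow> smooth g \<Longrightarrow> smooth (\<lambda>x. f x + g x)"
  by (simp add: smooth_def Ck_add)

lemma smooth_mult: "smooth f \<Longrightarrow> smooth g \<Longrightarrow> smooth (\<lambda>x. f x * g x)"
  by (simp add: smooth_def Ck_mult)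

lemma smooth_prod: "(\<And>i. i \<in> I \<Longrightarrow> smooth (f i)) \<Longrightarrow> smooth (\<lambda>x. \<Prod>i\<in>I. f i x)"
  by (induction I rule: infinite_finite_induct) (auto simp: smooth_const smooth_mult)

lemma smooth_sum: "(\<And>i. i \<in> I \<Longrightarrow> smooth (f i)) \<Longrightarrow> smooth (\<lambda>x. \<Sum>i\<in>I. f i x)"
  by (induction I rule: infinite_finite_induct) (auto simp: smooth_const smooth_add)

lemma smooth_compose:
  "(\<And>n t. (h n has_real_derivative h (Suc n) t) (at t)) \<Longrightarrow> smooth f \<Longrightarrow> smooth (\<lambda>x. h n (f x))"
  unfolding smooth_def by (blast intro: Ck_compose)

lemma smooth_component: "smooth (\<lambda>x. x $ i)"
proof -
  have *: "((\<lambda>x. x $ i) has_derivative (\<lambda>v. v $ i)) (at x)" for x :: R3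
    by (rule bounded_linear.has_derivative[OF bounded_linear_vec_nth has_derivative_ident])
  then have "partial j (\<lambda>x. x $ i) = (\<lambda>x. axis j 1 $ i)" for j
    by (intro ext partial_eq) auto
  moreover have "(\<lambda>x. x $ i) differentiable (at x)" for x :: R3
    using * by (auto simp: differentiable_def)
  ultimately have "Ck k (\<lambda>x. x $ i)" for k
    by (cases k) (auto simp: Ck_const)
  then show ?thesis by (simp add: smooth_def)
qed

lemma smooth_cmult: "smooth f \<Longrightarrow> smooth (\<lambda>x. c * f x)"
  by (intro smooth_mult smooth_const)

lemma smooth_diff: "smooth f \<Longrightarrow> smooth g \<Longrightarrow> smooth (\<lambda>x. f x - g x)"
  using smooth_add[OF _ smooth_cmult[of g "-1"]] by simp

lemma smooth_norm_sq: "smooth (\<lambda>x. (norm (x - a))\<^sup>2)"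
proof -
  have "smooth (\<lambda>x. \<Sum>i\<in>UNIV. (x $ i - a $ i) * (x $ i - a $ i))"
    by (intro smooth_sum smooth_mult smooth_diff smooth_component smooth_const)
  then show ?thesis
    unfolding power2_norm_eq_inner inner_vec_def by simp
qed

lemma smooth_continuous: "smooth f \<Longrightarrow> continuous_on UNIV f"
  by (meson continuous_at_imp_continuous_on differentiable_imp_continuous_within smooth_differentiable)

subsection \<open>Bump functions\<close>

text \<open>The derivatives of \<open>exp (- 1 / t)\<close> are \<open>poly (bump_poly n) (1 / t) * exp (- 1 / t)\<close>.\<close>

primrec bump_poly :: "nat \<Rightarrow> real poly" where
  "bump_poly 0 = 1"
| "bump_poly (Suc n) = monom 1 2 * (bump_poly n - pderiv (bump_poly n))"

definition bump :: "nat \<Rightarrow> real \<Rightarrow> real" where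
  "bump n t = (if t > 0 then poly (bump_poly n) (1 / t) * exp (- (1 / t)) else 0)"

lemma poly_exp_tendsto_0: "((\<lambda>s. poly p s * exp (- s)) \<longlongrightarrow> (0::real)) at_top"
proof -
  have "((\<lambda>s. \<Sum>i\<le>degree p. coeff p i * (s ^ i / exp s)) \<longlongrightarrow> (\<Sum>i\<le>degree p. coeff p i * 0)) at_top"
    by (intro tendsto_sum tendsto_mult tendsto_const tendsto_power_div_exp_0)
  then show ?thesis
    by (simp add: poly_altdef sum_distrib_right exp_minus field_simps sum_distrib_left)
qed

lemma bump_has_derivative: "(bump n has_real_derivative bump (Suc n) t) (at t)"
proof -
  consider "t > 0" | "t < 0" | "t = 0" by linarith
  then show ?thesis
  proof cases
    case 1
    \<comment> \<open>In the variable s = 1/t, differentiation by t is - s^2 d/ds, so p(s) exp(-s)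
      becomes s^2 (p - p')(s) exp(-s). This is the recursion of \<open>bump_poly\<close>.\<close>
    have "((\<lambda>t. poly (bump_poly n) (1 / t) * exp (- (1 / t))) has_real_derivative bump (Suc n) t) (at t)"
      using 1
      by (auto intro!: derivative_eq_intros poly_DERIV simp: bump_def poly_monom power2_eq_square field_simps)
    then show ?thesis
    proof (rule has_field_derivative_transform_within_open[of _ _ _ "{0<..}"])
    qed (use 1 in \<open>auto simp: bump_def\<close>)
  next
    case 2
    have "((\<lambda>t. 0) has_real_derivative bump (Suc n) t) (at t)"
      using 2 by (auto simp: bump_def)
    then show ?thesis
      by (rule has_field_derivative_transform_within_open[of _ _ _ "{..<0}"])
         (use 2 in \<open>auto simp: bump_def\<close>)
  next
    case 3
    have "((\<lambda>t. bump n t / t) \<longlongrightarrow> 0) (at 0)"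
      
    proof (rule filterlim_split_at)
      \<comment> \<open>Dividing by t multiplies the polynomial by s = 1/t, which is the effect of
        \<open>pCons 0\<close>.\<close>
      have "((\<lambda>s. poly (pCons 0 (bump_poly n)) s * exp (- s)) \<longlongrightarrow> 0) at_top"
        by (rule poly_exp_tendsto_0)
      then have "((\<lambda>t. poly (pCons 0 (bump_poly n)) (inverse t) * exp (- inverse t)) \<longlongrightarrow> 0) (at_right (0::real))"
        by (rule filterlim_compose[OF _ filterlim_inverse_at_top_right])
      then show "((\<lambda>t. bump n t / t) \<longlongrightarrow> 0) (at_right 0)"
        by (rule Lim_transform_eventually)
           (auto simp: bump_def field_simps eventually_at_filter)
      show "((\<lambda>t. bump n t / t) \<longlongrightarrow> 0) (at_left 0)"
        by (rule tendsto_eventually) (auto simp: bump_def eventually_at_filter)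
    qed
    then show ?thesis using 3
      by (simp add: has_field_derivative_iff bump_def)
  qed
qed

lemma bump_0: "bump 0 t = (if t > 0 then exp (- (1 / t)) else 0)"
  by (simp add: bump_def)

lemma bump_0_bounds: "0 \<le> bump 0 t" "bump 0 t \<le> 1"
  by (auto simp: bump_0)

lemma bump_0_eq_0_iff: "bump 0 t = 0 \<longleftrightarrow> t \<le> 0"
  by (auto simp: bump_0)

text \<open>Scaling the argument makes the transition steep, which yields smooth approximations of
  the indicator of the positive half-line and, by taking products, of boxes.\<close>

lemma bump_0_scaled_tendsto:
  "(\<lambda>n. bump 0 (real n * t)) \<longlonglongrightarrow> (if t > 0 then 1 else 0)"
proof (cases "t > 0")
  case True
  have "(\<lambda>n. exp (- (1 / t) * (1 / real n))) \<longlonglongrightarrow> exp (- (1 / t) * 0)"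
    by (intro tendsto_intros lim_1_over_n)
  then show ?thesis using True
    by (auto elim!: Lim_transform_eventually intro: eventually_mono[OF eventually_gt_at_top[of 0]]
        simp: bump_0 field_simps)
qed (auto simp: bump_0 zero_less_mult_iff)

lemma smooth_bump: "smooth f \<Longrightarrow> smooth (\<lambda>x. bump n (f x))"
  using smooth_compose[of bump f n] bump_has_derivative by blast

section \<open>Test functions\<close>

lemma sets_borel_cball [measurable]: "cball (a::R3) R \<in> sets borel"
  by (simp add: borel_closed)

lemma test_function_iff:
  "test_function \<phi> \<longleftrightarrow> smooth \<phi> \<and> (\<exists>R. \<forall>x. norm x > R \<longrightarrow> \<phi> x = 0)"
proof -
  have "compact (closure {x. \<phi> x \<noteq> 0}) \<longleftrightarrow> (\<exists>R. \<forall>x. norm x > R \<longrightarrow> \<phi> x = 0)"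
    unfolding compact_closure bounded_iff by (simp add: Ball_def) (metis not_le)
  then show ?thesis by (simp add: test_function_def smooth_iff_partials)
qed

lemma test_smooth: "test_function \<phi> \<Longrightarrow> smooth \<phi>"
  by (simp add: test_function_iff)

lemma test_differentiable: "test_function \<phi> \<Longrightarrow> \<phi> differentiable (at x)"
  by (simp add: test_smooth smooth_differentiable)

lemma test_continuous: "test_function \<phi> \<Longrightarrow> continuous_on UNIV \<phi>"
  by (simp add: test_smooth smooth_continuous)

lemma test_measurable: "test_function \<phi> \<Longrightarrow> \<phi> \<in> borel_measurable borel"
  by (rule borel_measurable_continuous_onI) (rule test_continuous)

lemma partial_eq_0_outside:
  assumes "\<And>x. norm x > R \<Longrightarrow> \<phi> x = 0" "norm x > R"
  shows "partial i \<phi> x = 0"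
proof -
  have "open {x::R3. norm x > R}"
    by (intro open_Collect_less continuous_intros)
  then have "(\<phi> has_derivative (\<lambda>_. 0)) (at x)"
    by (intro has_derivative_transform_within_open[of "\<lambda>_. 0" "\<lambda>_. 0" x _ "{x. norm x > R}" \<phi>])
       (use assms in auto)
  then show ?thesis by (simp add: partial_eq)
qed

lemma test_partial: "test_function \<phi> \<Longrightarrow> test_function (partial i \<phi>)"
  unfolding test_function_iff using partial_eq_0_outside smooth_partial by blast

lemma test_partials: "test_function \<phi> \<Longrightarrow> test_function (partials is \<phi>)"
  by (induction "is") (auto simp: partials_Cons intro: test_partial)

lemma test_mult_left: "smooth f \<Longrightarrow> test_function \<phi> \<Longrightarrow> test_function (\<lambda>x. f x * \<phi> x)"
  unfolding test_function_iff using smooth_mult by fastforce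

lemma test_mult_right: "test_function \<phi> \<Longrightarrow> smooth f \<Longrightarrow> test_function (\<lambda>x. \<phi> x * f x)"
  unfolding test_function_iff using smooth_mult by fastforce

lemma test_cmult: "test_function \<phi> \<Longrightarrow> test_function (\<lambda>x. c * \<phi> x)"
  by (intro test_mult_left smooth_const)

lemma test_add:
  assumes "test_function \<phi>" "test_function \<psi>"
  shows "test_function (\<lambda>x. \<phi> x + \<psi> x)"
proof -
  obtain R S where "\<forall>x. norm x > R \<longrightarrow> \<phi> x = 0" "\<forall>x. norm x > S \<longrightarrow> \<psi> x = 0"
    using assms by (auto simp: test_function_iff)
  then have "\<forall>x. norm x > max R S \<longrightarrow> \<phi> x + \<psi> x = 0" by simp
  then show ?thesis using assms smooth_add unfolding test_function_iff by blast
qed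

lemma test_zero: "test_function (\<lambda>x. 0)"
  by (simp add: test_function_iff smooth_const)

lemma test_sum: "(\<And>i. i \<in> I \<Longrightarrow> test_function (f i)) \<Longrightarrow> test_function (\<lambda>x. \<Sum>i\<in>I. f i x)"
  by (induction I rule: infinite_finite_induct) (auto simp: test_zero test_add)

lemma test_diff: "test_function \<phi> \<Longrightarrow> test_function \<psi> \<Longrightarrow> test_function (\<lambda>x. \<phi> x - \<psi> x)"
  using test_add[OF _ test_cmult[of \<psi> "-1"]] by simp

lemma test_laplace: "test_function \<phi> \<Longrightarrow> test_function (laplace \<phi>)"
  unfolding laplace_def by (intro test_sum test_partials)

lemma continuous_compact_support_bound:
  fixes f :: "R3 \<Rightarrow> real"
  assumes "continuous_on UNIV f" "\<And>x. norm x > R \<Longrightarrow> f x = 0"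
  obtains B where "B \<ge> 0" "\<And>x. \<bar>f x\<bar> \<le> B * indicator (cball 0 R) x"
proof -
  have "bounded (f ` cball 0 R)"
    by (intro compact_imp_bounded compact_continuous_image continuous_on_subset[OF assms(1)]) auto
  then obtain B where B: "\<forall>x\<in>cball 0 R. \<bar>f x\<bar> \<le> B"
    by (auto simp: bounded_iff)
  then have "\<bar>f x\<bar> \<le> \<bar>B\<bar> * indicator (cball 0 R) x" for x
    using assms(2)[of x] bspec[OF B, of x] by (cases "norm x \<le> R") (auto intro: order_trans[OF _ abs_ge_self])
  then show ?thesis by (intro that[of "\<bar>B\<bar>"]) auto
qed

lemma test_bound:
  assumes "test_function \<phi>"
  obtains B R where "B \<ge> 0" "R > 0" "\<And>x. \<bar>\<phi> x\<bar> \<le> B * indicator (cball 0 R) x"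
proof -
  obtain R where R: "\<And>x. norm x > R \<Longrightarrow> \<phi> x = 0" using assms by (auto simp: test_function_iff)
  then have "\<And>x. norm x > max R 1 \<Longrightarrow> \<phi> x = 0" by simp
  from continuous_compact_support_bound[OF test_continuous[OF assms] this]
  obtain B where "B \<ge> 0" "\<And>x. \<bar>\<phi> x\<bar> \<le> B * indicator (cball 0 (max R 1)) x" by metis
  then show ?thesis by (intro that[of B "max R 1"]) auto
qed

lemma integrable_ball_bound:
  fixes f :: "R3 \<Rightarrow> real"
  assumes "f \<in> borel_measurable borel" "\<And>x. \<bar>f x\<bar> \<le> B * indicator (cball 0 R) x"
  shows "integrable lborel f"
proof (rule Bochner_Integration.integrable_bound)
  show "integrable lborel (\<lambda>x::R3. B * indicator (cball 0 R) x :: real)"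
    using emeasure_bounded_finite[OF bounded_cball, of "0::R3" R] by auto
  show "AE x in lborel. norm (f x) \<le> norm (B * indicator (cball 0 R) x :: real)"
    using assms(2) by (intro AE_I2) (metis abs_ge_self order_trans real_norm_def)
qed (use assms in simp)

lemma test_integrable: "test_function \<phi> \<Longrightarrow> integrable lborel \<phi>"
  using test_bound[of \<phi>] integrable_ball_bound test_measurable by metis

lemma test_square_integrable: "test_function \<phi> \<Longrightarrow> square_integrable \<phi>"
  using test_integrable[of "\<lambda>x. \<phi> x * \<phi> x"] test_mult_left[of \<phi> \<phi>]
  by (simp add: square_integrable_def test_measurable test_smooth power2_eq_square)

lemma locally_integrable_ball:
  assumes "locally_integrable f"
  shows "integrable lborel (\<lambda>x. f x * indicator (cball 0 R) x)"
  using assms unfolding locally_integrable_def set_integrable_def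
  by (auto simp: mult.commute)

lemma locally_integrableI:
  assumes "f \<in> borel_measurable borel" "\<And>R. integrable lborel (\<lambda>x. f x * indicator (cball 0 R) x)"
  shows "locally_integrable f"
  unfolding locally_integrable_def
proof (intro conjI allI impI)
  fix K :: "R3 set" assume K: "compact K"
  obtain R where R: "\<And>x. x \<in> K \<Longrightarrow> norm x \<le> R"
    using compact_imp_bounded[OF K] by (auto simp: bounded_iff)
  have [measurable]: "K \<in> sets borel" using K by (simp add: compact_imp_closed borel_closed)
  show "set_integrable lborel K f"
    unfolding set_integrable_def
  proof (rule Bochner_Integration.integrable_bound[OF assms(2)[of R]])
    show "AE x in lborel. norm (indicator K x *\<^sub>R f x) \<le> norm (f x * indicator (cball 0 R) x)"
      using R by (intro AE_I2) (simp add: indicator_def)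
  qed (use assms(1) in simp)
qed (use assms in simp)

lemma integrable_locally_mult_test:
  assumes "locally_integrable f" "test_function \<phi>"
  shows "integrable lborel (\<lambda>x. f x * \<phi> x)"
proof -
  obtain B R where BR: "B \<ge> 0" "R > 0" "\<And>x. \<bar>\<phi> x\<bar> \<le> B * indicator (cball 0 R) x"
    using test_bound[OF assms(2)] by metis
  show ?thesis
  proof (rule Bochner_Integration.integrable_bound)
    show "integrable lborel (\<lambda>x. B * (f x * indicator (cball 0 R) x))"
      by (intro integrable_mult_right locally_integrable_ball assms)
    show "(\<lambda>x. f x * \<phi> x) \<in> borel_measurable lborel"
      using assms test_measurable by (auto simp: locally_integrable_def)
    show "AE x in lborel. norm (f x * \<phi> x) \<le> norm (B * (f x * indicator (cball 0 R) x))"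
    proof (rule AE_I2)
      fix x
      have "\<bar>f x\<bar> * \<bar>\<phi> x\<bar> \<le> \<bar>f x\<bar> * (B * indicator (cball 0 R) x)"
        by (intro mult_left_mono BR) auto
      then show "norm (f x * \<phi> x) \<le> norm (B * (f x * indicator (cball 0 R) x))"
        using BR(1) by (simp add: abs_mult mult.left_commute)
    qed
  qed
qed

lemma square_integrable_locally:
  assumes "square_integrable f" shows "locally_integrable f"
proof (rule locally_integrableI)
  show m: "f \<in> borel_measurable borel" using assms by (simp add: square_integrable_def)
  fix R
  have "square_integrable (indicator (cball 0 R))"
    unfolding square_integrable_def
  proof
    show "integrable lborel (\<lambda>x::R3. (indicator (cball 0 R) x)\<^sup>2 :: real)"
      by (rule integrable_ball_bound[of _ 1 R]) (measurable, auto simp: indicator_def)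
  qed measurable
  from square_integrable_mult[OF assms this]
  show "integrable lborel (\<lambda>x. f x * indicator (cball 0 R) x)" .
qed

lemma continuous_locally_integrable:
  assumes "continuous_on UNIV f" shows "locally_integrable f"
proof (rule locally_integrableI)
  show m [measurable]: "f \<in> borel_measurable borel"
    using assms by (rule borel_measurable_continuous_onI)
  fix R
  have "bounded (f ` cball 0 R)"
    by (intro compact_imp_bounded compact_continuous_image continuous_on_subset[OF assms(1)]) auto
  then obtain B where B: "\<forall>x\<in>cball 0 R. \<bar>f x\<bar> \<le> B"
    by (auto simp: bounded_iff)
  then have "\<bar>f x * indicator (cball 0 R) x\<bar> \<le> B * indicator (cball 0 R) x" for x
    using bspec[OF B, of x] by (cases "norm x \<le> R") auto
  then show "integrable lborel (\<lambda>x. f x * indicator (cball 0 R) x)"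
    by (intro integrable_ball_bound[where B = B and R = R]) measurable
qed

lemma locally_integrable_add:
  "locally_integrable f \<Longrightarrow> locally_integrable g \<Longrightarrow> locally_integrable (\<lambda>x. f x + g x)"
  unfolding locally_integrable_def by (auto intro: set_integral_add(1))

lemma locally_integrable_cmult:
  "locally_integrable f \<Longrightarrow> locally_integrable (\<lambda>x. c * f x)"
  unfolding locally_integrable_def by (auto intro: set_integrable_mult_right)

lemma locally_integrable_sum:
  "(\<And>i. i \<in> I \<Longrightarrow> locally_integrable (f i)) \<Longrightarrow> locally_integrable (\<lambda>x. \<Sum>i\<in>I. f i x)"
proof (induction I rule: infinite_finite_induct)
qed (auto intro: locally_integrable_add continuous_locally_integrable)

subsection \<open>Integration by parts\<close>

lemma lborel_integral_shift:
  fixes f :: "'a::euclidean_space \<Rightarrow> real"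
  assumes "f \<in> borel_measurable borel"
  shows "(\<integral>x. f (c + x) \<partial>lborel) = (\<integral>x. f x \<partial>lborel)"
  by (subst (2) lborel_distr_plus[of c, symmetric], subst integral_distr) (use assms in auto)

lemma lborel_integrable_shift:
  fixes f :: "'a::euclidean_space \<Rightarrow> real"
  assumes "integrable lborel f"
  shows "integrable lborel (\<lambda>x. f (c + x))"
proof -
  have "integrable (distr lborel borel ((+) c)) f"
    using assms by (simp add: lborel_distr_plus)
  then show ?thesis
    by (subst (asm) integrable_distr_eq) (use assms in auto)
qed

lemma partial_line:
  assumes "F differentiable (at (x + s *\<^sub>R axis i 1))"
  shows "((\<lambda>s. F (x + s *\<^sub>R axis i 1)) has_real_derivative partial i F (x + s *\<^sub>R axis i 1)) (at s)"
proof -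
  let ?D = "frechet_derivative F (at (x + s *\<^sub>R axis i 1))"
  have D: "(F has_derivative ?D) (at (x + s *\<^sub>R axis i 1))"
    using assms by (simp add: frechet_derivative_works)
  have "((\<lambda>s. x + s *\<^sub>R axis i 1) has_derivative (\<lambda>t. t *\<^sub>R axis i 1)) (at s)"
    by (auto intro!: derivative_eq_intros)
  from has_derivative_compose[OF this D]
  have "((\<lambda>s. F (x + s *\<^sub>R axis i 1)) has_derivative (\<lambda>t. ?D (t *\<^sub>R axis i 1))) (at s)" .
  moreover have "?D (t *\<^sub>R axis i 1) = partial i F (x + s *\<^sub>R axis i 1) * t" for t
    using linear_cmul[OF has_derivative_linear[OF D]] by (simp add: partial_def)
  ultimately show ?thesis
    by (simp add: has_field_derivative_def mult_commute_abs)
qed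

text \<open>By translation invariance every difference quotient of \<open>F\<close> in direction
  \<open>i\<close> has integral 0, and the quotients converge dominatedly to the partial derivative.
  No iterated integrals over coordinate lines are involved.\<close>

lemma integral_partial_eq_0:
  assumes "\<And>x. F differentiable (at x)" "continuous_on UNIV (partial i F)"
    and "\<And>x. norm x > R \<Longrightarrow> F x = 0"
  shows "(\<integral>x. partial i F x \<partial>lborel) = 0"
proof -
  define e :: R3 where "e = axis i 1"
  have ne: "norm e = 1" by (simp add: e_def)
  have cF: "continuous_on UNIV F"
    using assms(1) by (meson continuous_at_imp_continuous_on differentiable_imp_continuous_within)
  have mF [measurable]: "F \<in> borel_measurable borel" using cF by (rule borel_measurable_continuous_onI)
  have mP [measurable]: "partial i F \<in> borel_measurable borel"
    using assms(2) by (rule borel_measurable_continuous_onI)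
  obtain A where A: "A \<ge> 0" "\<And>x. \<bar>F x\<bar> \<le> A * indicator (cball 0 R) x"
    using continuous_compact_support_bound[OF cF assms(3)] by metis
  have intF: "integrable lborel F" by (rule integrable_ball_bound[OF mF A(2)])
  have P0: "partial i F x = 0" if "norm x > R" for x
    using partial_eq_0_outside[OF assms(3) that] by simp
  obtain B where B: "B \<ge> 0" "\<And>x. \<bar>partial i F x\<bar> \<le> B * indicator (cball 0 R) x"
    using continuous_compact_support_bound[OF assms(2) P0] by metis
  have B': "\<bar>partial i F x\<bar> \<le> B" for x
    using B(2)[of x] B(1) by (cases "norm x \<le> R") auto
  define h where "h n = 1 / real (Suc n)" for n
  have h: "0 < h n" "h n \<le> 1" for n by (auto simp: h_def)
  define d where "d n x = (F (h n *\<^sub>R e + x) - F x) / h n" for n x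
  have lim: "(\<lambda>n. d n x) \<longlonglongrightarrow> partial i F x" for x
  proof -
    have "((\<lambda>t. F (x + t *\<^sub>R e)) has_real_derivative partial i F x) (at 0)"
      using partial_line[of F x 0 i] assms(1) by (simp add: e_def)
    then have "((\<lambda>t. (F (x + t *\<^sub>R e) - F x) / t) \<longlongrightarrow> partial i F x) (at 0)"
      by (simp add: has_field_derivative_iff)
    moreover have "filterlim h (at 0) sequentially"
    proof -
      have "h \<longlonglongrightarrow> 0"
        using LIMSEQ_inverse_real_of_nat by (simp add: h_def [abs_def] divide_inverse)
      then show ?thesis
        unfolding filterlim_at using h by (auto intro!: always_eventually simp: less_imp_neq[symmetric])
    qed
    ultimately show ?thesis
      unfolding d_def by (auto dest: filterlim_compose simp: add.commute)
  qed
  \<comment> \<open>The steps are at most 1, so outside the ball of radius \<open>R + 1\<close> both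
    values of \<open>F\<close> in the quotient vanish; inside, the mean value theorem
    applies.\<close>
  have bnd: "\<bar>d n x\<bar> \<le> B * indicator (cball 0 (R + 1)) x" for n x
  proof (cases "norm x \<le> R + 1")
    case True
    have "\<exists>z. 0 < z \<and> z < h n \<and> F (x + h n *\<^sub>R e) - F (x + 0 *\<^sub>R e) = (h n - 0) * partial i F (x + z *\<^sub>R e)"
      unfolding e_def by (rule MVT2[OF h(1)]) (use partial_line assms(1) in auto)
    then obtain z where "d n x = partial i F (x + z *\<^sub>R e)"
      using h(1)[of n] unfolding d_def by (auto simp: add.commute)
    then show ?thesis using True B' by simp
  next
    case False
    have "norm x \<le> norm (h n *\<^sub>R e + x) + norm (h n *\<^sub>R e)"
      by (metis add_diff_cancel_left' norm_triangle_sub norm_minus_commute add.commute)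
    then have "norm x - norm (h n *\<^sub>R e) \<le> norm (h n *\<^sub>R e + x)" by simp
    then have "norm (h n *\<^sub>R e + x) > R" using False h[of n] ne by simp
    then show ?thesis using False assms(3) by (simp add: d_def)
  qed
  have "(\<lambda>n. \<integral>x. d n x \<partial>lborel) \<longlonglongrightarrow> (\<integral>x. partial i F x \<partial>lborel)"
  proof (rule integral_dominated_convergence[where w="\<lambda>x. B * indicator (cball 0 (R + 1)) x"])
    show "integrable lborel (\<lambda>x::R3. B * indicator (cball 0 (R + 1)) x :: real)"
      using emeasure_bounded_finite[OF bounded_cball, of "0::R3" "R + 1"] by auto
    show "d n \<in> borel_measurable lborel" for n unfolding d_def by measurable
  qed (use lim bnd in auto)
  moreover have "(\<integral>x. d n x \<partial>lborel) = 0" for n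
  proof -
    have "(\<integral>x. d n x \<partial>lborel) = ((\<integral>x. F (h n *\<^sub>R e + x) \<partial>lborel) - (\<integral>x. F x \<partial>lborel)) / h n"
      unfolding d_def using intF lborel_integrable_shift[OF intF, of "h n *\<^sub>R e"] by simp
    then show ?thesis by (simp add: lborel_integral_shift[OF mF])
  qed
  ultimately show ?thesis by (simp add: LIMSEQ_const_iff)
qed

text \<open>Stated for a function with one continuous partial derivative, since it is applied to
  radial functions of \<open>reg_norm\<close> that are only known to have the derivatives computed
  explicitly.\<close>

lemma integration_by_parts:
  assumes "\<And>x. u differentiable (at x)" "continuous_on UNIV (partial i u)" "test_function \<phi>"
  shows "(\<integral>x. u x * partial i \<phi> x \<partial>lborel) = - (\<integral>x. partial i u x * \<phi> x \<partial>lborel)"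
proof -
  have cu: "continuous_on UNIV u"
    using assms(1) by (meson continuous_at_imp_continuous_on differentiable_imp_continuous_within)
  obtain R where R: "\<And>x. norm x > R \<Longrightarrow> \<phi> x = 0" using assms(3) by (auto simp: test_function_iff)
  have eq: "partial i (\<lambda>x. u x * \<phi> x) = (\<lambda>x. partial i u x * \<phi> x + u x * partial i \<phi> x)"
    using assms by (intro ext partial_mult) (auto simp: test_differentiable)
  have "(\<integral>x. partial i (\<lambda>x. u x * \<phi> x) x \<partial>lborel) = 0"
  proof (rule integral_partial_eq_0)
    show "continuous_on UNIV (partial i (\<lambda>x. u x * \<phi> x))"
      unfolding eq by (intro continuous_intros assms cu test_continuous test_partial)
    show "(\<lambda>x. u x * \<phi> x) differentiable (at x)" for x
      using assms by (intro differentiable_mult) (auto simp: test_differentiable)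
  qed (use R in auto)
  moreover have "integrable lborel (\<lambda>x. partial i u x * \<phi> x)" "integrable lborel (\<lambda>x. u x * partial i \<phi> x)"
    using assms cu by (auto intro!: integrable_locally_mult_test continuous_locally_integrable test_partial)
  ultimately show ?thesis unfolding eq by simp
qed

lemma integration_by_parts_test:
  assumes "smooth u" "test_function \<phi>"
  shows "(\<integral>x. u x * partial i \<phi> x \<partial>lborel) = - (\<integral>x. partial i u x * \<phi> x \<partial>lborel)"
  by (intro integration_by_parts assms smooth_differentiable smooth_continuous smooth_partial)

subsection \<open>The fundamental lemma\<close>

text \<open>Open boxes are stable under intersection and generate the Borel sets, so the sets over
  which \<open>f\<close> integrates to 0 form a Dynkin system containing all Borel sets.\<close>

lemma AE_eq_0_if_box_integrals_0:
  fixes f :: "R3 \<Rightarrow> real"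
  assumes f: "integrable lborel f"
    and box: "\<And>a b. (\<integral>x. indicator (box a b) x * f x \<partial>lborel) = 0"
  shows "AE x in lborel. f x = 0"
proof (rule density_unique_real[OF f])
  let ?I = "\<lambda>A. \<integral>x. indicator A x * f x \<partial>lborel"
  have int: "integrable lborel (\<lambda>x. indicator A x * f x)" if "A \<in> sets borel" for A
    using integrable_mult_indicator[of A lborel f] that f by simp
  \<comment> \<open>Closure under complements needs the integral over the whole space, obtained by
    exhausting it with the cubes of half-width n.\<close>
  have tot: "?I UNIV = 0"
  proof -
    have "(\<lambda>n. ?I (box (- (real n *\<^sub>R One)) (real n *\<^sub>R One))) \<longlonglongrightarrow> ?I UNIV"
    proof (rule integral_dominated_convergence[where w="\<lambda>x. \<bar>f x\<bar>"])
      show "AE x in lborel. (\<lambda>n. indicator (box (- (real n *\<^sub>R One)) (real n *\<^sub>R One)) x * f x) \<longlonglongrightarrow> indicator UNIV x * f x"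
      proof (rule AE_I2)
        fix x :: R3
        obtain n0 where n0: "real n0 > norm x" using reals_Archimedean2 by blast
        have "x \<in> box (- (real n *\<^sub>R One)) (real n *\<^sub>R One)" if "n \<ge> n0" for n
        proof -
          have "\<bar>x \<bullet> b\<bar> < real n" if "b \<in> Basis" for b
            using Basis_le_norm[OF that, of x] n0 \<open>n \<ge> n0\<close> by simp
          then show ?thesis by (auto simp: box_def abs_less_iff) (metis minus_less_iff)
        qed
        then show "(\<lambda>n. indicator (box (- (real n *\<^sub>R One)) (real n *\<^sub>R One)) x * f x) \<longlonglongrightarrow> indicator UNIV x * f x"
          by (intro tendsto_eventually) (auto simp: eventually_at_top_linorder intro!: exI[of _ n0])
      qed
    qed (use f in \<open>auto simp: indicator_def\<close>)
    then show ?thesis by (simp add: box LIMSEQ_const_iff)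
  qed
  fix A assume "A \<in> sets (lborel :: R3 measure)"
  then have A: "A \<in> sigma_sets UNIV (range (\<lambda>(a, b). box a b))"
    by (simp add: borel_eq_box)
  have "Int_stable (range (\<lambda>(a::R3, b). box a b))"
    by (auto simp: Int_stable_def box_Int_box)
  moreover have "(range (\<lambda>(a, b). box a b)) \<subseteq> Pow (UNIV :: R3 set)"
    by auto
  ultimately have "?I A = 0" using A
  proof (induction rule: sigma_sets_induct_disjoint)
    case (basic A) then show ?case using box by auto
  next
    case empty then show ?case by simp
  next
    case (compl A)
    then have A: "A \<in> sets borel" by (simp add: borel_eq_box)
    have "?I (UNIV - A) = (\<integral>x. f x - indicator A x * f x \<partial>lborel)"
      by (intro Bochner_Integration.integral_cong) (auto simp: indicator_def)
    also have "\<dots> = ?I UNIV - ?I A" using f int[OF A] by simp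
    finally show ?case using compl tot by simp
  next
    case (union F)
    then have F: "\<And>i. F i \<in> sets borel" by (simp add: borel_eq_box subset_eq)
    have "(\<lambda>n. ?I (\<Union>i<n. F i)) \<longlonglongrightarrow> ?I (\<Union>i. F i)"
    proof (rule integral_dominated_convergence[where w="\<lambda>x. \<bar>f x\<bar>"])
      show "AE x in lborel. (\<lambda>n. indicator (\<Union>i<n. F i) x * f x) \<longlonglongrightarrow> indicator (\<Union>i. F i) x * f x"
        by (intro AE_I2 tendsto_intros LIMSEQ_indicator_UN)
    qed (use f F in \<open>auto simp: indicator_def\<close>)
    moreover have "?I (\<Union>i<n. F i) = 0" for n
    proof (induction n)
      case (Suc n)
      have "?I (\<Union>i<Suc n. F i) = (\<integral>x. indicator (\<Union>i<n. F i) x * f x + indicator (F n) x * f x \<partial>lborel)"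
      proof (rule Bochner_Integration.integral_cong)
        fix x
        show "indicator (\<Union>i<Suc n. F i) x * f x = indicator (\<Union>i<n. F i) x * f x + indicator (F n) x * f x"
        proof -
          have "F n \<inter> (\<Union>i<n. F i) = {}"
          proof -
            have "F n \<inter> F i = {}" if "i < n" for i
              using union(1) that by (simp add: disjoint_family_on_def)
            then show ?thesis by (simp add: Int_UN_distrib)
          qed
          moreover have "(\<Union>i<Suc n. F i) = F n \<union> (\<Union>i<n. F i)"
            by (simp add: lessThan_Suc)
          ultimately show ?thesis
            by (simp only: indicator_disj_union distrib_right add.commute)
        qed
      qed simp
      also have "\<dots> = 0"
        using Suc union F by (subst Bochner_Integration.integral_add) (auto intro!: int)
      finally show ?case .
    qed simp
    ultimately show ?case by (simp add: LIMSEQ_const_iff)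
  qed
  then show "(\<integral>x\<in>A. f x \<partial>lborel) = (\<integral>x\<in>A. 0 \<partial>lborel)"
    by (simp add: set_lebesgue_integral_def)
qed simp

text \<open>If a is below b in every coordinate, the quadratic in coordinate i is positive exactly
  between \<open>a $ i\<close> and \<open>b $ i\<close>. The product is then supported in the box,
  and it tends to the indicator of the box as n grows.\<close>

definition box_bump :: "nat \<Rightarrow> R3 \<Rightarrow> R3 \<Rightarrow> R3 \<Rightarrow> real" where
  "box_bump n a b x = (\<Prod>i\<in>UNIV. bump 0 (real n * ((x $ i - a $ i) * (b $ i - x $ i))))"

lemma mem_box_vec: "(x::R3) \<in> box a b \<longleftrightarrow> (\<forall>i. a $ i < x $ i \<and> x $ i < b $ i)"
  by (simp add: mem_box_cart)

lemma box_bump_bounds: "0 \<le> box_bump n a b x" "box_bump n a b x \<le> 1"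
  by (auto simp: box_bump_def intro!: prod_nonneg prod_le_1 bump_0_bounds)

lemma box_bump_outside:
  assumes "\<And>i. a $ i < b $ i" "x \<notin> box a b"
  shows "box_bump n a b x = 0"
proof -
  obtain i where "x $ i \<le> a $ i \<or> x $ i \<ge> b $ i"
    using assms(2) unfolding mem_box_vec by (meson not_le)
  then have "(x $ i - a $ i) * (b $ i - x $ i) \<le> 0"
    using assms(1)[of i] by (auto simp: mult_le_0_iff)
  then have "bump 0 (real n * ((x $ i - a $ i) * (b $ i - x $ i))) = 0"
    by (simp add: bump_0_eq_0_iff mult_nonneg_nonpos)
  then show ?thesis unfolding box_bump_def by (meson UNIV_I finite prod_zero)
qed

lemma box_bump_tendsto:
  assumes "\<And>i. a $ i < b $ i"
  shows "(\<lambda>n. box_bump n a b x) \<longlonglongrightarrow> indicator (box a b) x"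
proof (cases "x \<in> box a b")
  case True
  have "(\<lambda>n. box_bump n a b x) \<longlonglongrightarrow> (\<Prod>i\<in>UNIV. if (x $ i - a $ i) * (b $ i - x $ i) > 0 then 1 else 0)"
    unfolding box_bump_def by (intro tendsto_prod bump_0_scaled_tendsto)
  moreover have "(\<Prod>i\<in>UNIV. if (x $ i - a $ i) * (b $ i - x $ i) > 0 then 1 else 0) = (1::real)"
    using True unfolding mem_box_vec by (intro prod.neutral) auto
  ultimately show ?thesis using True by simp
qed (simp add: box_bump_outside[OF assms])

lemma test_box_bump:
  assumes "\<And>i. a $ i < b $ i"
  shows "test_function (box_bump n a b)"
  unfolding test_function_iff
proof
  show "smooth (box_bump n a b)"
    unfolding box_bump_def
    by (intro smooth_prod smooth_bump smooth_mult smooth_diff smooth_component smooth_const)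
  obtain R where "\<And>x. x \<in> box a b \<Longrightarrow> norm x \<le> R"
    using bounded_box[of a b] by (auto simp: bounded_iff)
  then show "\<exists>R. \<forall>x. norm x > R \<longrightarrow> box_bump n a b x = 0"
    using box_bump_outside[OF assms] by (metis not_less)
qed

lemma box_bump_integral_tendsto:
  assumes ab: "\<And>i. a $ i < b $ i" and e: "locally_integrable e"
  shows "(\<lambda>n. \<integral>x. e x * box_bump n a b x \<partial>lborel) \<longlonglongrightarrow> (\<integral>x. indicator (box a b) x * e x \<partial>lborel)"
proof -
  obtain R where R: "\<And>x. x \<in> box a b \<Longrightarrow> norm x \<le> R"
    using bounded_box[of a b] by (auto simp: bounded_iff)
  have [measurable]: "e \<in> borel_measurable borel" using e by (simp add: locally_integrable_def)
  have [measurable]: "box_bump n a b \<in> borel_measurable borel" for n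
    by (intro test_measurable test_box_bump ab)
  show ?thesis
  proof (rule integral_dominated_convergence[where w="\<lambda>x. \<bar>e x * indicator (cball 0 R) x\<bar>"])
    show "integrable lborel (\<lambda>x. \<bar>e x * indicator (cball 0 R) x\<bar>)"
      using locally_integrable_ball[OF e] by simp
    show "AE x in lborel. (\<lambda>n. e x * box_bump n a b x) \<longlonglongrightarrow> indicator (box a b) x * e x"
      using box_bump_tendsto[OF ab] by (intro AE_I2, subst mult.commute) (intro tendsto_intros)
    show "AE x in lborel. norm (e x * box_bump n a b x) \<le> \<bar>e x * indicator (cball 0 R) x\<bar>" for n
    proof (rule AE_I2)
      fix x
      show "norm (e x * box_bump n a b x) \<le> \<bar>e x * indicator (cball 0 R) x\<bar>"
      proof (cases "x \<in> box a b")
        case True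
        then show ?thesis using box_bump_bounds[of n a b x] R[of x]
          by (auto simp: abs_mult mult_left_le)
      qed (simp add: box_bump_outside[OF ab])
    qed
  qed measurable
qed

text \<open>Testing with \<open>box_bump\<close> and passing to the limit gives vanishing integrals
  over boxes. As \<open>e\<close> is only locally integrable, the criterion for box integrals is
  applied to its restrictions to growing cubes.\<close>

lemma fundamental_lemma:
  assumes e: "locally_integrable e"
    and zero: "\<And>\<phi>. test_function \<phi> \<Longrightarrow> (\<integral>x. e x * \<phi> x \<partial>lborel) = 0"
  shows "AE x in lborel. e x = 0"
proof -
  have box: "(\<integral>x. indicator (box a b) x * e x \<partial>lborel) = 0" for a b :: R3
  proof (cases "\<forall>i. a $ i < b $ i")
    case True
    then show ?thesis
      using box_bump_integral_tendsto[OF _ e, of a b] zero[OF test_box_bump, of a b]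
      by (simp add: LIMSEQ_const_iff)
  next
    case False
    then have "box a b = {}" by (metis interval_eq_empty_cart(1) not_le)
    then show ?thesis by simp
  qed
  have "AE x in lborel. e x * indicator (box (- (real n *\<^sub>R One)) (real n *\<^sub>R One)) x = 0" for n
  proof (rule AE_eq_0_if_box_integrals_0)
    let ?B = "box (- (real n *\<^sub>R One)) (real n *\<^sub>R One) :: R3 set"
    obtain R where R: "\<And>x. x \<in> ?B \<Longrightarrow> norm x \<le> R"
      using bounded_box[of "- (real n *\<^sub>R One) :: R3" "real n *\<^sub>R One"] by (auto simp: bounded_iff)
    have [measurable]: "e \<in> borel_measurable borel" using e by (simp add: locally_integrable_def)
    show "integrable lborel (\<lambda>x. e x * indicator ?B x)"
      by (rule Bochner_Integration.integrable_bound[OF locally_integrable_ball[OF e, of R]])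
         (use R in \<open>auto simp: indicator_def\<close>)
    fix a b :: R3
    obtain c d :: R3 where cd: "box a b \<inter> ?B = box c d"
      by (simp add: box_Int_box)
    have "indicator (box a b) x * (e x * indicator ?B x) = indicator (box c d) x * e x" for x
      unfolding cd[symmetric] indicator_inter_arith by (simp only: mult_ac)
    then show "(\<integral>x. indicator (box a b) x * (e x * indicator ?B x) \<partial>lborel) = 0"
      using box[of c d] by (simp only:)
  qed
  then have "AE x in lborel. \<forall>n. e x * indicator (box (- (real n *\<^sub>R One)) (real n *\<^sub>R One)) x = 0"
    unfolding AE_all_countable by blast
  then show ?thesis
  proof (rule AE_mp, intro AE_I2 impI)
    fix x :: R3
    assume *: "\<forall>n. e x * indicator (box (- (real n *\<^sub>R One)) (real n *\<^sub>R One)) x = 0"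
    obtain n where n: "real n > norm x" using reals_Archimedean2 by blast
    have "\<bar>x \<bullet> b\<bar> < real n" if "b \<in> Basis" for b
      using Basis_le_norm[OF that, of x] n by simp
    then have "x \<in> box (- (real n *\<^sub>R One)) (real n *\<^sub>R One)"
      by (auto simp: box_def abs_less_iff) (metis minus_less_iff)
    then show "e x = 0" using *[rule_format, of n] by simp
  qed
qed

section \<open>Radial integrals\<close>

text \<open>Polar coordinates for radial functions without a surface measure: half-lines pull back
  to balls, and \<open>4 * pi * s\<^sup>2\<close> is the derivative of the ball volume.\<close>

lemma distr_norm_R3:
  "distr lborel borel (norm :: R3 \<Rightarrow> real) = density lborel (\<lambda>s. ennreal (4 * pi * s\<^sup>2) * indicator {0..} s)"
proof (rule measure_eqI_generator_eq[where E = "range (\<lambda>a::real. {..a})" and \<Omega> = UNIV and A = "\<lambda>i. {..real i}"])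
  show "Int_stable (range (\<lambda>a::real. {..a}))"
    by (auto simp: Int_stable_def)
  have ball: "emeasure (distr lborel borel (norm :: R3 \<Rightarrow> real)) {..a} =
     (if a \<ge> 0 then ennreal (4/3 * pi * a ^ 3) else 0)" for a
  proof -
    have "emeasure (distr lborel borel (norm :: R3 \<Rightarrow> real)) {..a} = emeasure lborel (cball (0::R3) a)"
      by (subst emeasure_distr) (auto intro!: arg_cong[where f = "emeasure lborel"])
    also have "\<dots> = (if a \<ge> 0 then ennreal (4/3 * pi * a ^ 3) else 0)"
      by (auto simp: emeasure_cball unit_ball_vol_3)
    finally show ?thesis .
  qed
  show "\<And>i. emeasure (distr lborel borel (norm :: R3 \<Rightarrow> real)) {..real i} \<noteq> \<infinity>"
    by (simp add: ball)
  fix X :: "real set" assume "X \<in> range (\<lambda>a. {..a})"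
  then obtain a where X: "X = {..a}" by auto
  have "emeasure (density lborel (\<lambda>s. ennreal (4 * pi * s\<^sup>2) * indicator {0..} s)) {..a}
      = (\<integral>\<^sup>+s. ennreal (4 * pi * s\<^sup>2) * indicator {0..} s * indicator {..a} s \<partial>lborel)"
    by (subst emeasure_density) auto
  also have "\<dots> = (\<integral>\<^sup>+s. ennreal (4 * pi * s\<^sup>2) * indicator {0..a} s \<partial>lborel)"
    by (intro nn_integral_cong) (auto simp: indicator_def)
  also have "\<dots> = (if a \<ge> 0 then ennreal (4/3 * pi * a ^ 3) else 0)"
  proof (cases "a \<ge> 0")
    case True
    have "(\<integral>\<^sup>+s. ennreal (4 * pi * s\<^sup>2) * indicator {0..a} s \<partial>lborel) = ennreal (4/3 * pi * a ^ 3 - 4/3 * pi * 0 ^ 3)"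
      by (rule nn_integral_FTC_Icc[OF _ _ _ True])
         (auto intro!: derivative_eq_intros simp: power2_eq_square)
    then show ?thesis using True by simp
  qed auto
  finally show "emeasure (distr lborel borel (norm :: R3 \<Rightarrow> real)) X
     = emeasure (density lborel (\<lambda>s. ennreal (4 * pi * s\<^sup>2) * indicator {0..} s)) X"
    by (simp add: X ball)
qed (auto simp: borel_eq_atMost real_arch_simple)

lemma nn_integral_radial:
  assumes [measurable]: "h \<in> borel_measurable borel"
  shows "(\<integral>\<^sup>+x. h (norm (x::R3)) \<partial>lborel) = (\<integral>\<^sup>+s. ennreal (4 * pi * s\<^sup>2) * indicator {0..} s * h s \<partial>lborel)"
proof -
  have "(\<integral>\<^sup>+x. h (norm (x::R3)) \<partial>lborel) = (\<integral>\<^sup>+s. h s \<partial>distr lborel borel (norm :: R3 \<Rightarrow> real))"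
    by (subst nn_integral_distr) auto
  then show ?thesis
    unfolding distr_norm_R3 by (subst (asm) nn_integral_density) auto
qed

text \<open>Up to constants, this integrable function dominates every singular or slowly decaying radial
  integrand that occurs below.\<close>

definition dominating :: "R3 \<Rightarrow> real" where
  "dominating x = 1 / ((norm x)\<^sup>2 * (1 + (norm x)\<^sup>2))"

lemma dominating_nonneg [simp]: "0 \<le> dominating x"
  by (simp add: dominating_def)

lemma dominating_measurable [measurable]: "dominating \<in> borel_measurable borel"
  unfolding dominating_def by measurable

lemma dominating_integrable: "integrable lborel dominating"
proof -
  have "(\<integral>\<^sup>+x. ennreal (dominating x) \<partial>lborel)
      = (\<integral>\<^sup>+s. ennreal (4 * pi * s\<^sup>2) * indicator {0..} s * ennreal (1 / (s\<^sup>2 * (1 + s\<^sup>2))) \<partial>lborel)"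
    unfolding dominating_def by (rule nn_integral_radial[of "\<lambda>s. ennreal (1 / (s\<^sup>2 * (1 + s\<^sup>2)))"]) measurable
  also have "\<dots> \<le> (\<integral>\<^sup>+s. ennreal (4 * pi * (1 / (1 + s\<^sup>2))) * indicator {0..} s \<partial>lborel)"
  proof (rule nn_integral_mono)
    fix s :: real
    have "ennreal (4 * pi * s\<^sup>2) * ennreal (1 / (s\<^sup>2 * (1 + s\<^sup>2))) = ennreal (4 * pi * s\<^sup>2 * (1 / (s\<^sup>2 * (1 + s\<^sup>2))))"
      by (rule ennreal_mult[symmetric]) auto
    also have "\<dots> \<le> ennreal (4 * pi * (1 / (1 + s\<^sup>2)))"
      by (intro ennreal_leI) (cases "s = 0"; simp add: divide_simps)
    finally show "ennreal (4 * pi * s\<^sup>2) * indicator {0..} s * ennreal (1 / (s\<^sup>2 * (1 + s\<^sup>2)))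
       \<le> ennreal (4 * pi * (1 / (1 + s\<^sup>2))) * indicator {0..} s"
      by (simp add: indicator_def)
  qed
  also have "\<dots> = ennreal (4 * pi * (pi / 2) - 4 * pi * arctan 0)"
  proof (rule nn_integral_FTC_atLeast)
    show "((\<lambda>s. 4 * pi * arctan s) \<longlongrightarrow> 4 * pi * (pi / 2)) at_top"
      by (intro tendsto_intros tendsto_arctan_at_top)
    show "((\<lambda>s. 4 * pi * arctan s) has_real_derivative 4 * pi * (1 / (1 + s\<^sup>2))) (at s)" for s
      by (auto intro!: derivative_eq_intros simp: divide_inverse)
  qed (auto simp: add_nonneg_nonneg)
  also have "\<dots> < \<infinity>" by simp
  finally show ?thesis
    by (intro integrableI_nonneg) auto
qed

lemma dominating_ball:
  assumes "norm x \<le> R" "x \<noteq> 0"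
  shows "1 / (norm x)\<^sup>2 \<le> (1 + R\<^sup>2) * dominating x" "1 / norm x \<le> R * (1 + R\<^sup>2) * dominating x"
proof -
  have "(norm x)\<^sup>2 \<le> R\<^sup>2" using assms by (intro power_mono) auto
  then show 1: "1 / (norm x)\<^sup>2 \<le> (1 + R\<^sup>2) * dominating x"
    using assms unfolding dominating_def by (simp add: divide_simps add_pos_nonneg)
  have "1 / norm x = norm x * (1 / (norm x)\<^sup>2)"
    using assms by (simp add: power2_eq_square)
  also have "\<dots> \<le> R * ((1 + R\<^sup>2) * dominating x)"
    using assms 1 by (intro mult_mono) (auto intro: order_trans[OF norm_ge_zero])
  finally show "1 / norm x \<le> R * (1 + R\<^sup>2) * dominating x" by (simp add: mult.assoc)
qed

definition reg_norm :: "real \<Rightarrow> R3 \<Rightarrow> real" where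
  "reg_norm \<epsilon> x = sqrt ((norm x)\<^sup>2 + \<epsilon>\<^sup>2)"

lemma reg_norm_bounds:
  assumes "\<epsilon> > 0"
  shows "reg_norm \<epsilon> x > 0" "norm x \<le> reg_norm \<epsilon> x" "\<epsilon> \<le> reg_norm \<epsilon> x"
    "(reg_norm \<epsilon> x)\<^sup>2 = (norm x)\<^sup>2 + \<epsilon>\<^sup>2" "reg_norm \<epsilon> x \<le> norm x + \<epsilon>"
proof -
  show 1: "reg_norm \<epsilon> x > 0" using assms by (simp add: reg_norm_def add_nonneg_pos)
  show 2: "(reg_norm \<epsilon> x)\<^sup>2 = (norm x)\<^sup>2 + \<epsilon>\<^sup>2" by (simp add: reg_norm_def)
  show "norm x \<le> reg_norm \<epsilon> x" "\<epsilon> \<le> reg_norm \<epsilon> x"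
    unfolding reg_norm_def by (rule real_le_rsqrt; simp)+
  have "reg_norm \<epsilon> x \<le> sqrt ((norm x + \<epsilon>)\<^sup>2)"
    unfolding reg_norm_def using assms by (intro real_sqrt_le_mono) (simp add: power2_sum)
  then show "reg_norm \<epsilon> x \<le> norm x + \<epsilon>" using assms by simp
qed

lemma reg_norm_measurable [measurable]: "reg_norm \<epsilon> \<in> borel_measurable borel"
  unfolding reg_norm_def by measurable

lemma reg_norm_tendsto:
  assumes "e \<longlonglongrightarrow> 0"
  shows "(\<lambda>n. reg_norm (e n) x) \<longlonglongrightarrow> norm x"
proof -
  have "(\<lambda>n. reg_norm (e n) x) \<longlonglongrightarrow> sqrt ((norm x)\<^sup>2 + 0\<^sup>2)"
    unfolding reg_norm_def by (intro tendsto_intros assms)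
  then show ?thesis by simp
qed

text \<open>With q = sqrt (s^2 + \<epsilon>^2), the radial density is 3 s^2 \<epsilon>^2 / q^5, the
  derivative of (s/q)^3, which rises from 0 to 1 on the half-line.\<close>

lemma approx_delta_integral:
  assumes "\<epsilon> > 0"
  shows "has_bochner_integral lborel (\<lambda>x. 3 * \<epsilon>\<^sup>2 / (4 * pi * reg_norm \<epsilon> x ^ 5)) 1"
proof (rule has_bochner_integral_nn_integral)
  define q where "q s = sqrt (s\<^sup>2 + \<epsilon>\<^sup>2)" for s
  have q: "q s > 0" for s using assms by (simp add: q_def add_nonneg_pos)
  have q2: "(q s)\<^sup>2 = s\<^sup>2 + \<epsilon>\<^sup>2" for s by (simp add: q_def)
  have [measurable]: "q \<in> borel_measurable borel" unfolding q_def by measurable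
  have "(\<integral>\<^sup>+x. ennreal (3 * \<epsilon>\<^sup>2 / (4 * pi * reg_norm \<epsilon> x ^ 5)) \<partial>lborel)
      = (\<integral>\<^sup>+s. ennreal (4 * pi * s\<^sup>2) * indicator {0..} s * ennreal (3 * \<epsilon>\<^sup>2 / (4 * pi * q s ^ 5)) \<partial>lborel)"
    unfolding reg_norm_def q_def
    by (rule nn_integral_radial[of "\<lambda>s. ennreal (3 * \<epsilon>\<^sup>2 / (4 * pi * sqrt (s\<^sup>2 + \<epsilon>\<^sup>2) ^ 5))"]) measurable
  also have "\<dots> = (\<integral>\<^sup>+s. ennreal (3 * s\<^sup>2 * \<epsilon>\<^sup>2 / q s ^ 5) * indicator {0..} s \<partial>lborel)"
  proof (rule nn_integral_cong)
    fix s :: real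
    have "ennreal (4 * pi * s\<^sup>2) * ennreal (3 * \<epsilon>\<^sup>2 / (4 * pi * q s ^ 5)) = ennreal (4 * pi * s\<^sup>2 * (3 * \<epsilon>\<^sup>2 / (4 * pi * q s ^ 5)))"
      by (rule ennreal_mult[symmetric]) (use q[of s] in auto)
    also have "4 * pi * s\<^sup>2 * (3 * \<epsilon>\<^sup>2 / (4 * pi * q s ^ 5)) = 3 * s\<^sup>2 * \<epsilon>\<^sup>2 / q s ^ 5"
      using q[of s] by (simp add: field_simps)
    finally show "ennreal (4 * pi * s\<^sup>2) * indicator {0..} s * ennreal (3 * \<epsilon>\<^sup>2 / (4 * pi * q s ^ 5))
       = ennreal (3 * s\<^sup>2 * \<epsilon>\<^sup>2 / q s ^ 5) * indicator {0..} s"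
      by (simp add: indicator_def)
  qed
  also have "\<dots> = ennreal (1 - (0 / q 0) ^ 3)"
  proof (rule nn_integral_FTC_atLeast[where F = "\<lambda>s. (s / q s) ^ 3"])
    show "(\<lambda>s. 3 * s\<^sup>2 * \<epsilon>\<^sup>2 / q s ^ 5) \<in> borel_measurable borel" by measurable
    show "0 \<le> 3 * s\<^sup>2 * \<epsilon>\<^sup>2 / q s ^ 5" for s using q[of s] by auto
    show "((\<lambda>s. (s / q s) ^ 3) has_real_derivative 3 * s\<^sup>2 * \<epsilon>\<^sup>2 / q s ^ 5) (at s)" for s
    proof -
      have pos: "s\<^sup>2 + \<epsilon>\<^sup>2 > 0" using assms by (simp add: add_nonneg_pos)
      have dq: "(q has_real_derivative s / q s) (at s)"
        unfolding q_def using pos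
        by (auto intro!: derivative_eq_intros simp: divide_simps)
      have "((\<lambda>s. s / q s) has_real_derivative (1 * q s - s * (s / q s)) / (q s * q s)) (at s)"
        using q[of s] by (intro DERIV_divide DERIV_ident dq) auto
      moreover have "(1 * q s - s * (s / q s)) / (q s * q s) = \<epsilon>\<^sup>2 / q s ^ 3"
      proof -
        have "q s * q s - s * s = \<epsilon>\<^sup>2" using q2[of s] by (simp add: power2_eq_square)
        then show ?thesis using q[of s] by (simp add: field_simps power3_eq_cube)
      qed
      ultimately have d: "((\<lambda>s. s / q s) has_real_derivative \<epsilon>\<^sup>2 / q s ^ 3) (at s)" by simp
      have "3 * s\<^sup>2 * \<epsilon>\<^sup>2 / q s ^ 5 = of_nat 3 * (\<epsilon>\<^sup>2 / q s ^ 3 * (s / q s) ^ (3 - Suc 0))"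
        using q[of s] by (simp add: field_simps eval_nat_numeral)
      then show ?thesis using DERIV_power[OF d, of 3] by simp
    qed
    have "((\<lambda>s. (1 / sqrt (1 + \<epsilon>\<^sup>2 * (inverse s)\<^sup>2)) ^ 3) \<longlongrightarrow> (1 / sqrt (1 + \<epsilon>\<^sup>2 * 0\<^sup>2)) ^ 3) at_top"
      by (intro tendsto_intros tendsto_inverse_0_at_top filterlim_ident) auto
    then have "((\<lambda>s. (1 / sqrt (1 + \<epsilon>\<^sup>2 * (inverse s)\<^sup>2)) ^ 3) \<longlongrightarrow> 1) at_top" by simp
    then show "((\<lambda>s. (s / q s) ^ 3) \<longlongrightarrow> 1) at_top"
    proof (rule Lim_transform_eventually)
      have "(1 / sqrt (1 + \<epsilon>\<^sup>2 * (inverse s)\<^sup>2)) ^ 3 = (s / q s) ^ 3" if "s > 0" for s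
      proof -
        have "q s = sqrt (s\<^sup>2 * (1 + \<epsilon>\<^sup>2 * (inverse s)\<^sup>2))"
          using that by (simp add: q_def field_simps)
        also have "\<dots> = s * sqrt (1 + \<epsilon>\<^sup>2 * (inverse s)\<^sup>2)"
          using that by (simp add: real_sqrt_mult)
        finally show ?thesis using that by simp
      qed
      then show "\<forall>\<^sub>F s in at_top. (1 / sqrt (1 + \<epsilon>\<^sup>2 * (inverse s)\<^sup>2)) ^ 3 = (s / q s) ^ 3"
        by (auto intro: eventually_mono[OF eventually_gt_at_top[of 0]])
    qed
  qed
  finally show "(\<integral>\<^sup>+x. ennreal (3 * \<epsilon>\<^sup>2 / (4 * pi * reg_norm \<epsilon> x ^ 5)) \<partial>lborel) = ennreal 1"
    by simp
  show "AE x in lborel. 0 \<le> 3 * \<epsilon>\<^sup>2 / (4 * pi * reg_norm \<epsilon> x ^ 5)"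
    by (intro AE_I2) (use reg_norm_bounds(1)[OF assms] in \<open>simp add: less_imp_le\<close>)
qed auto

section \<open>Derivatives of radial functions of the regularised norm\<close>

lemma reg_norm_partial:
  assumes "\<epsilon> > 0" "(f has_real_derivative f') (at (reg_norm \<epsilon> x))"
  shows "(\<lambda>x. f (reg_norm \<epsilon> x)) differentiable (at x)"
    "partial i (\<lambda>x. f (reg_norm \<epsilon> x)) x = f' * (x $ i / reg_norm \<epsilon> x)"
proof -
  let ?r = "reg_norm \<epsilon> x"
  have pos: "(norm x)\<^sup>2 + \<epsilon>\<^sup>2 > 0" using assms by (simp add: add_nonneg_pos)
  have "((\<lambda>x. x \<bullet> x + \<epsilon>\<^sup>2) has_derivative (\<lambda>v. 2 * (x \<bullet> v))) (at x)"
    by (auto intro!: derivative_eq_intros simp: inner_commute)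
  then have "((\<lambda>x. sqrt (x \<bullet> x + \<epsilon>\<^sup>2)) has_derivative (\<lambda>v. 2 * (x \<bullet> v) * (inverse (sqrt (x \<bullet> x + \<epsilon>\<^sup>2)) / 2))) (at x)"
    using pos by (intro has_derivative_real_sqrt) (simp_all add: power2_norm_eq_inner)
  then have 1: "(reg_norm \<epsilon> has_derivative (\<lambda>v. (x \<bullet> v) / ?r)) (at x)"
    unfolding reg_norm_def power2_norm_eq_inner by (simp add: field_simps)
  then have d: "reg_norm \<epsilon> differentiable (at x)" by (auto simp: differentiable_def)
  show "(\<lambda>x. f (reg_norm \<epsilon> x)) differentiable (at x)"
    using assms(2) d by (rule differentiable_compose_real)
  show "partial i (\<lambda>x. f (reg_norm \<epsilon> x)) x = f' * (x $ i / ?r)"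
    using partial_compose[OF assms(2) d] partial_eq[OF 1] by (simp add: inner_axis)
qed

lemma reg_norm_continuous: "continuous_on UNIV (reg_norm \<epsilon>)"
  unfolding reg_norm_def by (intro continuous_intros)

lemma partial_component: "partial i (\<lambda>x. x $ i) x = 1"
proof -
  have "((\<lambda>x. x $ i) has_derivative (\<lambda>v. v $ i)) (at x)"
    by (rule bounded_linear.has_derivative[OF bounded_linear_vec_nth has_derivative_ident])
  from partial_eq[OF this, of i] show ?thesis by simp
qed

lemma continuous_on_reg_norm:
  assumes "\<epsilon> > 0" "continuous_on {0<..} f"
  shows "continuous_on UNIV (\<lambda>x. f (reg_norm \<epsilon> x))"
  by (rule continuous_on_compose2[OF assms(2) reg_norm_continuous])
     (use reg_norm_bounds(1)[OF assms(1)] in auto)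

text \<open>Writing f' as \<open>s * f1 s\<close> cancels the division by the regularised norm in
  the chain rule: the gradient of f(\<rho>) is f1(\<rho>) x. The same rule can be applied again to
  f1.\<close>

lemma reg_radial_gradient:
  assumes "\<epsilon> > 0" "test_function \<phi>"
    and f: "\<And>s. s > 0 \<Longrightarrow> (f has_real_derivative s * f1 s) (at s)"
    and f1: "continuous_on {0<..} f1"
  shows "(\<lambda>x. f (reg_norm \<epsilon> x)) differentiable (at x)"
    "partial i (\<lambda>x. f (reg_norm \<epsilon> x)) = (\<lambda>x. f1 (reg_norm \<epsilon> x) * x $ i)"
    "(\<integral>x. f (reg_norm \<epsilon> x) * partial i \<phi> x \<partial>lborel) = - (\<integral>x. f1 (reg_norm \<epsilon> x) * x $ i * \<phi> x \<partial>lborel)"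
proof -
  note r = reg_norm_bounds(1)[OF assms(1)]
  show d: "(\<lambda>x. f (reg_norm \<epsilon> x)) differentiable (at x)" for x
    using reg_norm_partial(1)[OF assms(1) f[OF r]] .
  show p: "partial i (\<lambda>x. f (reg_norm \<epsilon> x)) = (\<lambda>x. f1 (reg_norm \<epsilon> x) * x $ i)"
    using reg_norm_partial(2)[OF assms(1) f[OF r]] r by (simp add: fun_eq_iff less_imp_neq[symmetric])
  have "(\<integral>x. f (reg_norm \<epsilon> x) * partial i \<phi> x \<partial>lborel)
     = - (\<integral>x. partial i (\<lambda>x. f (reg_norm \<epsilon> x)) x * \<phi> x \<partial>lborel)"
  proof (rule integration_by_parts[OF d _ assms(2)])
    show "continuous_on UNIV (partial i (\<lambda>x. f (reg_norm \<epsilon> x)))"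
      unfolding p by (intro continuous_intros continuous_on_reg_norm assms)
  qed
  then show "(\<integral>x. f (reg_norm \<epsilon> x) * partial i \<phi> x \<partial>lborel) = - (\<integral>x. f1 (reg_norm \<epsilon> x) * x $ i * \<phi> x \<partial>lborel)"
    unfolding p .
qed

lemma laplace_alt: "laplace \<phi> x = (\<Sum>i\<in>UNIV. partial i (partial i \<phi>) x)"
  by (simp add: laplace_def partials_pair)

text \<open>The divergence of f1(\<rho>) x consists of f2(\<rho>) |x|^2 and of 3 f1(\<rho>), the 3
  being the divergence of x. Both derivatives are moved by parts, one coordinate direction at a
  time.\<close>

lemma reg_radial_laplace:
  assumes "\<epsilon> > 0" "test_function \<phi>"
    and f: "\<And>s. s > 0 \<Longrightarrow> (f has_real_derivative s * f1 s) (at s)"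
    and f1: "\<And>s. s > 0 \<Longrightarrow> (f1 has_real_derivative s * f2 s) (at s)"
    and f2: "continuous_on {0<..} f2"
  shows "(\<integral>x. f (reg_norm \<epsilon> x) * laplace \<phi> x \<partial>lborel)
     = (\<integral>x. (f2 (reg_norm \<epsilon> x) * (norm x)\<^sup>2 + 3 * f1 (reg_norm \<epsilon> x)) * \<phi> x \<partial>lborel)"
proof -
  let ?r = "reg_norm \<epsilon>"
  note tp = test_partial[OF assms(2)]
  have c1: "continuous_on {0<..} f1"
    using f1 by (intro continuous_at_imp_continuous_on) (auto intro: DERIV_isCont)
  have c0: "continuous_on {0<..} f"
    using f by (intro continuous_at_imp_continuous_on) (auto intro: DERIV_isCont)
  have cont: "continuous_on UNIV (\<lambda>x. f (?r x))" "continuous_on UNIV (\<lambda>x. f1 (?r x))"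
     "continuous_on UNIV (\<lambda>x. f2 (?r x))"
    using continuous_on_reg_norm[OF assms(1)] c0 c1 f2 by auto
  have d: "(\<lambda>x. f1 (?r x)) differentiable (at x)" for x
    by (rule reg_radial_gradient(1)[OF assms(1,2) f1 f2])
  have dc: "(\<lambda>x. x $ i) differentiable (at x)" for i and x :: R3
    by (rule smooth_differentiable[OF smooth_component])
  have p1: "partial i (\<lambda>x. f1 (?r x)) = (\<lambda>x. f2 (?r x) * x $ i)" for i
    by (rule reg_radial_gradient(2)[OF assms(1,2) f1 f2])
  have pm: "partial i (\<lambda>x. f1 (?r x) * x $ i) = (\<lambda>x. f2 (?r x) * (x $ i)\<^sup>2 + f1 (?r x))" for i
    by (rule ext) (simp add: partial_mult[OF d dc] p1 partial_component power2_eq_square mult.assoc)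
  have "(\<integral>x. f (?r x) * partial i (partial i \<phi>) x \<partial>lborel)
     = (\<integral>x. (f2 (?r x) * (x $ i)\<^sup>2 + f1 (?r x)) * \<phi> x \<partial>lborel)" for i
  proof -
    have "(\<integral>x. f (?r x) * partial i (partial i \<phi>) x \<partial>lborel) = - (\<integral>x. f1 (?r x) * x $ i * partial i \<phi> x \<partial>lborel)"
      by (rule reg_radial_gradient(3)[OF assms(1) tp f c1])
    also have "\<dots> = (\<integral>x. partial i (\<lambda>x. f1 (?r x) * x $ i) x * \<phi> x \<partial>lborel)"
    proof (subst integration_by_parts[OF _ _ assms(2)])
      show "(\<lambda>x. f1 (?r x) * x $ i) differentiable (at x)" for x
        by (intro differentiable_mult d dc)
      show "continuous_on UNIV (partial i (\<lambda>x. f1 (?r x) * x $ i))"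
        unfolding pm by (intro continuous_intros cont)
    qed simp
    also have "\<dots> = (\<integral>x. (f2 (?r x) * (x $ i)\<^sup>2 + f1 (?r x)) * \<phi> x \<partial>lborel)"
      unfolding pm ..
    finally show ?thesis .
  qed
  moreover have "integrable lborel (\<lambda>x. f (?r x) * partial i (partial i \<phi>) x)"
    "integrable lborel (\<lambda>x. (f2 (?r x) * (x $ i)\<^sup>2 + f1 (?r x)) * \<phi> x)" for i
    by (intro integrable_locally_mult_test continuous_locally_integrable continuous_intros cont
        test_partial assms)+
  moreover have "(\<Sum>i\<in>UNIV. (f2 (?r x) * (x $ i)\<^sup>2 + f1 (?r x)) * \<phi> x)
     = (f2 (?r x) * (norm x)\<^sup>2 + 3 * f1 (?r x)) * \<phi> x" for x
  proof -
    have "(\<Sum>i\<in>UNIV. (x $ i)\<^sup>2) = (norm x)\<^sup>2"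
      unfolding power2_norm_eq_inner inner_vec_def by (simp add: power2_eq_square)
    then show ?thesis
      by (simp add: sum_distrib_right[symmetric] sum.distrib sum_distrib_left[symmetric])
  qed
  ultimately show ?thesis
    unfolding laplace_alt sum_distrib_left
    by (subst Bochner_Integration.integral_sum) (auto simp flip: Bochner_Integration.integral_sum)
qed

subsection \<open>The kernel\<close>

definition kern :: "real \<Rightarrow> R3 \<Rightarrow> real" where
  "kern l x = exp (- sqrt l * norm x) / (4 * pi * norm x)"

lemma kern_nonneg [simp]: "0 \<le> kern l x"
  by (simp add: kern_def)

lemma kern_measurable [measurable]: "kern l \<in> borel_measurable borel"
  unfolding kern_def by measurable

lemma kern_minus: "kern l (x - y) = kern l (y - x)"
  by (simp add: kern_def norm_minus_commute)

lemma kern_0: "kern 0 x = 1 / (4 * pi * norm x)"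
  by (simp add: kern_def)

lemma kern_le_0: "0 \<le> l \<Longrightarrow> kern l x \<le> kern 0 x"
  by (simp add: kern_def divide_right_mono)

section \<open>Lipschitz bounds from bounds on partial derivatives\<close>

lemma frechet_derivative_partials:
  assumes "f differentiable (at x)"
  shows "frechet_derivative f (at x) v = (\<Sum>i\<in>UNIV. v $ i * partial i f x)"
proof -
  let ?D = "frechet_derivative f (at x)"
  have l: "linear ?D" using assms by (intro has_derivative_linear) (simp add: frechet_derivative_works)
  have "?D v = ?D (\<Sum>i\<in>UNIV. v $ i *\<^sub>R axis i 1)"
    by (simp add: basis_expansion scalar_mult_eq_scaleR[symmetric])
  also have "\<dots> = (\<Sum>i\<in>UNIV. v $ i * partial i f x)"
    by (simp add: linear_sum[OF l] linear_cmul[OF l] partial_def)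
  finally show ?thesis .
qed

text \<open>The 3 counts the coordinates, each of which is bounded by the norm.\<close>

lemma frechet_derivative_bound:
  assumes "f differentiable (at x)" "\<And>i. \<bar>partial i f x\<bar> \<le> B"
  shows "\<bar>frechet_derivative f (at x) v\<bar> \<le> 3 * B * norm v"
proof -
  have "\<bar>frechet_derivative f (at x) v\<bar> \<le> (\<Sum>i\<in>(UNIV::3 set). \<bar>v $ i * partial i f x\<bar>)"
    unfolding frechet_derivative_partials[OF assms(1)] by (rule sum_abs)
  also have "\<dots> \<le> (\<Sum>i\<in>(UNIV::3 set). norm v * B)"
    by (intro sum_mono) (auto simp: abs_mult intro!: mult_mono component_le_norm_cart assms)
  also have "\<dots> = 3 * B * norm v" by simp
  finally show ?thesis .
qed

lemma lipschitz_of_partials: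
  assumes "\<And>x. f differentiable (at x)" "\<And>i x. \<bar>partial i f x\<bar> \<le> B"
  shows "\<bar>f x - f y\<bar> \<le> 3 * B * norm (x - y)"
proof -
  have "norm (f x - f y) \<le> 3 * B * norm (x - y)"
  proof (rule differentiable_bound[where S = UNIV])
    show "(f has_derivative frechet_derivative f (at x)) (at x within UNIV)" for x
      using assms(1) by (simp add: frechet_derivative_works)
    show "onorm (frechet_derivative f (at x)) \<le> 3 * B" for x
      using frechet_derivative_bound[OF assms] by (intro onorm_le) auto
  qed auto
  then show ?thesis by simp
qed

lemma test_partials_bound:
  assumes "test_function \<phi>"
  obtains B where "B \<ge> 0" "\<And>i x. \<bar>partial i \<phi> x\<bar> \<le> B"
proof -
  have "\<exists>B. \<forall>x. \<bar>partial i \<phi> x\<bar> \<le> B" for i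
  proof -
    obtain B R where B: "B \<ge> 0" "\<And>x. \<bar>partial i \<phi> x\<bar> \<le> B * indicator (cball 0 R) x"
      using test_bound[OF test_partial[OF assms, of i]] by metis
    have "\<bar>partial i \<phi> x\<bar> \<le> B" for x using B(2)[of x] B(1) by (cases "x \<in> cball 0 R") auto
    then show ?thesis by auto
  qed
  then obtain B where B: "\<And>i x. \<bar>partial i \<phi> x\<bar> \<le> B i" by metis
  show ?thesis
  proof (rule that[of "\<Sum>i\<in>UNIV. \<bar>B i\<bar>"])
    show "\<bar>partial i \<phi> x\<bar> \<le> (\<Sum>i\<in>UNIV. \<bar>B i\<bar>)" for i x
    proof -
      have "\<bar>partial i \<phi> x\<bar> \<le> \<bar>B i\<bar>" using B[of i x] by simp
      also have "\<dots> \<le> (\<Sum>i\<in>UNIV. \<bar>B i\<bar>)" by (rule member_le_sum) auto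
      finally show ?thesis .
    qed
  qed (simp add: sum_nonneg)
qed

lemma test_lipschitz:
  assumes "test_function \<phi>"
  obtains L where "L \<ge> 0" "\<And>x y. \<bar>\<phi> x - \<phi> y\<bar> \<le> L * norm (x - y)"
proof -
  obtain B where B: "B \<ge> 0" "\<And>i x. \<bar>partial i \<phi> x\<bar> \<le> B"
    using test_partials_bound[OF assms] by metis
  then show ?thesis
    using lipschitz_of_partials[of \<phi> B] test_differentiable[OF assms] by (intro that[of "3 * B"]) auto
qed

text \<open>With \<open>\<rho> = sqrt (|x|\<^sup>2 + \<epsilon>\<^sup>2)\<close> and \<open>k = sqrt l\<close>, the operator \<open>l - \<Delta>\<close> maps the smooth function
  \<open>exp (- k \<rho>) / (4 \<pi> \<rho>)\<close> to \<open>\<epsilon>\<^sup>2 exp (- k \<rho>) (k\<^sup>2 / \<rho>\<^sup>3 + 3 k / \<rho>\<^sup>4 + 3 / \<rho>\<^sup>5) / (4 \<pi>)\<close>. The last term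
  is an approximate identity because \<open>3 \<epsilon>\<^sup>2 / (4 \<pi> \<rho>\<^sup>5)\<close> has integral \<open>1\<close>; the others vanish in the
  limit \<open>\<epsilon> \<rightarrow> 0\<close>.\<close>

lemma fundamental_solution_at_0:
  assumes "l \<ge> 0" and \<phi>: "test_function \<phi>"
  shows "(\<integral>x. kern l x * (l * \<phi> x - laplace \<phi> x) \<partial>lborel) = \<phi> 0"
proof -
  define k where "k = sqrt l"
  have k: "k \<ge> 0" "k\<^sup>2 = l" using assms by (auto simp: k_def)
  define e where "e n = 1 / real (Suc n)" for n
  have e: "e n > 0" "e n \<le> 1" for n by (auto simp: e_def)
  have e0: "e \<longlonglongrightarrow> 0"
    unfolding e_def using LIMSEQ_inverse_real_of_nat by (simp add: inverse_eq_divide)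
  let ?r = "\<lambda>n. reg_norm (e n)"
  note rb = reg_norm_bounds[OF e(1)]
  define f where "f s = exp (- k * s) / (4 * pi * s)" for s
  \<comment> \<open>\<open>f1\<close> and \<open>f2\<close> arise from \<open>f\<close> by applying
    (1/s) d/ds once and twice, the form that \<open>reg_radial_laplace\<close> expects.\<close>
  define f1 where "f1 s = - (exp (- k * s) / (4 * pi)) * (k / s\<^sup>2 + 1 / s ^ 3)" for s
  define f2 where "f2 s = exp (- k * s) / (4 * pi) * (k\<^sup>2 / s ^ 3 + 3 * k / s ^ 4 + 3 / s ^ 5)" for s
  have df: "(f has_real_derivative s * f1 s) (at s)" if "s > 0" for s
    unfolding f_def f1_def using that
    by (auto intro!: derivative_eq_intros simp: field_simps eval_nat_numeral)
  have df1: "(f1 has_real_derivative s * f2 s) (at s)" if "s > 0" for s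
    unfolding f1_def f2_def using that
    by (auto intro!: derivative_eq_intros simp: field_simps eval_nat_numeral)
  have cf2: "continuous_on {0<..} f2"
    unfolding f2_def by (intro continuous_intros) auto
  have cf: "continuous_on {0<..} f"
    unfolding f_def by (intro continuous_intros) auto
  have cf1: "continuous_on {0<..} f1"
    unfolding f1_def by (intro continuous_intros) auto
  have cont: "continuous_on UNIV (\<lambda>x. f (?r n x))" "continuous_on UNIV (\<lambda>x. f1 (?r n x))"
    "continuous_on UNIV (\<lambda>x. f2 (?r n x))" for n
    using continuous_on_reg_norm[OF e(1)] cf cf1 cf2 by auto
  have [measurable]: "\<phi> \<in> borel_measurable borel" using \<phi> by (rule test_measurable)
  have [measurable]: "(\<lambda>x. f2 (?r n x)) \<in> borel_measurable borel" "(\<lambda>x. f (?r n x)) \<in> borel_measurable borel" for n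
    using cont by (auto intro: borel_measurable_continuous_onI)
  define \<psi> where "\<psi> x = l * \<phi> x - laplace \<phi> x" for x
  have \<psi>: "test_function \<psi>"
    unfolding \<psi>_def by (intro test_diff test_cmult test_laplace \<phi>)
  have [measurable]: "\<psi> \<in> borel_measurable borel" using \<psi> by (rule test_measurable)
  let ?T = "\<lambda>n x. 3 * (e n)\<^sup>2 / (4 * pi * ?r n x ^ 5)"
  have Tint: "integrable lborel (?T n)" "(\<integral>x. ?T n x \<partial>lborel) = 1" for n
    using approx_delta_integral[OF e(1), of n] by (auto simp: has_bochner_integral_iff)
  \<comment> \<open>Subtracting \<phi>(0) times the approximate identity, whose integral is 1,
    leaves an integrand that tends to 0 away from the origin and has an integrable majorant
    independent of n.\<close>
  define q where "q n x = (e n)\<^sup>2 * f2 (?r n x) * \<phi> x - ?T n x * \<phi> 0" for n x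
  have [measurable]: "q n \<in> borel_measurable borel" for n
    unfolding q_def by measurable
  have eq: "(\<integral>x. f (?r n x) * \<psi> x \<partial>lborel) = (\<integral>x. q n x \<partial>lborel) + \<phi> 0" for n
  proof -
    have int: "integrable lborel (\<lambda>x. f (?r n x) * \<phi> x)" "integrable lborel (\<lambda>x. f (?r n x) * laplace \<phi> x)"
      "integrable lborel (\<lambda>x. f2 (?r n x) * \<phi> x)"
      by (intro integrable_locally_mult_test continuous_locally_integrable cont \<phi> test_laplace)+
    have int2: "integrable lborel (\<lambda>x. (e n)\<^sup>2 * f2 (?r n x) * \<phi> x)"
      using integrable_mult_right[OF int(3), of "(e n)\<^sup>2"] by (simp add: mult.assoc)
    have "(\<integral>x. f (?r n x) * laplace \<phi> x \<partial>lborel)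
       = (\<integral>x. (f2 (?r n x) * (norm x)\<^sup>2 + 3 * f1 (?r n x)) * \<phi> x \<partial>lborel)"
      by (rule reg_radial_laplace[OF e(1) \<phi> df df1 cf2])
    also have "\<dots> = (\<integral>x. l * (f (?r n x) * \<phi> x) - (e n)\<^sup>2 * f2 (?r n x) * \<phi> x \<partial>lborel)"
    proof (rule Bochner_Integration.integral_cong)
      fix x
      have "(norm x)\<^sup>2 = (?r n x)\<^sup>2 - (e n)\<^sup>2" using rb(4)[of n x] by simp
      then have "f2 (?r n x) * (norm x)\<^sup>2 = f2 (?r n x) * (?r n x)\<^sup>2 - (e n)\<^sup>2 * f2 (?r n x)"
        by (simp only: right_diff_distrib mult.commute)
      \<comment> \<open>This is the radial Helmholtz equation f'' + (2/s) f' = l f, expressed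
        through f' = s f1 and f'' = f1 + s^2 f2.\<close>
      moreover have "f2 s * s\<^sup>2 + 3 * f1 s = l * f s" if "s > 0" for s
        unfolding f_def f1_def f2_def k(2)[symmetric] using that
        by (simp add: field_simps eval_nat_numeral)
      then have "f2 (?r n x) * (?r n x)\<^sup>2 + 3 * f1 (?r n x) = l * f (?r n x)" using rb(1) by simp
      ultimately have "f2 (?r n x) * (norm x)\<^sup>2 + 3 * f1 (?r n x) = l * f (?r n x) - (e n)\<^sup>2 * f2 (?r n x)"
        by linarith
      then show "(f2 (?r n x) * (norm x)\<^sup>2 + 3 * f1 (?r n x)) * \<phi> x = l * (f (?r n x) * \<phi> x) - (e n)\<^sup>2 * f2 (?r n x) * \<phi> x"
        by (simp add: left_diff_distrib)
    qed simp
    also have "\<dots> = l * (\<integral>x. f (?r n x) * \<phi> x \<partial>lborel) - (\<integral>x. (e n)\<^sup>2 * f2 (?r n x) * \<phi> x \<partial>lborel)"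
      using int int2 by simp
    finally have 1: "(\<integral>x. f (?r n x) * \<psi> x \<partial>lborel) = (\<integral>x. (e n)\<^sup>2 * f2 (?r n x) * \<phi> x \<partial>lborel)"
      using int unfolding \<psi>_def right_diff_distrib
      by (subst Bochner_Integration.integral_diff) (auto simp: mult.left_commute)
    have "(\<integral>x. q n x \<partial>lborel) = (\<integral>x. (e n)\<^sup>2 * f2 (?r n x) * \<phi> x \<partial>lborel) - \<phi> 0"
    proof -
      have "(\<integral>x. ?T n x * \<phi> 0 \<partial>lborel) = \<phi> 0"
        by (simp only: Bochner_Integration.integral_mult_left_zero Tint(2) mult_1)
      then show ?thesis
        unfolding q_def Bochner_Integration.integral_diff[OF int2 integrable_mult_left[OF Tint(1)]] by simp
    qed
    with 1 show ?thesis by simp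
  qed
  have ne: "AE x in lborel. x \<noteq> (0::R3)" by (rule AE_lborel_singleton)
  obtain B R where B: "B \<ge> 0" "R > 0" "\<And>x. \<bar>\<phi> x\<bar> \<le> B * indicator (cball 0 R) x"
    using test_bound[OF \<phi>] by metis
  have B1: "\<bar>\<phi> x\<bar> \<le> B" for x using B(3)[of x] B(1) by (cases "x \<in> cball 0 R") auto
  obtain B' R' where B': "B' \<ge> 0" "R' > 0" "\<And>x. \<bar>\<psi> x\<bar> \<le> B' * indicator (cball 0 R') x"
    using test_bound[OF \<psi>] by metis
  obtain L where L: "L \<ge> 0" "\<And>x y. \<bar>\<phi> x - \<phi> y\<bar> \<le> L * norm (x - y)"
    using test_lipschitz[OF \<phi>] by metis
  have rpos: "norm x > 0" if "x \<noteq> 0" for x :: R3 using that by simp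
  have rlim: "(\<lambda>n. ?r n x) \<longlonglongrightarrow> norm x" for x by (rule reg_norm_tendsto[OF e0])
  have "(\<lambda>n. \<integral>x. f (?r n x) * \<psi> x \<partial>lborel) \<longlonglongrightarrow> (\<integral>x. kern l x * \<psi> x \<partial>lborel)"
  proof (rule integral_dominated_convergence[where w = "\<lambda>x. B' * (R' * (1 + R'\<^sup>2)) * dominating x"])
    show "AE x in lborel. (\<lambda>n. f (?r n x) * \<psi> x) \<longlonglongrightarrow> kern l x * \<psi> x"
      using ne
    proof eventually_elim
      case (elim x)
      show ?case unfolding f_def kern_def k_def[symmetric] using elim
        by (intro tendsto_intros rlim) auto
    qed
    show "AE x in lborel. norm (f (?r n x) * \<psi> x) \<le> B' * (R' * (1 + R'\<^sup>2)) * dominating x" for n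
      using ne
    proof eventually_elim
      case (elim x)
      show ?case
      proof (cases "norm x \<le> R'")
        case True
        have "\<bar>f (?r n x)\<bar> \<le> 1 / norm x"
        proof -
          have "f (?r n x) \<le> 1 / (1 * ?r n x)"
            unfolding f_def using rb(1)[of n x] k(1) pi_gt3
            by (intro frac_le mult_mono) auto
          also have "\<dots> \<le> 1 / norm x" using rb(2)[of x n] rpos[OF elim] by (simp add: frac_le)
          finally show ?thesis using rb(1)[of n x] by (simp add: f_def)
        qed
        also have "\<dots> \<le> R' * (1 + R'\<^sup>2) * dominating x" using dominating_ball(2)[OF True elim] .
        finally have "\<bar>f (?r n x)\<bar> * \<bar>\<psi> x\<bar> \<le> (R' * (1 + R'\<^sup>2) * dominating x) * B'"
          using B'(3)[of x] True by (intro mult_mono) (auto intro: order_trans[OF abs_ge_zero])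
        then show ?thesis by (simp add: abs_mult mult_ac)
      next
        case False
        then have "\<psi> x = 0" using B'(3)[of x] by simp
        then show ?thesis using B' by simp
      qed
    qed
  qed (use dominating_integrable in auto)
  moreover have "(\<lambda>n. \<integral>x. q n x \<partial>lborel) \<longlonglongrightarrow> (\<integral>x. 0 \<partial>(lborel::R3 measure))"
  proof (rule integral_dominated_convergence[where
      w = "\<lambda>x. (B * (k\<^sup>2 * (R * (1 + R\<^sup>2)) + 3 * k * (1 + R\<^sup>2)) + (L + B * k)) * dominating x"])
    show "AE x in lborel. (\<lambda>n. q n x) \<longlonglongrightarrow> 0"
      using ne
    proof eventually_elim
      case (elim x)
      have "(\<lambda>n. q n x) \<longlonglongrightarrow> 0\<^sup>2 * f2 (norm x) * \<phi> x - 3 * 0\<^sup>2 / (4 * pi * norm x ^ 5) * \<phi> 0"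
        unfolding q_def f2_def using elim by (intro tendsto_intros e0 rlim) auto
      then show ?case by simp
    qed
    show "AE x in lborel. norm (q n x) \<le> (B * (k\<^sup>2 * (R * (1 + R\<^sup>2)) + 3 * k * (1 + R\<^sup>2)) + (L + B * k)) * dominating x" for n
      using ne
    proof eventually_elim
      case (elim x)
      let ?\<rho> = "?r n x" and ?E = "exp (- k * ?r n x)"
      have \<rho>: "?\<rho> > 0" "norm x \<le> ?\<rho>" "e n \<le> ?\<rho>" using rb by auto
      have E: "0 < ?E" "?E \<le> 1" using k \<rho> by auto
      have e1: "(e n)\<^sup>2 \<le> 1" using e[of n] by (simp add: power_le_one)
      \<comment> \<open>The first summand collects the terms of order \<rho>^-3 and \<rho>^-4, for
        which \<epsilon>^2/\<rho>^2 \<le> 1 leaves singularities that are integrable over bounded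
        sets; the second contains the approximate identity.\<close>
      have q: "q n x = ?E / (4 * pi) * ((e n)\<^sup>2 / ?\<rho>\<^sup>2) * (k\<^sup>2 * (1 / ?\<rho>) + 3 * k * (1 / ?\<rho>\<^sup>2)) * \<phi> x
          + ?T n x * (?E * \<phi> x - \<phi> 0)"
        unfolding q_def f2_def using \<rho>(1) by (simp add: field_simps eval_nat_numeral)
      have 1: "\<bar>?E / (4 * pi) * ((e n)\<^sup>2 / ?\<rho>\<^sup>2) * (k\<^sup>2 * (1 / ?\<rho>) + 3 * k * (1 / ?\<rho>\<^sup>2)) * \<phi> x\<bar>
          \<le> B * (k\<^sup>2 * (R * (1 + R\<^sup>2)) + 3 * k * (1 + R\<^sup>2)) * dominating x"
      proof (cases "norm x \<le> R")
        case True
        have "?E \<le> 4 * pi" using E(2) pi_gt3 by linarith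
        then have a: "?E / (4 * pi) \<le> 1" by (simp add: pos_divide_le_eq)
        have b: "(e n)\<^sup>2 / ?\<rho>\<^sup>2 \<le> 1"
          using \<rho> e[of n] by (simp add: divide_simps power_mono)
        have c: "k\<^sup>2 * (1 / ?\<rho>) + 3 * k * (1 / ?\<rho>\<^sup>2) \<le> k\<^sup>2 * (1 / norm x) + 3 * k * (1 / (norm x)\<^sup>2)"
          using \<rho> k rpos[OF elim] by (intro add_mono mult_left_mono frac_le power_mono) auto
        also have "\<dots> \<le> k\<^sup>2 * (R * (1 + R\<^sup>2) * dominating x) + 3 * k * ((1 + R\<^sup>2) * dominating x)"
          using k dominating_ball[OF True elim] by (intro add_mono mult_left_mono) auto
        finally have c: "k\<^sup>2 * (1 / ?\<rho>) + 3 * k * (1 / ?\<rho>\<^sup>2) \<le> (k\<^sup>2 * (R * (1 + R\<^sup>2)) + 3 * k * (1 + R\<^sup>2)) * dominating x"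
          by (simp add: algebra_simps)
        have "?E / (4 * pi) * ((e n)\<^sup>2 / ?\<rho>\<^sup>2) \<le> 1 * 1"
          using a b E by (intro mult_mono) auto
        then have "?E / (4 * pi) * ((e n)\<^sup>2 / ?\<rho>\<^sup>2) * (k\<^sup>2 * (1 / ?\<rho>) + 3 * k * (1 / ?\<rho>\<^sup>2))
            \<le> 1 * ((k\<^sup>2 * (R * (1 + R\<^sup>2)) + 3 * k * (1 + R\<^sup>2)) * dominating x)"
          using c \<rho> k by (intro mult_mono) auto
        then have "?E / (4 * pi) * ((e n)\<^sup>2 / ?\<rho>\<^sup>2) * (k\<^sup>2 * (1 / ?\<rho>) + 3 * k * (1 / ?\<rho>\<^sup>2)) * \<bar>\<phi> x\<bar>
            \<le> ((k\<^sup>2 * (R * (1 + R\<^sup>2)) + 3 * k * (1 + R\<^sup>2)) * dominating x) * B"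
          by (rule mult_mono[OF order_trans[OF _ eq_refl[OF mult_1]] B1]) (use k B in auto)
        moreover have U0: "0 \<le> ?E / (4 * pi) * ((e n)\<^sup>2 / ?\<rho>\<^sup>2) * (k\<^sup>2 * (1 / ?\<rho>) + 3 * k * (1 / ?\<rho>\<^sup>2))"
          using \<rho> k by auto
        ultimately show ?thesis
          unfolding abs_mult_pos'[OF U0, of "\<phi> x", symmetric] by (simp only: mult_ac)
      next
        case False
        then have "\<phi> x = 0" using B(3)[of x] by simp
        moreover have "0 \<le> B * (k\<^sup>2 * (R * (1 + R\<^sup>2)) + 3 * k * (1 + R\<^sup>2)) * dominating x"
          using B k by (intro mult_nonneg_nonneg add_nonneg_nonneg) auto
        ultimately show ?thesis by (simp only: mult_zero_right abs_zero)
      qed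
      \<comment> \<open>Both 1 - exp(-k \<rho>) and \<phi>(x) - \<phi>(0) are of order \<rho>. The
        factor gained turns \<epsilon>^2/\<rho>^5, whose mass concentrates at the origin, into
        \<epsilon>^2/\<rho>^4, which \<open>dominating\<close> bounds for every n.\<close>
      have 2: "\<bar>?T n x * (?E * \<phi> x - \<phi> 0)\<bar> \<le> (L + B * k) * dominating x"
      proof -
        have "\<bar>?E * \<phi> x - \<phi> 0\<bar> \<le> \<bar>(1 - ?E) * \<phi> x\<bar> + \<bar>\<phi> x - \<phi> 0\<bar>"
          by (simp add: left_diff_distrib)
        also have "\<dots> \<le> (k * ?\<rho>) * B + L * norm (x - 0)"
          using E exp_ge_add_one_self[of "- k * ?\<rho>"] B1[of x] k \<rho> unfolding abs_mult
          by (intro add_mono L mult_mono) auto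
        also have "\<dots> \<le> (L + B * k) * ?\<rho>"
          using \<rho>(2) mult_left_mono[OF \<rho>(2) L(1)] by (simp add: algebra_simps)
        finally have "?T n x * \<bar>?E * \<phi> x - \<phi> 0\<bar> \<le> ?T n x * ((L + B * k) * ?\<rho>)"
          using \<rho> by (intro mult_left_mono) auto
        also have "\<dots> = (L + B * k) * ((3 / (4 * pi)) * ((e n)\<^sup>2 / ?\<rho> ^ 4))"
          using \<rho> by (simp add: field_simps eval_nat_numeral)
        also have "\<dots> \<le> (L + B * k) * (1 * dominating x)"
        proof (intro mult_left_mono mult_mono)
          have "?\<rho> ^ 4 = ((norm x)\<^sup>2 + (e n)\<^sup>2)\<^sup>2"
            using rb(4)[of n x] by (metis power_mult mult_2 numeral_Bit0)
          moreover have "(e n)\<^sup>2 * ((norm x)\<^sup>2 * (1 + (norm x)\<^sup>2)) \<le> ((norm x)\<^sup>2 + (e n)\<^sup>2)\<^sup>2"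
          proof -
            \<comment> \<open>Used with a = |x|^2 and b = \<epsilon>^2, which is at most 1 by the
              choice of the sequence \<open>e\<close>.\<close>
            have "b * (a * (1 + a)) \<le> (a + b)\<^sup>2" if "0 \<le> a" "0 \<le> b" "b \<le> 1" for a b :: real
            proof -
              have "(a + b)\<^sup>2 - b * (a * (1 + a)) = a * a * (1 - b) + a * b + b * b"
                by (simp add: power2_eq_square algebra_simps)
              moreover have "0 \<le> a * a * (1 - b) + a * b + b * b"
                using that by (intro add_nonneg_nonneg mult_nonneg_nonneg) auto
              ultimately show ?thesis by linarith
            qed
            then show ?thesis using e1 by simp
          qed
          ultimately show "(e n)\<^sup>2 / ?\<rho> ^ 4 \<le> dominating x"
            unfolding dominating_def using \<rho>(1) rpos[OF elim] by (simp add: divide_simps add_pos_pos mult_ac)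
          show "3 / (4 * pi) \<le> 1" using pi_gt3 by (simp add: divide_simps)
        qed (use B k L \<rho> in auto)
        finally show ?thesis using \<rho> by (simp add: abs_mult)
      qed
      show ?case unfolding q real_norm_def using 1 2 by (intro order_trans[OF abs_triangle_ineq]) (simp add: distrib_right)
    qed
  qed (use dominating_integrable in auto)
  then have "(\<lambda>n. (\<integral>x. q n x \<partial>lborel) + \<phi> 0) \<longlonglongrightarrow> 0 + \<phi> 0"
    by (intro tendsto_intros) simp
  ultimately show ?thesis
    unfolding eq \<psi>_def[symmetric] using LIMSEQ_unique by fastforce
qed

subsection \<open>Affine substitutions\<close>

lemma partial_affine:
  assumes "f differentiable (at (c + a *\<^sub>R x))"
  shows "(\<lambda>x. f (c + a *\<^sub>R x)) differentiable (at x)"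
    "partial i (\<lambda>x. f (c + a *\<^sub>R x)) x = a * partial i f (c + a *\<^sub>R x)"
proof -
  let ?D = "frechet_derivative f (at (c + a *\<^sub>R x))"
  have D: "(f has_derivative ?D) (at (c + a *\<^sub>R x))"
    using assms by (simp add: frechet_derivative_works)
  have "((\<lambda>x. c + a *\<^sub>R x) has_derivative (\<lambda>v. a *\<^sub>R v)) (at x)"
    by (auto intro!: derivative_eq_intros)
  from has_derivative_compose[OF this D]
  have 1: "((\<lambda>x. f (c + a *\<^sub>R x)) has_derivative (\<lambda>v. ?D (a *\<^sub>R v))) (at x)" .
  then show "(\<lambda>x. f (c + a *\<^sub>R x)) differentiable (at x)" by (auto simp: differentiable_def)
  show "partial i (\<lambda>x. f (c + a *\<^sub>R x)) x = a * partial i f (c + a *\<^sub>R x)"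
    unfolding partial_eq[OF 1] using linear_cmul[OF has_derivative_linear[OF D]] by (simp add: partial_def)
qed

lemma Ck_affine: "Ck k f \<Longrightarrow> Ck k (\<lambda>x. f (c + a *\<^sub>R x))"
proof (induction k arbitrary: f)
  case (Suc k)
  then have "partial i (\<lambda>x. f (c + a *\<^sub>R x)) = (\<lambda>x. a * partial i f (c + a *\<^sub>R x))" for i
    by (intro ext partial_affine(2)) auto
  then show ?case using Suc by (auto intro!: Ck_mult Ck_const partial_affine)
qed (auto intro!: partial_affine)

lemma smooth_affine: "smooth f \<Longrightarrow> smooth (\<lambda>x. f (c + a *\<^sub>R x))"
  by (simp add: smooth_def Ck_affine)

lemma test_affine:
  assumes "test_function \<phi>" "a \<noteq> 0"
  shows "test_function (\<lambda>x. \<phi> (c + a *\<^sub>R x))"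
proof -
  obtain R where R: "\<And>x. norm x > R \<Longrightarrow> \<phi> x = 0" using assms by (auto simp: test_function_iff)
  have "\<phi> (c + a *\<^sub>R x) = 0" if "norm x > (R + norm c) / \<bar>a\<bar>" for x
  proof (rule R)
    have "R + norm c < norm (a *\<^sub>R x)" using that assms by (simp add: field_simps)
    moreover have "norm (a *\<^sub>R x) \<le> norm (c + a *\<^sub>R x) + norm c"
      using norm_triangle_ineq4[of "c + a *\<^sub>R x" c] by simp
    ultimately show "norm (c + a *\<^sub>R x) > R" by simp
  qed
  then show ?thesis using assms smooth_affine unfolding test_function_iff by blast
qed

lemma test_shift: "test_function \<phi> \<Longrightarrow> test_function (\<lambda>x. \<phi> (c + x))"
  using test_affine[of \<phi> 1 c] by simp

lemma partial_shift: "test_function \<phi> \<Longrightarrow> partial i (\<lambda>x. \<phi> (c + x)) = (\<lambda>x. partial i \<phi> (c + x))"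
  using partial_affine(2)[of \<phi> c 1] test_differentiable by (intro ext) fastforce

lemma laplace_shift: "test_function \<phi> \<Longrightarrow> laplace (\<lambda>x. \<phi> (c + x)) = (\<lambda>x. laplace \<phi> (c + x))"
  by (simp add: laplace_alt[abs_def] partial_shift test_partial)

lemma fundamental_solution:
  assumes "l \<ge> 0" and \<phi>: "test_function \<phi>"
  shows "(\<integral>x. kern l (x - y) * (l * \<phi> x - laplace \<phi> x) \<partial>lborel) = \<phi> y"
proof -
  have [measurable]: "\<phi> \<in> borel_measurable borel" "laplace \<phi> \<in> borel_measurable borel"
    using \<phi> test_laplace test_measurable by auto
  have "(\<integral>x. kern l (x - y) * (l * \<phi> x - laplace \<phi> x) \<partial>lborel)
      = (\<integral>x. kern l (y + x - y) * (l * \<phi> (y + x) - laplace \<phi> (y + x)) \<partial>lborel)"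
    by (rule lborel_integral_shift[symmetric]) measurable
  also have "\<dots> = \<phi> y"
    using fundamental_solution_at_0[OF assms(1) test_shift[OF \<phi>, of y]]
    by (simp add: laplace_shift[OF \<phi>])
  finally show ?thesis .
qed

subsection \<open>Integrability of the kernel\<close>

text \<open>After multiplication by r^2 (1 + r^2) the claims say that r + r^3 and 1 + r^2 are
  bounded by multiples of exp(k r) and exp(2 k r), which follows from t \<le> exp t. At the origin
  both sides are 0 by the convention for division.\<close>

lemma kern_bounds:
  assumes "l > 0"
  obtains C where "C \<ge> 0" "\<And>x. kern l x \<le> C * dominating x" "\<And>x. (kern l x)\<^sup>2 \<le> C * dominating x"
proof -
  define k where "k = sqrt l"
  have k: "k > 0" using assms by (simp add: k_def)
  have e1: "r \<le> exp (k * r) / k" if "r > 0" for r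
  proof -
    have "k * r \<le> exp (k * r)" using exp_ge_add_one_self[of "k * r"] by linarith
    then show ?thesis using k by (simp add: field_simps)
  qed
  \<comment> \<open>The constant 27 is the cube of 3: t \<le> exp t is applied to t = k r / 3 and
    cubed.\<close>
  have e3: "r ^ 3 \<le> 27 / k ^ 3 * exp (k * r)" if "r > 0" for r
  proof -
    have "(k * r / 3) ^ 3 \<le> exp (k * r / 3) ^ 3"
    proof (intro power_mono)
      show "k * r / 3 \<le> exp (k * r / 3)" using exp_ge_add_one_self[of "k * r / 3"] by linarith
    qed (use k that in auto)
    also have "\<dots> = exp (k * r)" by (simp flip: exp_of_nat_mult)
    finally show ?thesis using k by (simp add: field_simps power_mult_distrib power_divide)
  qed
  have e2: "r\<^sup>2 \<le> 1 / k\<^sup>2 * exp (2 * (k * r))" if "r > 0" for r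
  proof -
    have "(k * r)\<^sup>2 \<le> (exp (k * r))\<^sup>2"
    proof (intro power_mono)
      show "k * r \<le> exp (k * r)" using exp_ge_add_one_self[of "k * r"] by linarith
    qed (use k that in auto)
    also have "\<dots> = exp (2 * (k * r))" by (simp add: exp_double)
    finally show ?thesis using k by (simp add: field_simps power_mult_distrib)
  qed
  let ?C1 = "1 / k + 27 / k ^ 3" and ?C2 = "1 + 1 / k\<^sup>2"
  have 1: "kern l x \<le> ?C1 * dominating x" for x
  proof (cases "x = 0")
    case False
    let ?r = "norm x"
    have r: "?r > 0" using False by simp
    have "?r * (1 + ?r\<^sup>2) = ?r + ?r ^ 3" by (simp add: algebra_simps power2_eq_square power3_eq_cube)
    also have "\<dots> \<le> ?C1 * exp (k * ?r)" using e1[OF r] e3[OF r] by (simp add: algebra_simps)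
    also have "\<dots> = 1 * (?C1 * exp (k * ?r))" by simp
    also have "\<dots> \<le> (4 * pi) * (?C1 * exp (k * ?r))"
      using pi_gt3 k by (intro mult_right_mono) auto
    finally have "?r * (1 + ?r\<^sup>2) * exp (- (k * ?r)) \<le> (4 * pi) * (?C1 * exp (k * ?r)) * exp (- (k * ?r))"
      by (intro mult_right_mono) auto
    also have "\<dots> = 4 * pi * ?C1" by (simp add: exp_minus)
    finally have "exp (- (k * ?r)) * (?r * (1 + ?r\<^sup>2)) \<le> ?C1 * (4 * pi)" by (simp only: mult_ac)
    moreover have "kern l x = exp (- (k * ?r)) * (?r * (1 + ?r\<^sup>2)) / (4 * pi * (?r\<^sup>2 * (1 + ?r\<^sup>2)))"
      using r add_pos_nonneg[of 1 "?r\<^sup>2"] by (simp add: kern_def k_def power2_eq_square)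
    ultimately have "kern l x \<le> ?C1 * (4 * pi) / (4 * pi * (?r\<^sup>2 * (1 + ?r\<^sup>2)))"
      by (simp only:) (intro divide_right_mono, auto)
    then show ?thesis by (simp add: dominating_def)
  qed (use k in \<open>simp add: kern_def\<close>)
  have 2: "(kern l x)\<^sup>2 \<le> ?C2 * dominating x" for x
  proof (cases "x = 0")
    case False
    let ?r = "norm x"
    have r: "?r > 0" using False by simp
    have "1 \<le> exp (2 * (k * ?r))" using k by simp
    then have "1 + ?r\<^sup>2 \<le> ?C2 * exp (2 * (k * ?r))" using e2[OF r] unfolding distrib_right by linarith
    then have "(1 + ?r\<^sup>2) * exp (- (2 * (k * ?r))) \<le> ?C2 * exp (2 * (k * ?r)) * exp (- (2 * (k * ?r)))"
      by (intro mult_right_mono) auto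
    then have a: "exp (- (2 * (k * ?r))) * (1 + ?r\<^sup>2) \<le> ?C2"
      unfolding mult.assoc exp_minus_inverse by (simp only: mult_1_right mult_1_left mult.commute)
    have "(kern l x)\<^sup>2 = exp (- (2 * (k * ?r))) / ((4 * pi)\<^sup>2 * ?r\<^sup>2)"
      by (simp add: kern_def k_def power_divide power_mult_distrib exp_double[symmetric])
    also have "\<dots> \<le> exp (- (2 * (k * ?r))) / (1 * ?r\<^sup>2)"
    proof -
      have "1\<^sup>2 \<le> (4 * pi)\<^sup>2" using pi_gt3 by (intro power_mono) auto
      then show ?thesis using r by (intro frac_le mult_right_mono) auto
    qed
    also have "\<dots> = exp (- (2 * (k * ?r))) * (1 + ?r\<^sup>2) * dominating x"
      using r add_pos_nonneg[of 1 "?r\<^sup>2"] by (simp add: dominating_def)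
    also have "\<dots> \<le> ?C2 * dominating x" by (intro mult_right_mono a) auto
    finally show ?thesis .
  qed (use k in \<open>simp add: kern_def\<close>)
  show ?thesis
  proof (rule that[of "max ?C1 ?C2"])
    show "0 \<le> max ?C1 ?C2" using k by (simp add: le_max_iff_disj)
    show "kern l x \<le> max ?C1 ?C2 * dominating x" for x
      by (rule order_trans[OF 1]) (intro mult_right_mono, auto)
    show "(kern l x)\<^sup>2 \<le> max ?C1 ?C2 * dominating x" for x
      by (rule order_trans[OF 2]) (intro mult_right_mono, auto)
  qed
qed

lemma kern_integrable:
  assumes "l > 0" shows "integrable lborel (kern l)"
proof -
  obtain C where "\<And>x. kern l x \<le> C * dominating x" using kern_bounds[OF assms] by metis
  then show ?thesis
    by (intro Bochner_Integration.integrable_bound[OF integrable_mult_right[OF dominating_integrable, of C]])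
       (auto intro!: AE_I2 intro: order_trans[OF _ abs_ge_self])
qed

lemma kern_square_integrable:
  assumes "l > 0" shows "square_integrable (kern l)"
proof -
  obtain C where "\<And>x. (kern l x)\<^sup>2 \<le> C * dominating x" using kern_bounds[OF assms] by metis
  then show ?thesis unfolding square_integrable_def
    by (intro conjI Bochner_Integration.integrable_bound[OF integrable_mult_right[OF dominating_integrable, of C]])
       (auto intro!: AE_I2 intro: order_trans[OF _ abs_ge_self])
qed

text \<open>Includes l = 0, where the exponential decay is missing and only a bound on each ball is
  available; this case is needed for \<open>G0\<close>.\<close>

lemma kern_locally_integrable:
  assumes "l \<ge> 0" shows "locally_integrable (kern l)"
proof (rule locally_integrableI)
  fix R :: real
  show "integrable lborel (\<lambda>x. kern l x * indicator (cball 0 R) x)"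
  proof (rule Bochner_Integration.integrable_bound[OF integrable_mult_right[OF dominating_integrable, of "R * (1 + R\<^sup>2)"]])
    have "kern l x * indicator (cball 0 R) x \<le> \<bar>R * (1 + R\<^sup>2) * dominating x\<bar>" for x
    proof (cases "x \<noteq> 0 \<and> norm x \<le> R")
      case True
      have "kern l x \<le> kern 0 x" by (rule kern_le_0[OF assms])
      also have "\<dots> \<le> 1 / (1 * norm x)" using True pi_gt3 unfolding kern_0 by (intro frac_le mult_right_mono) auto
      also have "\<dots> \<le> R * (1 + R\<^sup>2) * dominating x" using dominating_ball(2)[of x R] True by simp
      finally show ?thesis using True by simp
    qed (auto simp: kern_def)
    then show "AE x in lborel. norm (kern l x * indicator (cball 0 R) x) \<le> norm (R * (1 + R\<^sup>2) * dominating x)"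
      by (intro AE_I2) (simp add: abs_mult)
  qed measurable
qed measurable

lemma integrable_shift:
  fixes f :: "R3 \<Rightarrow> real"
  assumes "integrable lborel f" shows "integrable lborel (\<lambda>x. f (x - y))"
  using lborel_integrable_shift[OF assms, of "- y"] by (simp add: algebra_simps)

lemma square_integrable_shift:
  "square_integrable f \<Longrightarrow> square_integrable (\<lambda>x. f (x - y))"
  using integrable_shift[of "\<lambda>x. (f x)\<^sup>2" y] by (auto simp: square_integrable_def)

lemma locally_integrable_shift:
  assumes "locally_integrable f" shows "locally_integrable (\<lambda>x. f (x - y))"
proof (rule locally_integrableI)
  have [measurable]: "f \<in> borel_measurable borel" using assms by (simp add: locally_integrable_def)
  show "(\<lambda>x. f (x - y)) \<in> borel_measurable borel" by measurable
  fix R :: real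
  have "integrable lborel (\<lambda>x. f (x - y) * indicator (cball 0 (R + norm y)) (x - y))"
    by (rule integrable_shift[OF locally_integrable_ball[OF assms]])
  then show "integrable lborel (\<lambda>x. f (x - y) * indicator (cball 0 R) x)"
  proof (rule Bochner_Integration.integrable_bound)
    show "AE x in lborel. norm (f (x - y) * indicator (cball 0 R) x)
        \<le> norm (f (x - y) * indicator (cball 0 (R + norm y)) (x - y))"
    proof (rule AE_I2)
      fix x
      show "norm (f (x - y) * indicator (cball 0 R) x)
        \<le> norm (f (x - y) * indicator (cball 0 (R + norm y)) (x - y))"
        using norm_triangle_ineq4[of x y] by (auto simp: indicator_def)
    qed
  qed measurable
qed

section \<open>Convolution with the kernel\<close>

lemma kern_integral:
  assumes "l > 0"
  shows "(\<integral>\<^sup>+x. ennreal (kern l x) \<partial>lborel) = ennreal (1 / l)" "(\<integral>x. kern l x \<partial>lborel) = 1 / l"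
proof -
  define k where "k = sqrt l"
  have k: "k > 0" "k\<^sup>2 = l" using assms by (auto simp: k_def)
  have "(\<integral>\<^sup>+x. ennreal (kern l x) \<partial>lborel)
      = (\<integral>\<^sup>+s. ennreal (4 * pi * s\<^sup>2) * indicator {0..} s * ennreal (exp (- k * s) / (4 * pi * s)) \<partial>lborel)"
    unfolding kern_def k_def by (rule nn_integral_radial[of "\<lambda>s. ennreal (exp (- sqrt l * s) / (4 * pi * s))"]) measurable
  also have "\<dots> = (\<integral>\<^sup>+s. ennreal (s * exp (- k * s)) * indicator {0..} s \<partial>lborel)"
  proof (rule nn_integral_cong)
    fix s :: real
    show "ennreal (4 * pi * s\<^sup>2) * indicator {0..} s * ennreal (exp (- k * s) / (4 * pi * s))
       = ennreal (s * exp (- k * s)) * indicator {0..} s"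
    proof (cases "s > 0")
      case True
      have "ennreal (4 * pi * s\<^sup>2) * ennreal (exp (- k * s) / (4 * pi * s)) = ennreal (4 * pi * s\<^sup>2 * (exp (- k * s) / (4 * pi * s)))"
        by (rule ennreal_mult[symmetric]) (use True in auto)
      also have "4 * pi * s\<^sup>2 * (exp (- k * s) / (4 * pi * s)) = s * exp (- k * s)"
        using True by (simp add: field_simps power2_eq_square)
      finally show ?thesis using True by simp
    next
      case False
      then show ?thesis by (cases "s = 0") auto
    qed
  qed
  \<comment> \<open>An antiderivative of s exp(-k s) is - (1 + k s) exp(-k s) / k^2; the polynomial
    \<open>[:1, 1:]\<close> is 1 + t, so that \<open>poly_exp_tendsto_0\<close> gives the limit at
    infinity.\<close>
  also have "\<dots> = ennreal (0 - - (1 / k\<^sup>2 * (poly [:1, 1:] (k * 0) * exp (- (k * 0)))))"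
  proof (rule nn_integral_FTC_atLeast[where F = "\<lambda>s. - (1 / k\<^sup>2 * (poly [:1, 1:] (k * s) * exp (- (k * s))))"])
    show "((\<lambda>s. - (1 / k\<^sup>2 * (poly [:1, 1:] (k * s) * exp (- (k * s))))) has_real_derivative s * exp (- k * s)) (at s)" for s
      using k by (auto intro!: derivative_eq_intros simp: field_simps power2_eq_square)
    have "filterlim (\<lambda>s. k * s) at_top at_top"
      using k by (intro filterlim_tendsto_pos_mult_at_top[OF tendsto_const _ filterlim_ident])
    then have "((\<lambda>s. poly [:1, 1:] (k * s) * exp (- (k * s))) \<longlongrightarrow> 0) at_top"
      using poly_exp_tendsto_0[of "[:1, 1:]"] by (rule filterlim_compose[rotated])
    then have "((\<lambda>s. - (1 / k\<^sup>2 * (poly [:1, 1:] (k * s) * exp (- (k * s))))) \<longlongrightarrow> - (1 / k\<^sup>2 * 0)) at_top"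
      by (intro tendsto_intros)
    then show "((\<lambda>s. - (1 / k\<^sup>2 * (poly [:1, 1:] (k * s) * exp (- (k * s))))) \<longlongrightarrow> 0) at_top" by simp
  qed auto
  also have "\<dots> = ennreal (1 / l)" using k by simp
  finally show 1: "(\<integral>\<^sup>+x. ennreal (kern l x) \<partial>lborel) = ennreal (1 / l)" .
  have "ennreal (\<integral>x. kern l x \<partial>lborel) = ennreal (1 / l)"
    using nn_integral_eq_integral[OF kern_integrable[OF assms]] 1 by simp
  then show "(\<integral>x. kern l x \<partial>lborel) = 1 / l"
    using assms by (subst (asm) ennreal_inj) auto
qed

text \<open>The kernel is even, so this is the usual convolution; the order \<open>x - y\<close>
  makes the entries of \<open>G_adjoint\<close> literally its values at the points of
  \<open>Y\<close>.\<close>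

definition conv :: "real \<Rightarrow> (R3 \<Rightarrow> real) \<Rightarrow> R3 \<Rightarrow> real" where
  "conv l F y = (\<integral>x. kern l (x - y) * F x \<partial>lborel)"

lemma conv_integrable:
  assumes "l > 0" "square_integrable F"
  shows "integrable lborel (\<lambda>x. kern l (x - y) * F x)"
  by (intro square_integrable_mult square_integrable_shift kern_square_integrable assms)

lemma nn_integral_kern_shift:
  assumes "l > 0"
  shows "(\<integral>\<^sup>+x. ennreal (kern l (x - y)) \<partial>lborel) = ennreal (1 / l)"
proof -
  have "(\<integral>\<^sup>+x. ennreal (kern l (- y + x)) \<partial>lborel) = (\<integral>\<^sup>+x. ennreal (kern l x) \<partial>lborel)"
    by (subst (2) lborel_distr_plus[of "- y", symmetric], subst nn_integral_distr) auto
  then show ?thesis by (simp add: kern_integral[OF assms] algebra_simps)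
qed

lemma conv_measurable [measurable]:
  assumes [measurable]: "F \<in> borel_measurable borel"
  shows "conv l F \<in> borel_measurable borel"
  unfolding conv_def by measurable

text \<open>Integrate \<open>2 c |F| \<le> c\<^sup>2 + F\<^sup>2\<close> against the kernel, with \<open>c\<close> equal to \<open>l\<close> times the convolution
  of \<open>|F|\<close>.\<close>

lemma conv_pointwise_bound:
  assumes "l > 0" and F: "square_integrable F"
  shows "ennreal (l * (conv l F y)\<^sup>2) \<le> (\<integral>\<^sup>+x. ennreal (kern l (x - y) * (F x)\<^sup>2) \<partial>lborel)" (is "_ \<le> ?J")
proof -
  have [measurable]: "F \<in> borel_measurable borel" using F by (simp add: square_integrable_def)
  define a where "a = (\<integral>x. kern l (x - y) * \<bar>F x\<bar> \<partial>lborel)"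
  have int: "integrable lborel (\<lambda>x. kern l (x - y) * \<bar>F x\<bar>)"
    using integrable_abs[OF conv_integrable[OF assms, of y]] by (simp add: abs_mult)
  have a0: "a \<ge> 0" unfolding a_def by (intro integral_nonneg_AE) auto
  have "\<bar>conv l F y\<bar> \<le> a"
    unfolding conv_def a_def using integral_abs_bound[of lborel "\<lambda>x. kern l (x - y) * F x"] by (simp add: abs_mult)
  then have ca: "(conv l F y)\<^sup>2 \<le> a\<^sup>2" by (simp add: abs_le_square_iff[symmetric] a0)
  have "ennreal (2 * l * a\<^sup>2) = ennreal (2 * (l * a)) * ennreal a"
    using a0 assms by (subst ennreal_mult[symmetric]) (auto simp: power2_eq_square)
  also have "ennreal a = (\<integral>\<^sup>+x. ennreal (kern l (x - y) * \<bar>F x\<bar>) \<partial>lborel)"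
    unfolding a_def by (rule nn_integral_eq_integral[symmetric, OF int]) auto
  also have "ennreal (2 * (l * a)) * \<dots> = (\<integral>\<^sup>+x. ennreal (2 * (l * a)) * ennreal (kern l (x - y) * \<bar>F x\<bar>) \<partial>lborel)"
    by (rule nn_integral_cmult[symmetric]) measurable
  also have "\<dots> \<le> (\<integral>\<^sup>+x. ennreal ((l * a)\<^sup>2) * ennreal (kern l (x - y)) + ennreal (kern l (x - y) * (F x)\<^sup>2) \<partial>lborel)"
  proof (rule nn_integral_mono)
    fix x
    have "0 \<le> (l * a - \<bar>F x\<bar>)\<^sup>2" by simp
    then have "2 * (l * a) * \<bar>F x\<bar> \<le> (l * a)\<^sup>2 + (F x)\<^sup>2" by (simp add: power2_diff)
    then have "kern l (x - y) * (2 * (l * a) * \<bar>F x\<bar>) \<le> kern l (x - y) * ((l * a)\<^sup>2 + (F x)\<^sup>2)"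
      by (intro mult_left_mono) auto
    then have "ennreal (2 * (l * a) * (kern l (x - y) * \<bar>F x\<bar>)) \<le> ennreal ((l * a)\<^sup>2 * kern l (x - y) + kern l (x - y) * (F x)\<^sup>2)"
      by (intro ennreal_leI) (simp add: algebra_simps)
    then show "ennreal (2 * (l * a)) * ennreal (kern l (x - y) * \<bar>F x\<bar>)
       \<le> ennreal ((l * a)\<^sup>2) * ennreal (kern l (x - y)) + ennreal (kern l (x - y) * (F x)\<^sup>2)"
      using a0 assms(1) by (subst ennreal_mult[symmetric], simp, simp, subst ennreal_mult[symmetric], simp, simp) (simp add: ennreal_plus)
  qed
  also have "\<dots> = ennreal ((l * a)\<^sup>2) * ennreal (1 / l) + ?J"
    by (subst nn_integral_add) (auto simp: nn_integral_cmult nn_integral_kern_shift[OF assms(1)])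
  also have "ennreal ((l * a)\<^sup>2) * ennreal (1 / l) = ennreal (l * a\<^sup>2)"
  proof -
    have "(l * a)\<^sup>2 * (1 / l) = l * a\<^sup>2"
      using assms(1) by (simp add: power2_eq_square)
    then show ?thesis using assms(1) by (simp only: ennreal_mult[symmetric] zero_le_power2 zero_le_divide_1_iff less_imp_le)
  qed
  finally have main: "ennreal (2 * l * a\<^sup>2) \<le> ennreal (l * a\<^sup>2) + ?J" .
  have "ennreal (l * a\<^sup>2) \<le> ?J"
  proof (cases ?J)
    case (real j)
    have "ennreal (2 * l * a\<^sup>2) \<le> ennreal (l * a\<^sup>2 + j)"
      using main real assms(1) by (simp add: ennreal_plus)
    then have "2 * l * a\<^sup>2 \<le> l * a\<^sup>2 + j" using real assms(1) by (subst (asm) ennreal_le_iff) auto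
    then show ?thesis using real by (simp add: ennreal_leI)
  qed simp
  moreover have "ennreal (l * (conv l F y)\<^sup>2) \<le> ennreal (l * a\<^sup>2)"
    using ca assms(1) by (intro ennreal_leI mult_left_mono) auto
  ultimately show ?thesis by (rule order_trans[rotated])
qed

text \<open>Young's inequality for an integrable kernel of mass \<open>1 / l\<close>: the pointwise
  bound is integrated over y, the order of integration exchanged, and the mass of the kernel appears
  once more.\<close>

lemma conv_L2:
  assumes "l > 0" and F: "square_integrable F"
  shows "square_integrable (conv l F)" "(\<integral>x. (conv l F x)\<^sup>2 \<partial>lborel) \<le> (\<integral>x. (F x)\<^sup>2 \<partial>lborel) / l\<^sup>2"
proof -
  have m [measurable]: "F \<in> borel_measurable borel" using F by (simp add: square_integrable_def)
  have intF: "integrable lborel (\<lambda>x. (F x)\<^sup>2)" using F by (simp add: square_integrable_def)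
  let ?I = "\<integral>x. (F x)\<^sup>2 \<partial>lborel"
  have I: "?I \<ge> 0" by simp
  have "ennreal l * (\<integral>\<^sup>+y. ennreal ((conv l F y)\<^sup>2) \<partial>lborel) = (\<integral>\<^sup>+y. ennreal l * ennreal ((conv l F y)\<^sup>2) \<partial>lborel)"
    by (rule nn_integral_cmult[symmetric]) measurable
  also have "\<dots> = (\<integral>\<^sup>+y. ennreal (l * (conv l F y)\<^sup>2) \<partial>lborel)"
    using assms(1) by (simp add: ennreal_mult)
  also have "\<dots> \<le> (\<integral>\<^sup>+y. \<integral>\<^sup>+x. ennreal (kern l (x - y) * (F x)\<^sup>2) \<partial>lborel \<partial>lborel)"
    by (intro nn_integral_mono conv_pointwise_bound assms)
  also have "\<dots> = (\<integral>\<^sup>+x. \<integral>\<^sup>+y. ennreal (kern l (x - y) * (F x)\<^sup>2) \<partial>lborel \<partial>lborel)"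
    by (rule lborel_pair.Fubini') measurable
  also have "\<dots> = (\<integral>\<^sup>+x. ennreal (1 / l) * ennreal ((F x)\<^sup>2) \<partial>lborel)"
  proof (rule nn_integral_cong)
    fix x
    have "(\<integral>\<^sup>+y. ennreal (kern l (x - y) * (F x)\<^sup>2) \<partial>lborel) = (\<integral>\<^sup>+y. ennreal (kern l (y - x)) * ennreal ((F x)\<^sup>2) \<partial>lborel)"
      by (simp add: kern_minus[of l x] ennreal_mult)
    also have "\<dots> = (\<integral>\<^sup>+y. ennreal (kern l (y - x)) \<partial>lborel) * ennreal ((F x)\<^sup>2)"
      by (rule nn_integral_multc) measurable
    finally show "(\<integral>\<^sup>+y. ennreal (kern l (x - y) * (F x)\<^sup>2) \<partial>lborel) = ennreal (1 / l) * ennreal ((F x)\<^sup>2)"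
      by (simp add: nn_integral_kern_shift[OF assms(1)])
  qed
  also have "\<dots> = ennreal (1 / l) * (\<integral>\<^sup>+x. ennreal ((F x)\<^sup>2) \<partial>lborel)"
    by (rule nn_integral_cmult) measurable
  also have "(\<integral>\<^sup>+x. ennreal ((F x)\<^sup>2) \<partial>lborel) = ennreal ?I"
    by (rule nn_integral_eq_integral[OF intF]) simp
  finally have main: "ennreal l * (\<integral>\<^sup>+y. ennreal ((conv l F y)\<^sup>2) \<partial>lborel) \<le> ennreal (1 / l) * ennreal ?I" .
  have "(\<integral>\<^sup>+y. ennreal ((conv l F y)\<^sup>2) \<partial>lborel) = ennreal (1 / l) * (ennreal l * (\<integral>\<^sup>+y. ennreal ((conv l F y)\<^sup>2) \<partial>lborel))"
    using assms(1) by (simp add: mult.assoc[symmetric] ennreal_mult[symmetric])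
  also have "\<dots> \<le> ennreal (1 / l) * (ennreal (1 / l) * ennreal ?I)"
    by (intro mult_left_mono main) auto
  also have "\<dots> = ennreal (?I / l\<^sup>2)"
    using assms(1) I by (simp add: ennreal_mult[symmetric] power2_eq_square)
  finally have le: "(\<integral>\<^sup>+y. ennreal ((conv l F y)\<^sup>2) \<partial>lborel) \<le> ennreal (?I / l\<^sup>2)" .
  have int: "integrable lborel (\<lambda>y. (conv l F y)\<^sup>2)"
    using le by (intro integrableI_nonneg) (auto intro: le_less_trans)
  then show "square_integrable (conv l F)" by (simp add: square_integrable_def)
  have "ennreal (\<integral>x. (conv l F x)\<^sup>2 \<partial>lborel) \<le> ennreal (?I / l\<^sup>2)"
    using le nn_integral_eq_integral[OF int] by simp
  then show "(\<integral>x. (conv l F x)\<^sup>2 \<partial>lborel) \<le> ?I / l\<^sup>2"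
    by (subst (asm) ennreal_le_iff) (use I in auto)
qed

lemma square_integrable_abs: "square_integrable f \<Longrightarrow> square_integrable (\<lambda>x. \<bar>f x\<bar>)"
  by (auto simp: square_integrable_def)

text \<open>Fubini and evenness of the kernel. Absolute integrability of the double integrand is the
  L2 bound for the convolution of |F|, paired with |H|.\<close>

lemma conv_symmetric:
  assumes "l > 0" "square_integrable F" "square_integrable H"
  shows "(\<integral>x. conv l F x * H x \<partial>lborel) = (\<integral>x. F x * conv l H x \<partial>lborel)"
proof -
  have [measurable]: "F \<in> borel_measurable borel" "H \<in> borel_measurable borel"
    using assms by (auto simp: square_integrable_def)
  let ?K = "\<lambda>x y. kern l (x - y) * F x * H y"
  have F: "integrable lborel (\<lambda>x. kern l (x - y) * \<bar>F x\<bar>)" for y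
    by (intro conv_integrable square_integrable_abs assms)
  have "integrable (lborel \<Otimes>\<^sub>M lborel) (\<lambda>(y, x). ?K x y)"
  proof (rule lborel_pair.Fubini_integrable)
    have eq: "(\<integral>x. norm (?K x y) \<partial>lborel) = conv l (\<lambda>x. \<bar>F x\<bar>) y * \<bar>H y\<bar>" for y
      unfolding conv_def by (simp add: abs_mult)
    show "integrable lborel (\<lambda>y. \<integral>x. norm (case (y, x) of (y, x) \<Rightarrow> ?K x y) \<partial>lborel)"
      using eq by (simp add: square_integrable_mult conv_L2(1) square_integrable_abs assms)
    show "AE y in lborel. integrable lborel (\<lambda>x. case (y, x) of (y, x) \<Rightarrow> ?K x y)"
      using conv_integrable[OF assms(1,2)] by simp
  qed measurable
  then have "(\<integral>x. \<integral>y. ?K x y \<partial>lborel \<partial>lborel) = (\<integral>y. \<integral>x. ?K x y \<partial>lborel \<partial>lborel)"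
    using lborel_pair.Fubini_integral[of "\<lambda>y x. ?K x y"] by simp
  moreover have "(\<integral>x. ?K x y \<partial>lborel) = conv l F y * H y" for y
    by (simp add: conv_def)
  moreover have "(\<integral>y. ?K x y \<partial>lborel) = F x * conv l H x" for x
    unfolding conv_def kern_minus[of l x]
    by (subst integral_mult_right_zero[symmetric]) (simp add: mult_ac)
  ultimately show ?thesis by (simp only:)
qed

lemma conv_fundamental:
  assumes "l > 0" "test_function \<phi>"
  shows "conv l (\<lambda>x. l * \<phi> x - laplace \<phi> x) = \<phi>"
  using fundamental_solution[of l \<phi>] assms by (auto simp: conv_def)

subsection \<open>Smoothness of the convolution\<close>

text \<open>Translation moves the parameter y from the singular kernel to \<phi>, so that
  derivatives in y fall on \<phi> alone.\<close>

lemma conv_shift: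
  assumes "\<phi> \<in> borel_measurable borel"
  shows "conv l \<phi> y = (\<integral>x. kern l x * \<phi> (y + x) \<partial>lborel)"
proof -
  note [measurable] = assms
  show ?thesis
    unfolding conv_def by (subst lborel_integral_shift[of _ y, symmetric]) auto
qed

text \<open>The mean value inequality is applied to \<phi> minus its linearisation at z, whose
  derivative is bounded on the ball of radius |h| by the Lipschitz constants of the partials. The
  constant does not depend on z, so the remainder can be integrated.\<close>

lemma test_taylor:
  assumes "test_function \<phi>"
  obtains C where "C \<ge> 0" "\<And>z h. \<bar>\<phi> (z + h) - \<phi> z - (\<Sum>i\<in>UNIV. h $ i * partial i \<phi> z)\<bar> \<le> C * (norm h)\<^sup>2"
proof -
  have "\<exists>L. L \<ge> 0 \<and> (\<forall>x y. \<bar>partial i \<phi> x - partial i \<phi> y\<bar> \<le> L * norm (x - y))" for i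
    using test_lipschitz[OF test_partial[OF assms, of i]] by metis
  then obtain L where L: "\<And>i. L i \<ge> 0" "\<And>i x y. \<bar>partial i \<phi> x - partial i \<phi> y\<bar> \<le> L i * norm (x - y)"
    by metis
  define M where "M = (\<Sum>i\<in>UNIV. L i)"
  have M: "M \<ge> 0" "\<And>i. L i \<le> M" unfolding M_def using L(1) by (auto intro!: sum_nonneg member_le_sum)
  have "\<bar>\<phi> (z + h) - \<phi> z - (\<Sum>i\<in>UNIV. h $ i * partial i \<phi> z)\<bar> \<le> (3 * M) * (norm h)\<^sup>2" for z h
  proof -
    let ?D = "\<lambda>x. frechet_derivative \<phi> (at x)"
    have D: "(\<phi> has_derivative ?D x) (at x)" for x
      using test_differentiable[OF assms] by (simp add: frechet_derivative_works)
    have "norm ((\<phi> (z + h) - ?D z (z + h)) - (\<phi> z - ?D z z)) \<le> (3 * (M * norm h)) * norm (z + h - z)"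
    proof (rule differentiable_bound[where S = "cball z (norm h)" and f' = "\<lambda>x v. ?D x v - ?D z v"])
      fix x assume x: "x \<in> cball z (norm h)"
      show "((\<lambda>x. \<phi> x - ?D z x) has_derivative (\<lambda>v. ?D x v - ?D z v)) (at x within cball z (norm h))"
        by (intro has_derivative_diff has_derivative_at_withinI[OF D] bounded_linear_imp_has_derivative
            has_derivative_bounded_linear[OF D])
      show "onorm (\<lambda>v. ?D x v - ?D z v) \<le> 3 * (M * norm h)"
      proof (rule onorm_le)
        fix v
        have "?D x v - ?D z v = (\<Sum>i\<in>UNIV. v $ i * (partial i \<phi> x - partial i \<phi> z))"
          by (simp add: frechet_derivative_partials test_differentiable[OF assms] sum_subtractf right_diff_distrib)
        then have "norm (?D x v - ?D z v) \<le> (\<Sum>i\<in>UNIV. \<bar>v $ i * (partial i \<phi> x - partial i \<phi> z)\<bar>)"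
          by simp
        also have "\<dots> \<le> (\<Sum>i\<in>(UNIV::3 set). norm v * (M * norm h))"
        proof (rule sum_mono)
          fix i :: 3
          have "\<bar>partial i \<phi> x - partial i \<phi> z\<bar> \<le> L i * norm (x - z)" by (rule L)
          also have "\<dots> \<le> M * norm h"
            using x M L(1) by (intro mult_mono) (auto simp: dist_norm norm_minus_commute)
          finally show "\<bar>v $ i * (partial i \<phi> x - partial i \<phi> z)\<bar> \<le> norm v * (M * norm h)"
            unfolding abs_mult by (intro mult_mono component_le_norm_cart) auto
        qed
        also have "\<dots> = 3 * (M * norm h) * norm v" by simp
        finally show "norm (?D x v - ?D z v) \<le> 3 * (M * norm h) * norm v" .
      qed
    qed (auto simp: dist_norm)
    moreover have "?D z (z + h) = ?D z z + ?D z h"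
      using linear_add[OF has_derivative_linear[OF D]] by blast
    moreover have "?D z h = (\<Sum>i\<in>UNIV. h $ i * partial i \<phi> z)"
      by (rule frechet_derivative_partials) (rule test_differentiable[OF assms])
    ultimately show ?thesis by (simp add: power2_eq_square algebra_simps)
  qed
  then show ?thesis using M(1) by (intro that[of "3 * M"]) auto
qed

text \<open>Integrating the uniform Taylor remainder against the kernel, whose mass is
  \<open>1 / l\<close>, bounds the error of the linearisation by a multiple of |h|^2.\<close>

lemma conv_test_has_derivative:
  assumes "l > 0" "test_function \<phi>"
  shows "(conv l \<phi> has_derivative (\<lambda>h. \<Sum>i\<in>UNIV. h $ i * conv l (partial i \<phi>) y)) (at y)"
proof -
  obtain C where C: "C \<ge> 0" "\<And>z h. \<bar>\<phi> (z + h) - \<phi> z - (\<Sum>i\<in>UNIV. h $ i * partial i \<phi> z)\<bar> \<le> C * (norm h)\<^sup>2"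
    using test_taylor[OF assms(2)] by metis
  have int: "integrable lborel (\<lambda>x. kern l x * \<psi> (y + x))" if "test_function \<psi>" for \<psi> y
    using kern_locally_integrable[of l] assms(1) that
    by (intro integrable_locally_mult_test test_shift) auto
  note tp = test_partial[OF assms(2)]
  let ?E = "\<lambda>z h. \<phi> (z + h) - \<phi> z - (\<Sum>i\<in>UNIV. h $ i * partial i \<phi> z)"
  have eq: "conv l \<phi> (y + h) - conv l \<phi> y - (\<Sum>i\<in>UNIV. h $ i * conv l (partial i \<phi>) y)
      = (\<integral>x. kern l x * ?E (y + x) h \<partial>lborel)"
    and intE: "integrable lborel (\<lambda>x. kern l x * ?E (y + x) h)" for h
  proof -
    have i1: "integrable lborel (\<lambda>x. kern l x * \<phi> (y + h + x))" "integrable lborel (\<lambda>x. kern l x * \<phi> (y + x))"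
      "\<And>i. integrable lborel (\<lambda>x. h $ i * (kern l x * partial i \<phi> (y + x)))"
      using int[OF assms(2)] int[OF tp] by (auto intro: integrable_mult_right)
    have e: "kern l x * ?E (y + x) h = kern l x * \<phi> (y + h + x) - kern l x * \<phi> (y + x)
        - (\<Sum>i\<in>UNIV. h $ i * (kern l x * partial i \<phi> (y + x)))" for x
      by (simp add: algebra_simps sum_distrib_left)
    show "integrable lborel (\<lambda>x. kern l x * ?E (y + x) h)"
      unfolding e using i1 by (intro Bochner_Integration.integrable_diff Bochner_Integration.integrable_sum) auto
    show "conv l \<phi> (y + h) - conv l \<phi> y - (\<Sum>i\<in>UNIV. h $ i * conv l (partial i \<phi>) y)
      = (\<integral>x. kern l x * ?E (y + x) h \<partial>lborel)"
      unfolding e conv_shift[OF test_measurable[OF assms(2)]] conv_shift[OF test_measurable[OF tp]]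
      using i1 by (simp add: Bochner_Integration.integral_diff Bochner_Integration.integrable_diff Bochner_Integration.integral_sum)
  qed
  have bnd: "\<bar>conv l \<phi> (y + h) - conv l \<phi> y - (\<Sum>i\<in>UNIV. h $ i * conv l (partial i \<phi>) y)\<bar> \<le> C / l * (norm h)\<^sup>2" for h
  proof -
    have "\<bar>\<integral>x. kern l x * ?E (y + x) h \<partial>lborel\<bar> \<le> (\<integral>x. \<bar>kern l x * ?E (y + x) h\<bar> \<partial>lborel)"
      by (rule integral_abs_bound)
    also have "\<dots> \<le> (\<integral>x. kern l x * (C * (norm h)\<^sup>2) \<partial>lborel)"
      using kern_integrable[OF assms(1)] C(2) integrable_abs[OF intE]
      by (intro integral_mono integrable_mult_left) (auto simp: abs_mult intro!: mult_left_mono)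
    also have "\<dots> = C / l * (norm h)\<^sup>2" by (simp add: kern_integral(2)[OF assms(1)])
    finally show ?thesis unfolding eq .
  qed
  show ?thesis
  proof (rule has_derivativeI_sandwich[where e = 1 and H = "\<lambda>z. C / l * norm (z - y)"])
    show "bounded_linear (\<lambda>h. \<Sum>i\<in>UNIV. h $ i * conv l (partial i \<phi>) y)"
      by (intro bounded_linear_sum bounded_linear_mult_const bounded_linear_vec_nth)
    show "((\<lambda>z. C / l * norm (z - y)) \<longlongrightarrow> 0) (at y)"
      by (rule tendsto_eq_intros refl | simp)+
    show "norm (conv l \<phi> z - conv l \<phi> y - (\<Sum>i\<in>UNIV. (z - y) $ i * conv l (partial i \<phi>) y)) / norm (z - y)
       \<le> C / l * norm (z - y)" if "z \<noteq> y" for z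
      using bnd[of "z - y"] that by (simp add: pos_divide_le_eq power2_eq_square mult.assoc)
  qed simp
qed

lemma conv_test_partial:
  assumes "l > 0" "test_function \<phi>"
  shows "partial i (conv l \<phi>) = conv l (partial i \<phi>)"
proof
  fix y
  have "(\<Sum>j\<in>UNIV. axis i 1 $ j * conv l (partial j \<phi>) y) = conv l (partial i \<phi>) y"
    by (simp add: axis_def if_distrib[of "\<lambda>c. c * _"] cong: if_cong)
  then show "partial i (conv l \<phi>) y = conv l (partial i \<phi>) y"
    using partial_eq[OF conv_test_has_derivative[OF assms]] by simp
qed

lemma conv_test_smooth:
  assumes "l > 0" "test_function \<phi>"
  shows "smooth (conv l \<phi>)"
proof -
  have "Ck k (conv l \<phi>)" for k
    using assms(2)
  proof (induction k arbitrary: \<phi>)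
    case 0
    then show ?case using conv_test_has_derivative[OF assms(1)] by (auto simp: differentiable_def)
  next
    case (Suc k)
    have "conv l \<phi> differentiable (at x)" for x
      using conv_test_has_derivative[OF assms(1) Suc.prems] by (auto simp: differentiable_def)
    then show ?case using Suc by (simp add: conv_test_partial[OF assms(1)] test_partial)
  qed
  then show ?thesis by (simp add: smooth_def)
qed

text \<open>\<open>conv_fundamental\<close> makes the convolution a left inverse of l -
  \<Delta>-type composition on test functions, applied after it; since derivatives commute with the
  convolution, the two operations can also be composed in the opposite order.\<close>

lemma conv_test_laplace:
  assumes "l > 0" "test_function \<phi>"
  shows "l * conv l \<phi> y - laplace (conv l \<phi>) y = \<phi> y"
proof -
  have int: "integrable lborel (\<lambda>x. kern l (x - y) * \<psi> x)" if "test_function \<psi>" for \<psi>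
    using conv_integrable[OF assms(1) test_square_integrable[OF that]] .
  have "laplace (conv l \<phi>) y = (\<Sum>i\<in>UNIV. conv l (partial i (partial i \<phi>)) y)"
    by (simp add: laplace_alt conv_test_partial assms test_partial)
  also have "\<dots> = conv l (laplace \<phi>) y"
    unfolding conv_def laplace_alt sum_distrib_left
    by (rule Bochner_Integration.integral_sum[symmetric]) (intro int test_partial assms)
  finally have "l * conv l \<phi> y - laplace (conv l \<phi>) y = conv l (\<lambda>x. l * \<phi> x - laplace \<phi> x) y"
    unfolding conv_def right_diff_distrib using int[OF assms(2)] int[OF test_laplace[OF assms(2)]]
    by (subst Bochner_Integration.integral_diff) (auto simp: mult.left_commute)
  then show ?thesis by (simp add: conv_fundamental assms)
qed

subsection \<open>Uniqueness for the Helmholtz equation\<close>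

text \<open>The normalisation to 1 at the origin serves two opposite scalings: stretched, the
  function tends to 1 everywhere; contracted around a point, it isolates the value there.\<close>

definition cutoff :: "R3 \<Rightarrow> real" where
  "cutoff x = bump 0 (1 - (norm x)\<^sup>2) / bump 0 1"

lemma test_cutoff: "test_function cutoff"
  unfolding test_function_iff
proof
  have "smooth (\<lambda>x. inverse (bump 0 1) * bump 0 (1 - (norm (x - 0))\<^sup>2))"
    by (intro smooth_cmult smooth_bump smooth_diff smooth_const smooth_norm_sq)
  then show "smooth cutoff" by (simp add: cutoff_def[abs_def] divide_inverse mult.commute)
  have "cutoff x = 0" if "norm x > 1" for x
    using that by (simp add: cutoff_def bump_0_eq_0_iff one_le_power)
  then show "\<exists>R. \<forall>x. norm x > R \<longrightarrow> cutoff x = 0" by blast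
qed

lemma cutoff_0: "cutoff 0 = 1"
  using bump_0_eq_0_iff[of 1] by (simp add: cutoff_def)

lemma partial_scale: "test_function \<phi> \<Longrightarrow> partial i (\<lambda>x. \<phi> (a *\<^sub>R x)) = (\<lambda>x. a * partial i \<phi> (a *\<^sub>R x))"
  using partial_affine(2)[of \<phi> 0 a] test_differentiable by (intro ext) fastforce

lemma partial_cmult: "f differentiable (at x) \<Longrightarrow> partial i (\<lambda>x. c * f x) x = c * partial i f x"
  using partial_mult[of "\<lambda>_. c" x f i] by (simp add: partial_const)

lemma laplace_scale:
  assumes "test_function \<phi>"
  shows "laplace (\<lambda>x. \<phi> (a *\<^sub>R x)) x = a\<^sup>2 * laplace \<phi> (a *\<^sub>R x)"
proof -
  have "(\<lambda>x. partial i \<phi> (a *\<^sub>R x)) differentiable (at x)" for i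
    using partial_affine(1)[of "partial i \<phi>" 0 a x] test_differentiable[OF test_partial[OF assms]] by simp
  then show ?thesis
    by (simp add: laplace_alt partial_scale assms test_partial partial_cmult sum_distrib_left power2_eq_square mult.assoc)
qed

lemma laplace_mult:
  assumes "smooth f" "smooth g"
  shows "laplace (\<lambda>x. f x * g x) x = f x * laplace g x + 2 * (\<Sum>i\<in>UNIV. partial i f x * partial i g x) + laplace f x * g x"
proof -
  note d = smooth_differentiable smooth_partial smooth_mult assms
  have 1: "partial i (\<lambda>x. f x * g x) = (\<lambda>x. partial i f x * g x + f x * partial i g x)" for i
    by (intro ext partial_mult d)
  have "partial i (partial i (\<lambda>x. f x * g x)) x =
      partial i (partial i f) x * g x + 2 * (partial i f x * partial i g x) + f x * partial i (partial i g) x" for i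
    unfolding 1 by (subst partial_add, (intro d)+, subst partial_mult, (intro d)+, subst partial_mult, (intro d)+) simp
  then show ?thesis
    by (simp add: laplace_alt sum.distrib sum_distrib_left sum_distrib_right)
qed

text \<open>The test functions \<open>cutoff (x / n) * conv l \<psi>\<close> are mapped by \<open>l - \<Delta>\<close> to functions tending to \<open>\<psi>\<close>.\<close>

lemma helmholtz_unique:
  assumes "l > 0" and v: "square_integrable v"
    and zero: "\<And>\<phi>. test_function \<phi> \<Longrightarrow> (\<integral>x. v x * (l * \<phi> x - laplace \<phi> x) \<partial>lborel) = 0"
  shows "AE x in lborel. v x = 0"
proof (rule fundamental_lemma[OF square_integrable_locally[OF v]])
  fix \<psi> assume \<psi>: "test_function \<psi>"
  have [measurable]: "v \<in> borel_measurable borel" using v by (simp add: square_integrable_def)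
  have [measurable]: "\<psi> \<in> borel_measurable borel" using \<psi> by (rule test_measurable)
  \<comment> \<open>\<open>W\<close> solves l W - \<Delta>W = \<psi> but need not have compact
    support, so it cannot be inserted into the hypothesis without a cut-off.\<close>
  define W where "W = conv l \<psi>"
  have W: "smooth W" unfolding W_def by (rule conv_test_smooth[OF assms(1) \<psi>])
  have W2: "square_integrable W" unfolding W_def by (intro conv_L2 assms test_square_integrable \<psi>)
  have dW2: "square_integrable (partial i W)" for i
    unfolding W_def conv_test_partial[OF assms(1) \<psi>] by (intro conv_L2 assms test_square_integrable test_partial \<psi>)
  have [measurable]: "W \<in> borel_measurable borel" "partial i W \<in> borel_measurable borel" for i
    using W2 dW2 by (auto simp: square_integrable_def)
  define c where "c n = 1 / real (Suc n)" for n
  have c: "c n > 0" "c n \<le> 1" for n by (auto simp: c_def)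
  have c0: "c \<longlonglongrightarrow> 0"
    unfolding c_def using LIMSEQ_inverse_real_of_nat by (simp add: inverse_eq_divide)
  define g where "g n x = cutoff (c n *\<^sub>R x)" for n x
  have tg: "test_function (g n)" for n
    unfolding g_def using test_affine[OF test_cutoff, of "c n" 0] c(1)[of n] by simp
  \<comment> \<open>The Leibniz expansion of l - \<Delta> on the cut-off product: each derivative
    that hits the cut-off contributes a factor \<open>c n\<close>, while the undifferentiated term
    contains \<psi> by the equation for \<open>W\<close>.\<close>
  define q where "q n x = cutoff (c n *\<^sub>R x) * \<psi> x
      - 2 * (\<Sum>i\<in>UNIV. c n * partial i cutoff (c n *\<^sub>R x) * partial i W x)
      - (c n)\<^sup>2 * laplace cutoff (c n *\<^sub>R x) * W x" for n x
  have q: "l * (g n x * W x) - laplace (\<lambda>x. g n x * W x) x = q n x" for n x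
  proof -
    have dg: "partial i (g n) x = c n * partial i cutoff (c n *\<^sub>R x)" for i
      unfolding g_def partial_scale[OF test_cutoff] ..
    have lg: "laplace (g n) x = (c n)\<^sup>2 * laplace cutoff (c n *\<^sub>R x)"
      unfolding g_def by (rule laplace_scale[OF test_cutoff])
    have psi: "\<psi> x = l * W x - laplace W x"
      unfolding W_def conv_test_laplace[OF assms(1) \<psi>] ..
    show ?thesis
      unfolding laplace_mult[OF test_smooth[OF tg] W] dg lg q_def psi g_def[of n x, symmetric]
      by (simp add: algebra_simps)
  qed
  obtain B0 R0 where B0: "B0 \<ge> 0" "\<And>x. \<bar>cutoff x\<bar> \<le> B0 * indicator (cball 0 R0) x"
    using test_bound[OF test_cutoff] by metis
  obtain B1 where B1: "B1 \<ge> 0" "\<And>i x. \<bar>partial i cutoff x\<bar> \<le> B1" using test_partials_bound[OF test_cutoff] by metis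
  obtain B2 R2 where B2: "B2 \<ge> 0" "\<And>x. \<bar>laplace cutoff x\<bar> \<le> B2 * indicator (cball 0 R2) x"
    using test_bound[OF test_laplace[OF test_cutoff]] by metis
  have B0': "\<bar>cutoff x\<bar> \<le> B0" for x using B0(2)[of x] B0(1) by (cases "x \<in> cball 0 R0") auto
  have B2': "\<bar>laplace cutoff x\<bar> \<le> B2" for x using B2(2)[of x] B2(1) by (cases "x \<in> cball 0 R2") auto
  let ?w = "\<lambda>x. B0 * \<bar>v x * \<psi> x\<bar> + 2 * (\<Sum>i\<in>UNIV. B1 * \<bar>v x * partial i W x\<bar>) + B2 * \<bar>v x * W x\<bar>"
  have "(\<lambda>n. \<integral>x. v x * q n x \<partial>lborel) \<longlonglongrightarrow> (\<integral>x. v x * \<psi> x \<partial>lborel)"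
  proof (rule integral_dominated_convergence[where w = ?w])
    show "integrable lborel ?w"
      by (intro Bochner_Integration.integrable_add integrable_mult_right Bochner_Integration.integrable_sum
          integrable_abs square_integrable_mult v W2 dW2 test_square_integrable \<psi>)
    have [measurable]: "cutoff \<in> borel_measurable borel" "partial i cutoff \<in> borel_measurable borel"
      "laplace cutoff \<in> borel_measurable borel" for i
      using test_cutoff test_partial test_laplace test_measurable by auto
    show "(\<lambda>x. v x * q n x) \<in> borel_measurable lborel" for n
      unfolding q_def by measurable
    show "AE x in lborel. (\<lambda>n. v x * q n x) \<longlonglongrightarrow> v x * \<psi> x"
    proof (rule AE_I2)
      fix x
      have lim: "(\<lambda>n. h (c n *\<^sub>R x)) \<longlonglongrightarrow> h 0" if "test_function h" for h
      proof -
        have "isCont h 0" using test_differentiable[OF that] by (rule differentiable_imp_continuous_within)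
        moreover have "(\<lambda>n. c n *\<^sub>R x) \<longlonglongrightarrow> 0 *\<^sub>R x" by (intro tendsto_intros c0)
        ultimately show ?thesis using isCont_tendsto_compose[of 0 h] by fastforce
      qed
      have "(\<lambda>n. v x * q n x) \<longlonglongrightarrow> v x * (cutoff 0 * \<psi> x - 2 * (\<Sum>i\<in>UNIV. 0 * partial i cutoff 0 * partial i W x)
         - 0\<^sup>2 * laplace cutoff 0 * W x)"
        unfolding q_def by (intro tendsto_intros lim c0 test_cutoff test_partial test_laplace)
      then show "(\<lambda>n. v x * q n x) \<longlonglongrightarrow> v x * \<psi> x" by (simp add: cutoff_0)
    qed
    show "AE x in lborel. norm (v x * q n x) \<le> ?w x" for n
    proof (rule AE_I2)
      fix x
      have "\<bar>v x * q n x\<bar> \<le> \<bar>v x\<bar> * (B0 * \<bar>\<psi> x\<bar> + 2 * (\<Sum>i\<in>UNIV. B1 * \<bar>partial i W x\<bar>) + B2 * \<bar>W x\<bar>)"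
        unfolding abs_mult
      proof (rule mult_left_mono)
        have 1: "\<bar>cutoff (c n *\<^sub>R x) * \<psi> x\<bar> \<le> B0 * \<bar>\<psi> x\<bar>"
          unfolding abs_mult by (intro mult_right_mono B0') auto
        have cc: "\<bar>c n * z\<bar> \<le> b" if "\<bar>z\<bar> \<le> b" for z b
          using mult_mono[of "c n" 1 "\<bar>z\<bar>" b] c[of n] that by (simp add: abs_mult)
        have "\<bar>\<Sum>i\<in>UNIV. c n * partial i cutoff (c n *\<^sub>R x) * partial i W x\<bar>
           \<le> (\<Sum>i\<in>UNIV. \<bar>c n * partial i cutoff (c n *\<^sub>R x) * partial i W x\<bar>)"
          by (rule sum_abs)
        also have "\<dots> \<le> (\<Sum>i\<in>UNIV. B1 * \<bar>partial i W x\<bar>)"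
        proof (rule sum_mono)
          fix i :: 3
          show "\<bar>c n * partial i cutoff (c n *\<^sub>R x) * partial i W x\<bar> \<le> B1 * \<bar>partial i W x\<bar>"
            unfolding abs_mult[of _ "partial i W x"] by (intro mult_right_mono cc B1) auto
        qed
        finally have 2: "\<bar>\<Sum>i\<in>UNIV. c n * partial i cutoff (c n *\<^sub>R x) * partial i W x\<bar> \<le> (\<Sum>i\<in>UNIV. B1 * \<bar>partial i W x\<bar>)" .
        have 3: "\<bar>(c n)\<^sup>2 * laplace cutoff (c n *\<^sub>R x) * W x\<bar> \<le> B2 * \<bar>W x\<bar>"
          unfolding power2_eq_square mult.assoc[of "c n"] abs_mult[of _ "W x"]
          by (metis abs_ge_zero abs_mult B2' cc mult.assoc mult_right_mono)
        show "\<bar>q n x\<bar> \<le> B0 * \<bar>\<psi> x\<bar> + 2 * (\<Sum>i\<in>UNIV. B1 * \<bar>partial i W x\<bar>) + B2 * \<bar>W x\<bar>"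
          unfolding q_def using 1 2 3 by linarith
      qed simp
      also have "\<dots> = ?w x"
        by (simp add: distrib_left sum_distrib_left abs_mult mult_ac)
      finally show "norm (v x * q n x) \<le> ?w x" by simp
    qed
  qed measurable
  moreover have "(\<integral>x. v x * q n x \<partial>lborel) = 0" for n
    unfolding q[symmetric] by (rule zero) (intro test_mult_right tg W)
  ultimately show "(\<integral>x. v x * \<psi> x \<partial>lborel) = 0" by (simp add: LIMSEQ_const_iff)
qed

section \<open>Hilbert space facts\<close>

text \<open>For small t the linear term decides the sign, which is negative on one side unless d =
  0. It is the first-order condition at a minimum; the witness uses N + 1 so that N = 0 needs no
  separate treatment.\<close>

lemma quadratic_nonneg_imp_zero:
  fixes d N :: real
  assumes N: "0 \<le> N" and nonneg: "\<And>t. 0 \<le> 2 * t * d + t\<^sup>2 * N"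
  shows "d = 0"
proof (rule ccontr)
  assume "d \<noteq> 0"
  define a where "a = 1 / (N + 1)"
  have a: "a > 0" "a * N \<le> 1" using N by (auto simp: a_def)
  have "2 * (- d * a) * d + (- d * a)\<^sup>2 * N = (a * d\<^sup>2) * (a * N - 2)"
    by (simp add: power2_eq_square algebra_simps)
  also have "\<dots> < 0" using a \<open>d \<noteq> 0\<close> by (intro mult_pos_neg) auto
  finally show False using nonneg[of "- d * a"] by simp
qed

text \<open>Riesz representation of a functional \<open>F\<close> on a parametrised subspace \<open>J ` V\<close>: the
  representing vector is the limit of a minimising sequence of \<open>\<parallel>J v\<parallel>\<^sup>2 - 2 F v\<close>, so it lies in
  the closure of the subspace.\<close>

lemma riesz_on_subspace:
  fixes J :: "'v \<Rightarrow> 'h::{real_inner, complete_space}" and F :: "'v \<Rightarrow> real"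
  assumes ne: "V \<noteq> {}"
    and lin: "\<And>a b s t. a \<in> V \<Longrightarrow> b \<in> V \<Longrightarrow> \<exists>c\<in>V. J c = s *\<^sub>R J a + t *\<^sub>R J b \<and> F c = s * F a + t * F b"
    and bound: "\<And>v. v \<in> V \<Longrightarrow> \<bar>F v\<bar> \<le> C * norm (J v)"
  obtains g where "g \<in> closure (J ` V)" "\<And>v. v \<in> V \<Longrightarrow> g \<bullet> J v = F v"
proof -
  define q where "q v = (norm (J v))\<^sup>2 - 2 * F v" for v
  have low: "- (C\<^sup>2) \<le> q v" if "v \<in> V" for v
  proof -
    have "2 * F v \<le> 2 * norm (J v) * C" using bound[OF that] by (simp add: mult.commute)
    moreover have "0 \<le> (norm (J v) - C)\<^sup>2" by simp
    ultimately show ?thesis unfolding q_def power2_diff by linarith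
  qed
  define m where "m = Inf (q ` V)"
  have bdd: "bdd_below (q ` V)" using low by (auto intro!: bdd_belowI)
  have m: "m \<le> q v" if "v \<in> V" for v unfolding m_def using that bdd by (intro cInf_lower) auto
  have "\<exists>v\<in>V. q v < m + 1 / real (Suc n)" for n
    using cInf_lessD[of "q ` V" "m + 1 / real (Suc n)"] ne by (auto simp: m_def)
  then obtain s where s: "\<And>n. s n \<in> V" "\<And>n. q (s n) < m + 1 / real (Suc n)" by metis
  \<comment> \<open>Parallelogram law with the midpoint c, whose value is at least m: near-minimal
    elements have nearby images.\<close>
  have par: "(norm (J a - J b))\<^sup>2 \<le> 2 * (q a - m) + 2 * (q b - m)" if ab: "a \<in> V" "b \<in> V" for a b
  proof -
    obtain c where c: "c \<in> V" "J c = (1/2) *\<^sub>R J a + (1/2) *\<^sub>R J b" "F c = 1/2 * F a + 1/2 * F b"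
      using lin[OF ab] by metis
    have "(norm (J a - J b))\<^sup>2 + 4 * (norm (J c))\<^sup>2 = 2 * (norm (J a))\<^sup>2 + 2 * (norm (J b))\<^sup>2"
      unfolding c(2) power2_norm_eq_inner by (simp add: algebra_simps inner_commute)
    then show ?thesis using m[OF c(1)] unfolding q_def c(3) by simp
  qed
  have e0: "(\<lambda>n. 1 / real (Suc n)) \<longlonglongrightarrow> 0"
    using LIMSEQ_inverse_real_of_nat by (simp add: inverse_eq_divide)
  have "Cauchy (\<lambda>n. J (s n))"
  proof (rule metric_CauchyI)
    fix e :: real assume e: "e > 0"
    then obtain N where N: "\<And>n. n \<ge> N \<Longrightarrow> 1 / real (Suc n) < e\<^sup>2 / 4"
      using order_tendstoD(2)[OF e0, of "e\<^sup>2 / 4"] by (auto simp: eventually_sequentially)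
    show "\<exists>M. \<forall>i\<ge>M. \<forall>n\<ge>M. dist (J (s i)) (J (s n)) < e"
    proof (intro exI allI impI)
      fix i n assume iN: "N \<le> i" "N \<le> n"
      then have "(norm (J (s i) - J (s n)))\<^sup>2 < e\<^sup>2"
      proof -
        have "q (s k) < m + e\<^sup>2 / 4" if "N \<le> k" for k
          using s(2)[of k] add_strict_left_mono[OF N[OF that], of m] by (rule less_trans)
        from this[OF iN(1)] this[OF iN(2)]
        have "2 * (q (s i) - m) + 2 * (q (s n) - m) < e\<^sup>2" by (simp add: field_simps)
        with par[OF s(1) s(1)] show ?thesis by (rule le_less_trans)
      qed
      then show "dist (J (s i)) (J (s n)) < e"
        unfolding dist_norm by (rule power2_less_imp_less) (use e in simp)
    qed
  qed
  then obtain g where g: "(\<lambda>n. J (s n)) \<longlonglongrightarrow> g" by (auto simp: Cauchy_convergent_iff convergent_def)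
  have gcl: "g \<in> closure (J ` V)"
    unfolding closure_sequential using g s(1) by (intro exI[of _ "\<lambda>n. J (s n)"]) auto
  have main: "g \<bullet> J v = F v" if v: "v \<in> V" for v
  proof -
    \<comment> \<open>The limit of the inequality stating that a variation of the minimising
      sequence by \<open>t\<close> times v does not go below the infimum.\<close>
    have pos: "0 \<le> 2 * t * (g \<bullet> J v - F v) + t\<^sup>2 * (norm (J v))\<^sup>2" for t
    proof -
      have "- (1 / real (Suc n)) \<le> 2 * t * (J (s n) \<bullet> J v - F v) + t\<^sup>2 * (norm (J v))\<^sup>2" for n
      proof -
        obtain c where c: "c \<in> V" "J c = 1 *\<^sub>R J (s n) + t *\<^sub>R J v" "F c = 1 * F (s n) + t * F v"
          using lin[OF s(1) v] by metis
        have "q c = q (s n) + 2 * t * (J (s n) \<bullet> J v - F v) + t\<^sup>2 * (norm (J v))\<^sup>2"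
          unfolding q_def c(2,3) power2_norm_eq_inner
          by (simp add: algebra_simps inner_commute power2_eq_square)
        then show ?thesis using m[OF c(1)] s(2)[of n] by linarith
      qed
      then have ev: "\<exists>n0. \<forall>n\<ge>n0. - (1 / real (Suc n)) \<le> 2 * t * (J (s n) \<bullet> J v - F v) + t\<^sup>2 * (norm (J v))\<^sup>2"
        by blast
      have lim: "(\<lambda>n. 2 * t * (J (s n) \<bullet> J v - F v) + t\<^sup>2 * (norm (J v))\<^sup>2)
          \<longlonglongrightarrow> 2 * t * (g \<bullet> J v - F v) + t\<^sup>2 * (norm (J v))\<^sup>2"
        by (intro tendsto_intros g)
      from LIMSEQ_le[OF tendsto_minus[OF e0] lim ev] show ?thesis by simp
    qed
    have "g \<bullet> J v - F v = 0"
      using pos by (rule quadratic_nonneg_imp_zero[rotated]) simp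
    then show ?thesis by simp
  qed
  show ?thesis using that[OF gcl main] by blast
qed

text \<open>The functional given by f is represented by some g in the closure; f - g is orthogonal
  to the subspace, hence 0. This replaces an orthogonal projection.\<close>

lemma dense_if_orthogonal_trivial:
  fixes J :: "'v \<Rightarrow> 'h::{real_inner, complete_space}"
  assumes ne: "V \<noteq> {}"
    and lin: "\<And>a b s t. a \<in> V \<Longrightarrow> b \<in> V \<Longrightarrow> \<exists>c\<in>V. J c = s *\<^sub>R J a + t *\<^sub>R J b"
    and orth: "\<And>v. (\<And>a. a \<in> V \<Longrightarrow> v \<bullet> J a = 0) \<Longrightarrow> v = 0"
  shows "closure (J ` V) = UNIV"
proof -
  have "f \<in> closure (J ` V)" for f
  proof (rule riesz_on_subspace[of V J "\<lambda>a. f \<bullet> J a" "norm f"])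
    show "\<exists>c\<in>V. J c = s *\<^sub>R J a + t *\<^sub>R J b \<and> f \<bullet> J c = s * (f \<bullet> J a) + t * (f \<bullet> J b)"
      if "a \<in> V" "b \<in> V" for a b s t
      using lin[OF that, of s t] by (auto simp: inner_add_right)
    show "\<bar>f \<bullet> J v\<bar> \<le> norm f * norm (J v)" for v by (rule Cauchy_Schwarz_ineq2)
    fix g assume g: "g \<in> closure (J ` V)" "\<And>v. v \<in> V \<Longrightarrow> g \<bullet> J v = f \<bullet> J v"
    then have "g - f = 0" by (intro orth) (simp add: inner_diff_left)
    then show ?thesis using g(1) by simp
  qed (use ne in auto)
  then show ?thesis by auto
qed

subsection \<open>Representatives\<close>

lemma L2_eq_refl: "square_integrable f \<Longrightarrow> L2_eq f f"
  by (simp add: L2_eq_def)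

lemma inner_abs_L2:
  assumes "square_integrable f" "square_integrable g"
  shows "inner (abs_L2 f) (abs_L2 g) = (\<integral>x. f x * g x \<partial>lborel)"
  by (rule inner_L2.abs_eq) (use assms in \<open>auto simp: L2_eq_refl\<close>)

lemma inner_rep_abs:
  "square_integrable g \<Longrightarrow> inner u (abs_L2 g) = (\<integral>x. rep_L2 u x * g x \<partial>lborel)"
  using inner_abs_L2[OF square_integrable_rep[of u]] by simp

lemma abs_L2_eqI:
  assumes "square_integrable f" "square_integrable g" "AE x in lborel. f x = g x"
  shows "abs_L2 f = abs_L2 g"
  by (rule Quotient3_rel_abs[OF Quotient3_L2]) (use assms in \<open>simp add: L2_eq_def\<close>)

lemma abs_L2_add:
  "square_integrable f \<Longrightarrow> square_integrable g \<Longrightarrow> abs_L2 f + abs_L2 g = abs_L2 (\<lambda>x. f x + g x)"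
  by (rule plus_L2.abs_eq) (auto simp: L2_eq_refl)

lemma abs_L2_scale: "square_integrable f \<Longrightarrow> c *\<^sub>R abs_L2 f = abs_L2 (\<lambda>x. c * f x)"
  by (rule scaleR_L2.abs_eq) (auto simp: L2_eq_refl)

lemma rep_add_AE: "AE x in lborel. rep_L2 (u + v) x = rep_L2 u x + rep_L2 v x"
proof -
  have "u + v = abs_L2 (\<lambda>x. rep_L2 u x + rep_L2 v x)"
    using abs_L2_add[OF square_integrable_rep square_integrable_rep, of u v] by simp
  then show ?thesis
    by (simp only: rep_abs_L2 square_integrable_add square_integrable_rep)
qed

lemma rep_scale_AE: "AE x in lborel. rep_L2 (c *\<^sub>R u) x = c * rep_L2 u x"
proof -
  have "c *\<^sub>R u = abs_L2 (\<lambda>x. c * rep_L2 u x)"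
    using abs_L2_scale[OF square_integrable_rep, of c u] by simp
  then show ?thesis
    by (simp only: rep_abs_L2 square_integrable_scale square_integrable_rep)
qed

lemma rep_measurable [measurable]: "rep_L2 u \<in> borel_measurable borel"
  using square_integrable_rep[of u] by (simp add: square_integrable_def)

lemma norm_abs_L2_sq:
  "square_integrable f \<Longrightarrow> (norm (abs_L2 f))\<^sup>2 = (\<integral>x. (f x)\<^sup>2 \<partial>lborel)"
  unfolding power2_norm_eq_inner by (simp add: inner_abs_L2 power2_eq_square)

lemma L2_zero_if_orthogonal_test:
  assumes "\<And>\<phi>. test_function \<phi> \<Longrightarrow> inner u (abs_L2 \<phi>) = 0"
  shows "u = 0"
proof -
  have "AE x in lborel. rep_L2 u x = 0"
    using assms by (intro fundamental_lemma square_integrable_locally square_integrable_rep)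
      (simp add: inner_rep_abs test_square_integrable)
  then have "abs_L2 (rep_L2 u) = abs_L2 (\<lambda>x. 0)"
    by (intro abs_L2_eqI square_integrable_rep square_integrable_zero)
  then show ?thesis by (simp add: zero_L2.abs_eq[symmetric])
qed

subsection \<open>The resolvent of the Laplacian\<close>

definition Res :: "real \<Rightarrow> L2 \<Rightarrow> L2" where
  "Res l F = abs_L2 (conv l (rep_L2 F))"

definition helmholtz :: "real \<Rightarrow> (R3 \<Rightarrow> real) \<Rightarrow> R3 \<Rightarrow> real" where
  "helmholtz l \<phi> x = l * \<phi> x - laplace \<phi> x"

lemma test_helmholtz: "test_function \<phi> \<Longrightarrow> test_function (helmholtz l \<phi>)"
  unfolding helmholtz_def by (intro test_diff test_cmult test_laplace)

lemma conv_rep_abs: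
  assumes "square_integrable f"
  shows "conv l (rep_L2 (abs_L2 f)) = conv l f"
proof
  fix y
  have [measurable]: "f \<in> borel_measurable borel" using assms by (simp add: square_integrable_def)
  show "conv l (rep_L2 (abs_L2 f)) y = conv l f y"
    unfolding conv_def
  proof (rule integral_cong_AE)
    show "AE x in lborel. kern l (x - y) * rep_L2 (abs_L2 f) x = kern l (x - y) * f x"
      using rep_abs_L2[OF assms] by eventually_elim simp
  qed measurable
qed

lemma Res_abs: "square_integrable f \<Longrightarrow> Res l (abs_L2 f) = abs_L2 (conv l f)"
  by (simp add: Res_def conv_rep_abs)

lemma conv_add:
  assumes "l > 0" "square_integrable f" "square_integrable g"
  shows "conv l (\<lambda>x. f x + g x) = (\<lambda>y. conv l f y + conv l g y)"
  unfolding fun_eq_iff conv_def using conv_integrable assms by (simp add: distrib_left)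

lemma conv_cmult: "conv l (\<lambda>x. c * f x) = (\<lambda>y. c * conv l f y)"
  unfolding conv_def integral_mult_right_zero[symmetric] by (simp only: mult.left_commute)

lemma Res_linear:
  assumes "l > 0" shows "linear (Res l)"
proof (rule linearI)
  note s = square_integrable_rep and c = conv_L2(1)[OF assms square_integrable_rep]
  show "Res l (u + v) = Res l u + Res l v" for u v
  proof -
    have "Res l (u + v) = Res l (abs_L2 (\<lambda>x. rep_L2 u x + rep_L2 v x))"
      using abs_L2_add[OF s s, of u v] by simp
    also have "\<dots> = abs_L2 (\<lambda>x. conv l (rep_L2 u) x + conv l (rep_L2 v) x)"
      by (subst Res_abs) (auto intro!: square_integrable_add s simp: conv_add[OF assms s s])
    finally show ?thesis by (simp add: Res_def abs_L2_add c)
  qed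
  show "Res l (r *\<^sub>R u) = r *\<^sub>R Res l u" for r u
  proof -
    have "Res l (r *\<^sub>R u) = Res l (abs_L2 (\<lambda>x. r * rep_L2 u x))"
      using abs_L2_scale[OF s, of r u] by simp
    also have "\<dots> = abs_L2 (\<lambda>x. r * conv l (rep_L2 u) x)"
      by (subst Res_abs) (auto intro!: square_integrable_scale s simp: conv_cmult)
    finally show ?thesis by (simp add: Res_def abs_L2_scale c)
  qed
qed

lemma Res_norm:
  assumes "l > 0" shows "norm (Res l F) \<le> norm F / l"
proof -
  have "(norm (Res l F))\<^sup>2 \<le> (norm F)\<^sup>2 / l\<^sup>2"
    unfolding Res_def norm_abs_L2_sq[OF conv_L2(1)[OF assms square_integrable_rep]]
    using conv_L2(2)[OF assms square_integrable_rep[of F]] norm_abs_L2_sq[OF square_integrable_rep[of F]] by simp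
  then have "(norm (Res l F))\<^sup>2 \<le> (norm F / l)\<^sup>2" by (simp add: power_divide)
  then show ?thesis by (rule power2_le_imp_le) (use assms in simp)
qed

lemma Res_bounded_linear:
  assumes "l > 0" shows "bounded_linear (Res l)"
  using Res_linear[OF assms] Res_norm[OF assms]
  by (intro bounded_linear_intro[where K = "1 / l"]) (auto simp: linear_add linear_cmul)

lemma Res_symmetric:
  assumes "l > 0" shows "inner (Res l u) v = inner u (Res l v)"
  using conv_symmetric[OF assms square_integrable_rep square_integrable_rep, of u v]
    inner_abs_L2[OF conv_L2(1)[OF assms square_integrable_rep] square_integrable_rep, of u v]
    inner_abs_L2[OF square_integrable_rep conv_L2(1)[OF assms square_integrable_rep], of u v]
  by (simp add: Res_def)

lemma Res_helmholtz:
  assumes "l > 0" "test_function \<phi>"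
  shows "Res l (abs_L2 (helmholtz l \<phi>)) = abs_L2 \<phi>"
  unfolding Res_abs[OF test_square_integrable[OF test_helmholtz[OF assms(2)]]]
  unfolding helmholtz_def conv_fundamental[OF assms] ..

lemma Res_weak:
  assumes "l > 0" "test_function \<phi>"
  shows "inner (Res l F) (abs_L2 (helmholtz l \<phi>)) = inner F (abs_L2 \<phi>)"
  by (simp add: Res_symmetric Res_helmholtz assms)

lemma helmholtz_orthogonal:
  assumes "l > 0" "\<And>\<phi>. test_function \<phi> \<Longrightarrow> inner v (abs_L2 (helmholtz l \<phi>)) = 0"
  shows "v = 0"
proof -
  have "AE x in lborel. rep_L2 v x = 0"
  proof (rule helmholtz_unique[OF assms(1) square_integrable_rep])
    fix \<phi> assume \<phi>: "test_function \<phi>"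
    show "(\<integral>x. rep_L2 v x * (l * \<phi> x - laplace \<phi> x) \<partial>lborel) = 0"
      using assms(2)[OF \<phi>] inner_rep_abs[OF test_square_integrable[OF test_helmholtz[OF \<phi>]], of v l]
      by (simp add: helmholtz_def)
  qed
  then have "abs_L2 (rep_L2 v) = abs_L2 (\<lambda>x. 0)"
    by (intro abs_L2_eqI square_integrable_rep square_integrable_zero)
  then show ?thesis by (simp add: zero_L2.abs_eq[symmetric])
qed

text \<open>The criterion behind the identities for \<open>Res\<close>: an equation (l - \<Delta>) u
  = F tested only against test functions determines u within L2.\<close>

lemma Res_unique:
  assumes "l > 0" "\<And>\<phi>. test_function \<phi> \<Longrightarrow> inner u (abs_L2 (helmholtz l \<phi>)) = inner F (abs_L2 \<phi>)"
  shows "u = Res l F"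
proof -
  have "u - Res l F = 0"
    by (rule helmholtz_orthogonal[OF assms(1)]) (simp add: inner_diff_left assms Res_weak)
  then show ?thesis by simp
qed

lemma smooth_cmult_differentiable: "smooth f \<Longrightarrow> (\<lambda>x. c * f x) differentiable (at x)"
  by (intro smooth_differentiable smooth_cmult)

lemma partial_lin:
  assumes "smooth f" "smooth g"
  shows "partial i (\<lambda>x. s * f x + t * g x) = (\<lambda>x. s * partial i f x + t * partial i g x)"
proof
  fix x
  have "partial i (\<lambda>x. s * f x + t * g x) x = partial i (\<lambda>x. s * f x) x + partial i (\<lambda>x. t * g x) x"
    by (rule partial_add) (intro smooth_cmult_differentiable assms)+
  then show "partial i (\<lambda>x. s * f x + t * g x) x = s * partial i f x + t * partial i g x"
    by (simp add: partial_cmult smooth_differentiable assms)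
qed

lemma laplace_lin:
  assumes "smooth f" "smooth g"
  shows "laplace (\<lambda>x. s * f x + t * g x) x = s * laplace f x + t * laplace g x"
  by (simp add: laplace_alt partial_lin assms smooth_partial sum.distrib sum_distrib_left)

text \<open>Density is dual to uniqueness: a vector orthogonal to all these functions solves the
  homogeneous Helmholtz equation weakly.\<close>

lemma helmholtz_dense:
  assumes "l > 0"
  shows "closure ((\<lambda>\<phi>. abs_L2 (helmholtz l \<phi>)) ` Collect test_function) = UNIV"
proof (rule dense_if_orthogonal_trivial)
  show "Collect test_function \<noteq> {}" using test_zero by auto
  show "v = 0" if "\<And>a. a \<in> Collect test_function \<Longrightarrow> inner v (abs_L2 (helmholtz l a)) = 0" for v
    using helmholtz_orthogonal[OF assms] that by auto
  fix \<phi> \<psi> s t assume "\<phi> \<in> Collect test_function" "\<psi> \<in> Collect test_function"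
  then have t: "test_function \<phi>" "test_function \<psi>" by auto
  then have th: "square_integrable (helmholtz l \<phi>)" "square_integrable (helmholtz l \<psi>)"
    by (auto intro: test_square_integrable test_helmholtz)
  have "helmholtz l (\<lambda>x. s * \<phi> x + t * \<psi> x) = (\<lambda>x. s * helmholtz l \<phi> x + t * helmholtz l \<psi> x)"
    using laplace_lin[OF test_smooth test_smooth, OF t] by (simp add: helmholtz_def fun_eq_iff algebra_simps)
  then have "abs_L2 (helmholtz l (\<lambda>x. s * \<phi> x + t * \<psi> x)) = s *\<^sub>R abs_L2 (helmholtz l \<phi>) + t *\<^sub>R abs_L2 (helmholtz l \<psi>)"
    by (simp add: abs_L2_scale abs_L2_add square_integrable_scale th)
  moreover have "test_function (\<lambda>x. s * \<phi> x + t * \<psi> x)" by (intro test_add test_cmult t)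
  ultimately show "\<exists>c\<in>Collect test_function. abs_L2 (helmholtz l c) = s *\<^sub>R abs_L2 (helmholtz l \<phi>) + t *\<^sub>R abs_L2 (helmholtz l \<psi>)"
    by blast
qed

subsection \<open>Elliptic regularity\<close>

text \<open>The mean value theorem twice, in direction i for the increment in direction j, and in
  direction j for the resulting partial.\<close>

lemma second_difference:
  assumes "smooth f" "h > 0"
  shows "\<exists>s t. 0 < s \<and> s < h \<and> 0 < t \<and> t < h \<and>
     f (x + h *\<^sub>R axis i 1 + h *\<^sub>R axis j 1) - f (x + h *\<^sub>R axis i 1) - f (x + h *\<^sub>R axis j 1) + f x
       = h * h * partial j (partial i f) (x + s *\<^sub>R axis i 1 + t *\<^sub>R axis j 1)"
proof -
  let ?e = "axis i 1 :: R3" and ?d = "axis j 1 :: R3"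
  note sd = smooth_differentiable[OF assms(1)] smooth_differentiable[OF smooth_partial[OF assms(1)]]
  define g where "g s = f ((x + h *\<^sub>R ?d) + s *\<^sub>R ?e) - f (x + s *\<^sub>R ?e)" for s
  have dg: "(g has_real_derivative partial i f ((x + h *\<^sub>R ?d) + s *\<^sub>R ?e) - partial i f (x + s *\<^sub>R ?e)) (at s)" for s
    unfolding g_def by (intro DERIV_diff partial_line sd)
  obtain s where s: "0 < s" "s < h"
    "g h - g 0 = (h - 0) * (partial i f ((x + h *\<^sub>R ?d) + s *\<^sub>R ?e) - partial i f (x + s *\<^sub>R ?e))"
    using MVT2[OF assms(2), of g "\<lambda>s. partial i f ((x + h *\<^sub>R ?d) + s *\<^sub>R ?e) - partial i f (x + s *\<^sub>R ?e)"] dg by blast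
  have d2: "((\<lambda>t. partial i f ((x + s *\<^sub>R ?e) + t *\<^sub>R ?d)) has_real_derivative partial j (partial i f) ((x + s *\<^sub>R ?e) + t *\<^sub>R ?d)) (at t)" for t
    by (intro partial_line sd)
  obtain t where t: "0 < t" "t < h"
    "partial i f ((x + s *\<^sub>R ?e) + h *\<^sub>R ?d) - partial i f ((x + s *\<^sub>R ?e) + 0 *\<^sub>R ?d)
      = (h - 0) * partial j (partial i f) ((x + s *\<^sub>R ?e) + t *\<^sub>R ?d)"
    using MVT2[OF assms(2), of "\<lambda>t. partial i f ((x + s *\<^sub>R ?e) + t *\<^sub>R ?d)"
        "\<lambda>t. partial j (partial i f) ((x + s *\<^sub>R ?e) + t *\<^sub>R ?d)"] d2 by blast
  have e: "partial i f (x + h *\<^sub>R ?d + s *\<^sub>R ?e) = partial i f (x + s *\<^sub>R ?e + h *\<^sub>R ?d)"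
    by (simp add: add_ac)
  have "g h - g 0 = h * (h * partial j (partial i f) ((x + s *\<^sub>R ?e) + t *\<^sub>R ?d))"
    using s(3) t(3) unfolding e by simp
  moreover have "g h - g 0 = f (x + h *\<^sub>R ?e + h *\<^sub>R ?d) - f (x + h *\<^sub>R ?e) - f (x + h *\<^sub>R ?d) + f x"
    unfolding g_def by (simp add: add_ac)
  ultimately show ?thesis using s t by (intro exI[of _ s] exI[of _ t]) simp
qed

text \<open>The second difference is symmetric in i and j, so the two mixed partials agree at
  intermediate points that shrink to x; continuity concludes.\<close>

lemma partial_commute:
  assumes "smooth f"
  shows "partial i (partial j f) x = partial j (partial i f) x"
proof -
  define h where "h n = 1 / real (Suc n)" for n
  have h: "h n > 0" for n by (simp add: h_def)
  have h0: "h \<longlonglongrightarrow> 0"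
    unfolding h_def using LIMSEQ_inverse_real_of_nat by (simp add: inverse_eq_divide)
  have "\<exists>s t s' t'. 0 < s \<and> s < h n \<and> 0 < t \<and> t < h n \<and> 0 < s' \<and> s' < h n \<and> 0 < t' \<and> t' < h n \<and>
     partial j (partial i f) (x + s *\<^sub>R axis i 1 + t *\<^sub>R axis j 1)
       = partial i (partial j f) (x + s' *\<^sub>R axis j 1 + t' *\<^sub>R axis i 1)" for n
  proof -
    have sym: "x + h n *\<^sub>R axis i 1 + h n *\<^sub>R axis j 1 = x + h n *\<^sub>R axis j 1 + h n *\<^sub>R axis i 1" by simp
    obtain s t where st: "0 < s" "s < h n" "0 < t" "t < h n"
     "f (x + h n *\<^sub>R axis i 1 + h n *\<^sub>R axis j 1) - f (x + h n *\<^sub>R axis i 1) - f (x + h n *\<^sub>R axis j 1) + f x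
       = h n * h n * partial j (partial i f) (x + s *\<^sub>R axis i 1 + t *\<^sub>R axis j 1)"
      using second_difference[OF assms h[of n], of x i j] by metis
    obtain s' t' where st': "0 < s'" "s' < h n" "0 < t'" "t' < h n"
     "f (x + h n *\<^sub>R axis j 1 + h n *\<^sub>R axis i 1) - f (x + h n *\<^sub>R axis j 1) - f (x + h n *\<^sub>R axis i 1) + f x
       = h n * h n * partial i (partial j f) (x + s' *\<^sub>R axis j 1 + t' *\<^sub>R axis i 1)"
      using second_difference[OF assms h[of n], of x j i] by metis
    have "h n * h n * partial j (partial i f) (x + s *\<^sub>R axis i 1 + t *\<^sub>R axis j 1)
       = h n * h n * partial i (partial j f) (x + s' *\<^sub>R axis j 1 + t' *\<^sub>R axis i 1)"
      using st(5) st'(5) unfolding sym by linarith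
    then show ?thesis using st st' h[of n] by (metis less_irrefl mult_cancel_left mult_pos_pos)
  qed
  then obtain s t s' t' where st: "\<And>n. 0 < s n \<and> s n < h n \<and> 0 < t n \<and> t n < h n \<and> 0 < s' n \<and> s' n < h n \<and> 0 < t' n \<and> t' n < h n \<and>
     partial j (partial i f) (x + s n *\<^sub>R axis i 1 + t n *\<^sub>R axis j 1)
       = partial i (partial j f) (x + s' n *\<^sub>R axis j 1 + t' n *\<^sub>R axis i 1)"
    by metis
  have lim0: "r \<longlonglongrightarrow> 0" if "\<And>n. 0 < r n \<and> r n < h n" for r
    by (rule tendsto_sandwich[OF _ _ tendsto_const h0]) (use that in \<open>auto intro!: always_eventually less_imp_le\<close>)
  have l: "s \<longlonglongrightarrow> 0" "t \<longlonglongrightarrow> 0" "s' \<longlonglongrightarrow> 0" "t' \<longlonglongrightarrow> 0"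
    using st by (auto intro!: lim0)
  have cont: "(\<lambda>n. g (a n)) \<longlonglongrightarrow> g x" if "smooth g" "a \<longlonglongrightarrow> x" for g a
    using smooth_continuous[OF that(1)] that(2)
    by (metis UNIV_I continuous_on_eq_continuous_at isCont_tendsto_compose open_UNIV)
  have "(\<lambda>n. x + s n *\<^sub>R axis i 1 + t n *\<^sub>R axis j 1) \<longlonglongrightarrow> x + 0 *\<^sub>R axis i 1 + 0 *\<^sub>R axis j 1"
    "(\<lambda>n. x + s' n *\<^sub>R axis j 1 + t' n *\<^sub>R axis i 1) \<longlonglongrightarrow> x + 0 *\<^sub>R axis j 1 + 0 *\<^sub>R axis i 1"
    by (intro tendsto_intros l)+
  then have "(\<lambda>n. partial j (partial i f) (x + s n *\<^sub>R axis i 1 + t n *\<^sub>R axis j 1)) \<longlonglongrightarrow> partial j (partial i f) x"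
    "(\<lambda>n. partial i (partial j f) (x + s' n *\<^sub>R axis j 1 + t' n *\<^sub>R axis i 1)) \<longlonglongrightarrow> partial i (partial j f) x"
    by (auto intro!: cont smooth_partial assms)
  moreover have "partial j (partial i f) (x + s n *\<^sub>R axis i 1 + t n *\<^sub>R axis j 1)
       = partial i (partial j f) (x + s' n *\<^sub>R axis j 1 + t' n *\<^sub>R axis i 1)" for n
    using st by blast
  ultimately show ?thesis using LIMSEQ_unique by fastforce
qed

section \<open>Energy identities and a priori bounds up to second order\<close>

abbreviation energy :: "(R3 \<Rightarrow> real) \<Rightarrow> real" where
  "energy f \<equiv> (\<integral>x. f x * f x \<partial>lborel)"

lemma test_product_integrable:
  "test_function f \<Longrightarrow> test_function g \<Longrightarrow> integrable lborel (\<lambda>x. f x * g x)"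
  by (intro test_integrable test_mult_left test_smooth)

lemma ibp_test:
  assumes "test_function f" "test_function g"
  shows "(\<integral>x. f x * partial i g x \<partial>lborel) = - (\<integral>x. partial i f x * g x \<partial>lborel)"
  by (intro integration_by_parts_test test_smooth assms)

lemma gradient_energy:
  assumes "test_function \<psi>"
  shows "(\<Sum>i\<in>UNIV. energy (partial i \<psi>)) = - (\<integral>x. laplace \<psi> x * \<psi> x \<partial>lborel)"
proof -
  have "energy (partial i \<psi>) = - (\<integral>x. partial i (partial i \<psi>) x * \<psi> x \<partial>lborel)" for i
    by (rule ibp_test) (intro test_partial assms)+
  then show ?thesis
    unfolding laplace_alt sum_distrib_right
    by (subst Bochner_Integration.integral_sum) (auto simp: sum_negf intro!: test_product_integrable test_partial assms)
qed

text \<open>Two integrations by parts and the symmetry of mixed partials turn the square of each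
  mixed derivative into a product of two pure second derivatives; these products sum to the squared
  Laplacian.\<close>

lemma hessian_energy:
  assumes "test_function \<psi>"
  shows "(\<Sum>i\<in>UNIV. \<Sum>j\<in>UNIV. energy (partial i (partial j \<psi>))) = energy (laplace \<psi>)"
proof -
  note t = test_partial assms
  have 1: "energy (partial i (partial j \<psi>)) = (\<integral>x. partial j (partial j \<psi>) x * partial i (partial i \<psi>) x \<partial>lborel)" for i j
  proof -
    have c: "partial i (partial i (partial j \<psi>)) = partial j (partial i (partial i \<psi>))"
    proof -
      have "partial i (partial j \<psi>) = partial j (partial i \<psi>)"
        by (rule ext) (rule partial_commute[OF test_smooth[OF assms]])
      then have "partial i (partial i (partial j \<psi>)) = partial i (partial j (partial i \<psi>))" by simp
      also have "\<dots> = partial j (partial i (partial i \<psi>))"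
        by (rule ext) (rule partial_commute[OF test_smooth[OF test_partial[OF assms]]])
      finally show ?thesis .
    qed
    have "energy (partial i (partial j \<psi>)) = - (\<integral>x. partial i (partial i (partial j \<psi>)) x * partial j \<psi> x \<partial>lborel)"
      by (rule ibp_test) (intro t)+
    also have "\<dots> = - (\<integral>x. partial j \<psi> x * partial j (partial i (partial i \<psi>)) x \<partial>lborel)"
      unfolding c by (simp only: mult.commute)
    also have "\<dots> = (\<integral>x. partial j (partial j \<psi>) x * partial i (partial i \<psi>) x \<partial>lborel)"
      by (subst ibp_test) (auto intro!: t)
    finally show ?thesis .
  qed
  have "laplace \<psi> x * laplace \<psi> x = (\<Sum>i\<in>UNIV. \<Sum>j\<in>UNIV. partial j (partial j \<psi>) x * partial i (partial i \<psi>) x)" for x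
    unfolding laplace_alt sum_product by (simp only: mult.commute)
  then have 2: "energy (laplace \<psi>) = (\<Sum>i\<in>UNIV. \<Sum>j\<in>UNIV. \<integral>x. partial j (partial j \<psi>) x * partial i (partial i \<psi>) x \<partial>lborel)"
    by (simp add: Bochner_Integration.integral_sum test_product_integrable t)
  show ?thesis unfolding 2 by (intro sum.cong refl 1)
qed

text \<open>The cross term of the square is the gradient energy after integration by parts. For l >
  0 all summands are nonnegative, so each of them is controlled by the left-hand side.\<close>

lemma helmholtz_energy:
  assumes "test_function \<psi>"
  shows "energy (helmholtz l \<psi>) = l\<^sup>2 * energy \<psi> + 2 * l * (\<Sum>i\<in>UNIV. energy (partial i \<psi>)) + energy (laplace \<psi>)"
proof -
  note t = test_laplace assms
  have int: "integrable lborel (\<lambda>x. \<psi> x * \<psi> x)" "integrable lborel (\<lambda>x. laplace \<psi> x * \<psi> x)"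
    "integrable lborel (\<lambda>x. laplace \<psi> x * laplace \<psi> x)"
    by (intro test_product_integrable t)+
  have "helmholtz l \<psi> x * helmholtz l \<psi> x = l\<^sup>2 * (\<psi> x * \<psi> x) - 2 * l * (laplace \<psi> x * \<psi> x) + laplace \<psi> x * laplace \<psi> x" for x
    by (simp add: helmholtz_def power2_eq_square algebra_simps)
  then show ?thesis using int by (simp add: gradient_energy[OF assms])
qed

lemma energy_nonneg: "0 \<le> energy f"
  by simp

lemma partials_energy_bound:
  assumes "l > 0" "length is \<le> 2"
  obtains C where "C \<ge> 0" "\<And>\<psi>. test_function \<psi> \<Longrightarrow> energy (partials is \<psi>) \<le> C * energy (helmholtz l \<psi>)"
proof -
  have terms: "l\<^sup>2 * energy \<psi> \<le> energy (helmholtz l \<psi>)" "2 * l * energy (partial i \<psi>) \<le> energy (helmholtz l \<psi>)"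
    "energy (partial i (partial j \<psi>)) \<le> energy (helmholtz l \<psi>)" if \<psi>: "test_function \<psi>" for \<psi> i j
  proof -
    have 1: "energy (partial i \<psi>) \<le> (\<Sum>i\<in>UNIV. energy (partial i \<psi>))"
      by (rule member_le_sum) (auto simp: energy_nonneg)
    have "energy (partial i (partial j \<psi>)) \<le> (\<Sum>j\<in>UNIV. energy (partial i (partial j \<psi>)))"
      by (rule member_le_sum[of j UNIV "\<lambda>j. energy (partial i (partial j \<psi>))"]) (auto simp: energy_nonneg)
    also have "\<dots> \<le> (\<Sum>i\<in>UNIV. \<Sum>j\<in>UNIV. energy (partial i (partial j \<psi>)))"
      by (rule member_le_sum[of i UNIV "\<lambda>i. \<Sum>j\<in>UNIV. energy (partial i (partial j \<psi>))"]) (auto intro!: sum_nonneg energy_nonneg)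
    finally have 2: "energy (partial i (partial j \<psi>)) \<le> energy (laplace \<psi>)" by (simp add: hessian_energy[OF \<psi>])
    have 3: "0 \<le> l\<^sup>2 * energy \<psi>" "0 \<le> 2 * l * (\<Sum>i\<in>UNIV. energy (partial i \<psi>))" "0 \<le> energy (laplace \<psi>)"
      using assms(1) by (auto intro!: mult_nonneg_nonneg sum_nonneg energy_nonneg)
    show "l\<^sup>2 * energy \<psi> \<le> energy (helmholtz l \<psi>)" "energy (partial i (partial j \<psi>)) \<le> energy (helmholtz l \<psi>)"
      using 2 3 unfolding helmholtz_energy[OF \<psi>] by linarith+
    have "2 * l * energy (partial i \<psi>) \<le> 2 * l * (\<Sum>i\<in>UNIV. energy (partial i \<psi>))"
      using 1 assms(1) by (intro mult_left_mono) auto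
    then show "2 * l * energy (partial i \<psi>) \<le> energy (helmholtz l \<psi>)"
      using 3 unfolding helmholtz_energy[OF \<psi>] by linarith
  qed
  consider "is = []" | i where "is = [i]" | i j where "is = [i, j]"
    using assms(2) by (cases "is" rule: list.exhaust) (auto simp: length_Suc_conv le_Suc_eq numeral_2_eq_2)
  then show ?thesis
  proof cases
    case 1
    show ?thesis
      using terms(1) assms(1) by (intro that[of "1 / l\<^sup>2"]) (auto simp: 1 field_simps)
  next
    case (2 i)
    show ?thesis
      using terms(2)[of _ i] assms(1) by (intro that[of "1 / (2 * l)"]) (auto simp: 2 partials_Cons field_simps)
  next
    case (3 i j)
    show ?thesis
      using terms(3)[of _ i j] by (intro that[of 1]) (auto simp: 3 partials_Cons)
  qed
qed

text \<open>The outermost derivative is moved over before the others and ends up innermost on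
  \<open>f\<close>, whence the reversed list.\<close>

lemma ibp_partials:
  assumes "test_function f" "test_function g"
  shows "(\<integral>x. f x * partials is g x \<partial>lborel) = (-1) ^ length is * (\<integral>x. partials (rev is) f x * g x \<partial>lborel)"
  using assms
proof (induction "is" arbitrary: f)
  case (Cons i "is")
  have "(\<integral>x. f x * partials (i # is) g x \<partial>lborel) = - (\<integral>x. partial i f x * partials is g x \<partial>lborel)"
    unfolding partials_Cons by (rule ibp_test) (intro test_partials Cons.prems)+
  also have "\<dots> = - ((-1) ^ length is * (\<integral>x. partials (rev is) (partial i f) x * g x \<partial>lborel))"
    using Cons.IH[OF test_partial[OF Cons.prems(1)] Cons.prems(2)] by simp
  finally show ?case by (simp add: partials_snoc)
qed simp

lemma energy_norm: "test_function \<psi> \<Longrightarrow> energy \<psi> = (norm (abs_L2 \<psi>))\<^sup>2"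
  by (simp only: power2_norm_eq_inner inner_abs_L2 test_square_integrable)

text \<open>For F = (l - \<Delta>)\<psi> the resolvent returns \<psi>, the derivatives can be moved
  to \<psi>, and the energy bound applies. For fixed \<phi> the estimate is closed in F, so density
  extends it to all of L2.\<close>

lemma Res_partials_bound:
  assumes "l > 0" "length is \<le> 2"
  obtains C where "\<And>F \<phi>. test_function \<phi> \<Longrightarrow> \<bar>inner (Res l F) (abs_L2 (partials is \<phi>))\<bar> \<le> C * norm F * norm (abs_L2 \<phi>)"
proof -
  have "length (rev is) \<le> 2" using assms(2) by simp
  then obtain C where C: "C \<ge> 0" "\<And>\<psi>. test_function \<psi> \<Longrightarrow> energy (partials (rev is) \<psi>) \<le> C * energy (helmholtz l \<psi>)"
    using partials_energy_bound[OF assms(1), of "rev is"] by blast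
  have "\<bar>inner (Res l F) (abs_L2 (partials is \<phi>))\<bar> \<le> sqrt C * norm F * norm (abs_L2 \<phi>)"
    if \<phi>: "test_function \<phi>" for F \<phi>
  proof -
    let ?P = "{F. \<bar>inner (Res l F) (abs_L2 (partials is \<phi>))\<bar> \<le> sqrt C * norm F * norm (abs_L2 \<phi>)}"
    have "closed ?P"
      by (intro closed_Collect_le continuous_intros bounded_linear.continuous_on[OF Res_bounded_linear[OF assms(1)]])
    moreover have "(\<lambda>\<phi>. abs_L2 (helmholtz l \<phi>)) ` Collect test_function \<subseteq> ?P"
    proof clarify
      fix \<psi> assume \<psi>: "test_function \<psi>"
      note tr = test_partials[OF \<psi>, of "rev is"]
      have "inner (abs_L2 \<psi>) (abs_L2 (partials is \<phi>)) = (-1) ^ length is * inner (abs_L2 (partials (rev is) \<psi>)) (abs_L2 \<phi>)"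
        by (simp add: inner_abs_L2 test_square_integrable test_partials \<phi> \<psi> ibp_partials)
      then have "\<bar>inner (abs_L2 \<psi>) (abs_L2 (partials is \<phi>))\<bar> = \<bar>inner (abs_L2 (partials (rev is) \<psi>)) (abs_L2 \<phi>)\<bar>"
        by (simp add: abs_mult power_abs)
      also have "\<dots> \<le> norm (abs_L2 (partials (rev is) \<psi>)) * norm (abs_L2 \<phi>)"
        by (rule Cauchy_Schwarz_ineq2)
      also have "\<dots> \<le> (sqrt C * norm (abs_L2 (helmholtz l \<psi>))) * norm (abs_L2 \<phi>)"
      proof (rule mult_right_mono)
        have "(norm (abs_L2 (partials (rev is) \<psi>)))\<^sup>2 \<le> (sqrt C * norm (abs_L2 (helmholtz l \<psi>)))\<^sup>2"
          using C(2)[OF \<psi>] C(1) unfolding energy_norm[OF tr] energy_norm[OF test_helmholtz[OF \<psi>]] by (simp add: power_mult_distrib)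
        then show "norm (abs_L2 (partials (rev is) \<psi>)) \<le> sqrt C * norm (abs_L2 (helmholtz l \<psi>))"
          by (rule power2_le_imp_le) (use C(1) in simp)
      qed simp
      finally show "\<bar>inner (Res l (abs_L2 (helmholtz l \<psi>))) (abs_L2 (partials is \<phi>))\<bar> \<le> sqrt C * norm (abs_L2 (helmholtz l \<psi>)) * norm (abs_L2 \<phi>)"
        by (simp add: Res_helmholtz assms(1) \<psi>)
    qed
    ultimately have "UNIV \<subseteq> ?P" unfolding helmholtz_dense[OF assms(1), symmetric] by (rule closure_minimal[rotated])
    then show ?thesis by blast
  qed
  then show ?thesis by (rule that)
qed

lemma partials_lin:
  assumes "smooth f" "smooth g"
  shows "partials is (\<lambda>x. s * f x + t * g x) = (\<lambda>x. s * partials is f x + t * partials is g x)"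
  by (induction "is") (simp_all add: partials_Cons partial_lin smooth_partials assms)

lemma abs_L2_lin:
  assumes "square_integrable f" "square_integrable g"
  shows "abs_L2 (\<lambda>x. s * f x + t * g x) = s *\<^sub>R abs_L2 f + t *\<^sub>R abs_L2 g"
  by (simp add: abs_L2_scale abs_L2_add square_integrable_scale assms)

text \<open>The bound makes pairing with derivatives of \<phi> a functional continuous in the L2
  norm of \<phi>; its Riesz representative is the weak derivative.\<close>

lemma Res_H2:
  assumes "l > 0" shows "Res l F \<in> H2"
  unfolding H2_def
proof (intro CollectI allI impI)
  fix "is" :: "3 list" assume len: "length is \<le> 2"
  obtain C where C: "\<And>F \<phi>. test_function \<phi> \<Longrightarrow> \<bar>inner (Res l F) (abs_L2 (partials is \<phi>))\<bar> \<le> C * norm F * norm (abs_L2 \<phi>)"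
    using Res_partials_bound[OF assms len] by metis
  let ?F = "\<lambda>\<phi>. (-1) ^ length is * inner (Res l F) (abs_L2 (partials is \<phi>))"
  obtain g where g: "\<And>\<phi>. test_function \<phi> \<Longrightarrow> inner g (abs_L2 \<phi>) = ?F \<phi>"
  proof (rule riesz_on_subspace[of "Collect test_function" abs_L2 ?F "C * norm F"])
    show "Collect test_function \<noteq> {}" using test_zero by auto
    show "\<bar>?F \<phi>\<bar> \<le> C * norm F * norm (abs_L2 \<phi>)" if "\<phi> \<in> Collect test_function" for \<phi>
      using C[of \<phi> F] that by (simp add: abs_mult power_abs)
    fix \<phi> \<psi> s t assume "\<phi> \<in> Collect test_function" "\<psi> \<in> Collect test_function"
    then have t: "test_function \<phi>" "test_function \<psi>" by auto
    have tt: "test_function (\<lambda>x. s * \<phi> x + t * \<psi> x)" by (intro test_add test_cmult t)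
    note q = test_square_integrable[OF t(1)] test_square_integrable[OF t(2)]
      test_square_integrable[OF test_partials[OF t(1)]] test_square_integrable[OF test_partials[OF t(2)]]
    have "?F (\<lambda>x. s * \<phi> x + t * \<psi> x) = s * ?F \<phi> + t * ?F \<psi>"
      by (simp add: partials_lin test_smooth t abs_L2_lin q inner_add_right distrib_left mult.left_commute)
    then show "\<exists>c\<in>Collect test_function. abs_L2 c = s *\<^sub>R abs_L2 \<phi> + t *\<^sub>R abs_L2 \<psi> \<and> ?F c = s * ?F \<phi> + t * ?F \<psi>"
      using tt abs_L2_lin[OF q(1,2)] by blast
  qed (use that in auto)
  have "weak_derivative is (rep_L2 (Res l F)) (rep_L2 g)"
    unfolding weak_derivative_def
  proof (intro conjI allI impI square_integrable_locally square_integrable_rep)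
    fix \<phi> assume \<phi>: "test_function \<phi>"
    have "inner (Res l F) (abs_L2 (partials is \<phi>)) = (-1) ^ length is * inner g (abs_L2 \<phi>)"
      by (simp add: g[OF \<phi>] mult.assoc[symmetric] power_mult_distrib[symmetric])
    then show "(\<integral>x. rep_L2 (Res l F) x * partials is \<phi> x \<partial>lborel) = (-1) ^ length is * (\<integral>x. rep_L2 g x * \<phi> x \<partial>lborel)"
      by (simp add: inner_rep_abs test_square_integrable test_partials \<phi>)
  qed
  then show "\<exists>g. weak_derivative is (rep_L2 (Res l F)) (rep_L2 g)" by blast
qed

lemma weak_laplacian_rep_iff:
  "weak_laplacian (rep_L2 u) (rep_L2 h) \<longleftrightarrow>
    (\<forall>\<phi>. test_function \<phi> \<longrightarrow> inner u (abs_L2 (laplace \<phi>)) = inner h (abs_L2 \<phi>))"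
  unfolding weak_laplacian_def
  by (simp add: inner_rep_abs test_square_integrable test_laplace square_integrable_locally square_integrable_rep)

lemma abs_helmholtz:
  assumes "test_function \<phi>"
  shows "abs_L2 (helmholtz l \<phi>) = l *\<^sub>R abs_L2 \<phi> - abs_L2 (laplace \<phi>)"
proof -
  have "helmholtz l \<phi> = (\<lambda>x. l * \<phi> x + (-1) * laplace \<phi> x)" by (simp add: helmholtz_def fun_eq_iff)
  then show ?thesis
    using abs_L2_lin[OF test_square_integrable[OF assms] test_square_integrable[OF test_laplace[OF assms]], of l "-1"] by simp
qed

text \<open>Uniqueness for the weak equation gives one inclusion, the H2 regularity of
  \<open>Res l f\<close> the other.\<close>

lemma resolvent_neg_laplacian:
  assumes "l > 0"
  shows "resolvent neg_laplacian l = graph_of (Res l)"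
proof (intro set_eqI)
  fix p :: "L2 \<times> L2"
  obtain f u where p: "p = (f, u)" by (cases p)
  have "(f, u) \<in> resolvent neg_laplacian l \<longleftrightarrow> u = Res l f"
  proof
    assume "(f, u) \<in> resolvent neg_laplacian l"
    then obtain h where h: "u \<in> H2" "weak_laplacian (rep_L2 u) (rep_L2 h)" "f = - h + l *\<^sub>R u"
      by (auto simp: resolvent_def rel_add_def graph_of_def neg_laplacian_def)
    show "u = Res l f"
    proof (rule Res_unique[OF assms])
      fix \<phi> assume \<phi>: "test_function \<phi>"
      then show "inner u (abs_L2 (helmholtz l \<phi>)) = inner f (abs_L2 \<phi>)"
        using h(2) unfolding weak_laplacian_rep_iff by (simp add: h(3) abs_helmholtz inner_diff_left inner_diff_right)
    qed
  next
    assume u: "u = Res l f"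
    have "weak_laplacian (rep_L2 u) (rep_L2 (l *\<^sub>R u - f))"
      unfolding weak_laplacian_rep_iff
    proof (intro allI impI)
      fix \<phi> assume \<phi>: "test_function \<phi>"
      then show "inner u (abs_L2 (laplace \<phi>)) = inner (l *\<^sub>R u - f) (abs_L2 \<phi>)"
        using Res_weak[OF assms \<phi>, of f] by (simp add: u abs_helmholtz inner_diff_left inner_diff_right)
    qed
    then have "(u, - (l *\<^sub>R u - f)) \<in> neg_laplacian"
      using Res_H2[OF assms] u unfolding neg_laplacian_def by blast
    moreover have "f = - (l *\<^sub>R u - f) + l *\<^sub>R u" by simp
    ultimately show "(f, u) \<in> resolvent neg_laplacian l"
      unfolding resolvent_def rel_add_def graph_of_def by blast
  qed
  then show "p \<in> resolvent neg_laplacian l \<longleftrightarrow> p \<in> graph_of (Res l)"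
    by (auto simp: p graph_of_def)
qed

subsection \<open>Positivity of the resolvent\<close>

lemma Res_identity:
  assumes "l > 0" "\<mu> > 0"
  shows "Res \<mu> F = Res l (F + (l - \<mu>) *\<^sub>R Res \<mu> F)"
proof (rule Res_unique[OF assms(1)])
  fix \<phi> assume \<phi>: "test_function \<phi>"
  show "inner (Res \<mu> F) (abs_L2 (helmholtz l \<phi>)) = inner (F + (l - \<mu>) *\<^sub>R Res \<mu> F) (abs_L2 \<phi>)"
    using Res_weak[OF assms(2) \<phi>, of F]
    unfolding abs_helmholtz[OF \<phi>] inner_add_left inner_diff_right inner_scaleR_left inner_scaleR_right left_diff_distrib
    by linarith
qed

text \<open>By the resolvent identity \<open>\<mu> \<mapsto> Res \<mu> F \<bullet> F\<close> is decreasing, and it tends to \<open>0\<close> at infinity because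
  the norm of \<open>Res \<mu>\<close> is at most \<open>1 / \<mu>\<close>.\<close>

lemma Res_positive:
  assumes "\<mu> > 0"
  shows "0 \<le> inner (Res \<mu> F) F"
proof -
  have dec: "inner (Res l F) F \<le> inner (Res \<mu> F) F" if l: "l \<ge> \<mu>" for l
  proof -
    have l0: "l > 0" using assms l by simp
    let ?u = "Res \<mu> F"
    have id: "Res \<mu> F = Res l F + (l - \<mu>) *\<^sub>R Res l ?u"
      using Res_identity[OF l0 assms, of F] linear_add[OF Res_linear[OF l0]] linear_cmul[OF Res_linear[OF l0]] by simp
    have "inner (Res l ?u) ?u \<le> norm (Res l ?u) * norm ?u" by (rule norm_cauchy_schwarz)
    also have "\<dots> \<le> (norm ?u / l) * norm ?u" by (intro mult_right_mono Res_norm l0) auto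
    also have "\<dots> = inner ?u ?u / l" by (simp add: power2_norm_eq_inner[symmetric] power2_eq_square)
    finally have 1: "inner (Res l ?u) ?u \<le> inner ?u ?u / l" .
    \<comment> \<open>Pairing the resolvent identity with u leaves |u|^2 minus (l - \<mu>) times the
      form of \<open>Res l\<close>, which is at most |u|^2 / l; what remains is at least |u|^2 \<mu>
      / l.\<close>
    have "inner (Res l F) ?u = inner ?u ?u - (l - \<mu>) * inner (Res l ?u) ?u"
      by (subst (2) id) (simp add: inner_add_left)
    also have "\<dots> \<ge> inner ?u ?u - (l - \<mu>) * (inner ?u ?u / l)"
      using l by (intro diff_left_mono mult_left_mono 1) auto
    finally have "inner (Res l F) ?u \<ge> inner ?u ?u * (\<mu> / l)" using l0 by (simp add: field_simps)
    moreover have "0 \<le> inner ?u ?u * (\<mu> / l)" using assms l0 by (intro mult_nonneg_nonneg) auto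
    ultimately have 2: "0 \<le> inner (Res l F) ?u" by linarith
    have "inner (Res \<mu> F) F = inner (Res l F) F + (l - \<mu>) * inner (Res l ?u) F"
      by (subst id) (simp add: inner_add_left)
    also have "inner (Res l ?u) F = inner (Res l F) ?u"
      by (metis Res_symmetric[OF l0] inner_commute)
    finally show ?thesis using 2 l by (simp add: mult_nonneg_nonneg)
  qed
  have low: "- ((norm F)\<^sup>2 / l) \<le> inner (Res \<mu> F) F" if l: "l \<ge> \<mu>" for l
  proof -
    have l0: "l > 0" using assms l by simp
    have "\<bar>inner (Res l F) F\<bar> \<le> norm (Res l F) * norm F" by (rule Cauchy_Schwarz_ineq2)
    also have "\<dots> \<le> (norm F / l) * norm F" by (intro mult_right_mono Res_norm l0) auto
    finally have "\<bar>inner (Res l F) F\<bar> \<le> (norm F)\<^sup>2 / l" by (simp add: power2_eq_square)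
    then show ?thesis using dec[OF l] by linarith
  qed
  have "((\<lambda>l. - ((norm F)\<^sup>2 / l)) \<longlongrightarrow> - 0) at_top"
    by (intro tendsto_minus real_tendsto_divide_at_top[OF tendsto_const filterlim_ident])
  then show ?thesis
    using tendsto_upperbound[of "\<lambda>l. - ((norm F)\<^sup>2 / l)" "- 0" at_top "inner (Res \<mu> F) F"] low
    by (auto simp: eventually_at_top_linorder)
qed

subsection \<open>Continuity of the convolution\<close>

lemma conv_inner:
  assumes "l > 0"
  shows "conv l (rep_L2 F) y = inner (abs_L2 (\<lambda>x. kern l (x - y))) F"
  using inner_rep_abs[OF square_integrable_shift[OF kern_square_integrable[OF assms]], of F y]
  by (simp add: conv_def inner_commute mult.commute)

text \<open>Point evaluation is the inner product with a translated kernel, and translation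
  preserves the L2 norm; hence the bound is uniform in y.\<close>

lemma conv_bound:
  assumes "l > 0"
  shows "\<bar>conv l (rep_L2 F) y\<bar> \<le> norm (abs_L2 (kern l)) * norm F"
proof -
  have "(norm (abs_L2 (\<lambda>x. kern l (x - y))))\<^sup>2 = (\<integral>x. (kern l (- y + x))\<^sup>2 \<partial>lborel)"
    using norm_abs_L2_sq[OF square_integrable_shift[OF kern_square_integrable[OF assms]], of y] by simp
  also have "\<dots> = (norm (abs_L2 (kern l)))\<^sup>2"
    using norm_abs_L2_sq[OF kern_square_integrable[OF assms]] lborel_integral_shift[of "\<lambda>x. (kern l x)\<^sup>2" "- y"] by simp
  finally have "norm (abs_L2 (\<lambda>x. kern l (x - y))) = norm (abs_L2 (kern l))" by simp
  then show ?thesis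
    using Cauchy_Schwarz_ineq2[of "abs_L2 (\<lambda>x. kern l (x - y))" F] by (simp add: conv_inner[OF assms])
qed

text \<open>On the dense set of functions (l - \<Delta>)\<psi> the convolution is the continuous
  \<psi>, and \<open>conv_bound\<close> turns L2 convergence of the data into uniform
  convergence.\<close>

lemma conv_continuous:
  assumes "l > 0"
  shows "continuous_on UNIV (conv l (rep_L2 F))"
proof -
  have "F \<in> closure ((\<lambda>\<phi>. abs_L2 (helmholtz l \<phi>)) ` Collect test_function)"
    using helmholtz_dense[OF assms] by auto
  then obtain \<psi> where \<psi>: "\<And>n. test_function (\<psi> n)" "(\<lambda>n. abs_L2 (helmholtz l (\<psi> n))) \<longlonglongrightarrow> F"
  proof -
    assume *: "\<And>\<psi>. (\<And>n. test_function (\<psi> n)) \<Longrightarrow> (\<lambda>n. abs_L2 (helmholtz l (\<psi> n))) \<longlonglongrightarrow> F \<Longrightarrow> thesis"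
    assume "F \<in> closure ((\<lambda>\<phi>. abs_L2 (helmholtz l \<phi>)) ` Collect test_function)"
    then obtain v where v: "\<And>n. v n \<in> (\<lambda>\<phi>. abs_L2 (helmholtz l \<phi>)) ` Collect test_function" "v \<longlonglongrightarrow> F"
      unfolding closure_sequential by blast
    have "\<exists>\<phi>. test_function \<phi> \<and> v n = abs_L2 (helmholtz l \<phi>)" for n using v(1)[of n] by blast
    then obtain \<psi> where \<psi>: "\<And>n. test_function (\<psi> n)" "\<And>n. v n = abs_L2 (helmholtz l (\<psi> n))" by metis
    from \<psi>(2) have "v = (\<lambda>n. abs_L2 (helmholtz l (\<psi> n)))" by blast
    then show thesis using * \<psi>(1) v(2) by blast
  qed
  let ?K = "norm (abs_L2 (kern l))"
  have eq: "conv l (rep_L2 (abs_L2 (helmholtz l (\<psi> n)))) = \<psi> n" for n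
    using conv_rep_abs[OF test_square_integrable[OF test_helmholtz[OF \<psi>(1)]], of l l n] conv_fundamental[OF assms \<psi>(1), of n]
    by (simp add: helmholtz_def[abs_def])
  have dist: "dist (\<psi> n y) (conv l (rep_L2 F) y) \<le> ?K * norm (abs_L2 (helmholtz l (\<psi> n)) - F)" for n y
  proof -
    have "\<psi> n y - conv l (rep_L2 F) y = conv l (rep_L2 (abs_L2 (helmholtz l (\<psi> n)) - F)) y"
      using conv_inner[OF assms, of "abs_L2 (helmholtz l (\<psi> n))" y] eq[of n]
      by (simp add: conv_inner[OF assms] inner_diff_right)
    then show ?thesis using conv_bound[OF assms] by (simp add: dist_norm)
  qed
  have "uniform_limit UNIV \<psi> (conv l (rep_L2 F)) sequentially"
  proof (rule uniform_limitI)
    fix e :: real assume e: "e > 0"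
    have "(\<lambda>n. ?K * norm (abs_L2 (helmholtz l (\<psi> n)) - F)) \<longlonglongrightarrow> ?K * norm (F - F)"
      by (intro tendsto_intros \<psi>(2))
    then have "\<forall>\<^sub>F n in sequentially. ?K * norm (abs_L2 (helmholtz l (\<psi> n)) - F) < e"
      using e by (intro order_tendstoD(2)) auto
    then show "\<forall>\<^sub>F n in sequentially. \<forall>y\<in>UNIV. dist (\<psi> n y) (conv l (rep_L2 F) y) < e"
      by eventually_elim (use dist in \<open>auto intro: le_less_trans\<close>)
  qed
  then show ?thesis
    by (rule uniform_limit_theorem[rotated]) (use \<psi>(1) in \<open>auto simp: test_continuous\<close>)
qed

section \<open>The regular part of the kernel\<close>

text \<open>The value at the origin is the limit of \<open>kern l - kern 0\<close> there.\<close>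

definition regk :: "real \<Rightarrow> R3 \<Rightarrow> real" where
  "regk l x = (if x = 0 then - sqrt l / (4 * pi) else kern l x - kern 0 x)"

text \<open>The classical gradient of \<open>regk l\<close> away from the origin; at the origin it
  is 0.\<close>

definition regk_grad :: "real \<Rightarrow> R3 \<Rightarrow> R3" where
  "regk_grad l x = ((1 - exp (- sqrt l * norm x) * (1 + sqrt l * norm x)) / (4 * pi * norm x ^ 3)) *\<^sub>R x"

lemma regk_nonzero: "x \<noteq> 0 \<Longrightarrow> regk l x = (exp (- sqrt l * norm x) - 1) / (4 * pi * norm x)"
  by (simp add: regk_def kern_def diff_divide_distrib)

lemma regk_AE: "AE x in lborel. regk l (x - y) = kern l (x - y) - kern 0 (x - y)"
  using AE_lborel_singleton[of y] by eventually_elim (simp add: regk_def)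

lemma one_minus_exp_bounds:
  fixes t :: real
  assumes "t \<ge> 0"
  shows "\<bar>exp (- t) - 1\<bar> \<le> t" "0 \<le> 1 - exp (- t) * (1 + t)" "1 - exp (- t) * (1 + t) \<le> 1"
    "1 - exp (- t) * (1 + t) \<le> t\<^sup>2"
proof -
  have 1: "1 - t \<le> exp (- t)" using exp_ge_add_one_self[of "- t"] by simp
  have 2: "exp (- t) \<le> 1" using assms by simp
  show "\<bar>exp (- t) - 1\<bar> \<le> t" using 1 2 by linarith
  have "exp (- t) * (1 + t) \<le> exp (- t) * exp t"
    using exp_ge_add_one_self[of t] by (intro mult_left_mono) auto
  then show "0 \<le> 1 - exp (- t) * (1 + t)" by (simp add: exp_minus)
  show "1 - exp (- t) * (1 + t) \<le> 1" using assms by simp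
  have "(1 - t) * (1 + t) \<le> exp (- t) * (1 + t)" using 1 assms by (intro mult_right_mono) auto
  then show "1 - exp (- t) * (1 + t) \<le> t\<^sup>2" by (simp add: power2_eq_square algebra_simps)
qed

lemma regk_continuous: "continuous_on UNIV (regk l)"
proof -
  let ?k = "sqrt l"
  have "isCont (regk l) x" for x
  proof (cases "x = 0")
    case False
    have "isCont (\<lambda>x. (exp (- ?k * norm x) - 1) / (4 * pi * norm x)) x"
      using False by (intro continuous_intros) auto
    moreover have "\<forall>\<^sub>F z in nhds x. (exp (- ?k * norm z) - 1) / (4 * pi * norm z) = regk l z"
      unfolding eventually_nhds using False by (intro exI[of _ "- {0}"]) (auto simp: regk_nonzero)
    ultimately show ?thesis by (simp add: isCont_cong)
  next
    case True
    \<comment> \<open>Up to the factor 1/(4 pi), the regular kernel is the difference quotient of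
      this exponential at 0, evaluated at the norm.\<close>
    have "((\<lambda>s. exp (- ?k * s)) has_real_derivative - ?k) (at 0)"
      by (auto intro!: derivative_eq_intros)
    then have 1: "((\<lambda>s. (exp (- ?k * s) - 1) / s) \<longlongrightarrow> - ?k) (at 0)"
      by (simp add: has_field_derivative_iff)
    have "filterlim norm (at 0) (at (0::R3))"
      by (auto simp: filterlim_at eventually_at_filter tendsto_norm_zero_iff)
    from filterlim_compose[OF 1 this]
    have "((\<lambda>x::R3. 1 / (4 * pi) * ((exp (- ?k * norm x) - 1) / norm x)) \<longlongrightarrow> 1 / (4 * pi) * - ?k) (at 0)"
      by (intro tendsto_intros)
    then have "(regk l \<longlongrightarrow> 1 / (4 * pi) * - ?k) (at 0)"
      by (rule Lim_transform_eventually) (auto simp: eventually_at_filter regk_nonzero)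
    then show ?thesis using True by (simp add: isCont_def regk_def)
  qed
  then show ?thesis by (simp add: continuous_at_imp_continuous_on)
qed

lemma regk_measurable [measurable]: "regk l \<in> borel_measurable borel"
  by (rule borel_measurable_continuous_onI[OF regk_continuous])

lemma regk_bound:
  assumes "l \<ge> 0" shows "\<bar>regk l x\<bar> \<le> sqrt l / (4 * pi)"
proof (cases "x = 0")
  case True
  then show ?thesis using assms by (simp add: regk_def)
next
  case False
  have "\<bar>exp (- (sqrt l * norm x)) - 1\<bar> \<le> sqrt l * norm x"
    using assms by (intro one_minus_exp_bounds) auto
  then have "\<bar>exp (- (sqrt l * norm x)) - 1\<bar> / (4 * pi * norm x) \<le> sqrt l * norm x / (4 * pi * norm x)"
    by (intro divide_right_mono) auto
  then show ?thesis using False by (simp add: regk_nonzero abs_mult)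
qed

lemma component_measurable [measurable]: "(\<lambda>x::R3. x $ i) \<in> borel_measurable borel"
  by (intro borel_measurable_continuous_onI continuous_intros)

lemma regk_grad_measurable [measurable]: "(\<lambda>x. regk_grad l x $ i) \<in> borel_measurable borel"
  unfolding regk_grad_def by simp

text \<open>The gradient is at most l, by the quadratic bound on the numerator, and at most 1/r^2.
  The squares of these bounds compare with \<open>dominating\<close> inside and outside the unit
  ball, respectively.\<close>

lemma regk_grad_square_integrable:
  assumes "l \<ge> 0"
  shows "square_integrable (\<lambda>x. regk_grad l x $ i)"
proof -
  let ?k = "sqrt l"
  have "(regk_grad l x $ i)\<^sup>2 \<le> 2 * (l\<^sup>2 + 1) * dominating x" for x
  proof (cases "x = 0")
    case False
    let ?r = "norm x" and ?N = "1 - exp (- (sqrt l * norm x)) * (1 + sqrt l * norm x)"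
    have r: "?r > 0" using False by simp
    have N: "0 \<le> ?N" "?N \<le> 1" "?N \<le> (?k * ?r)\<^sup>2"
      using one_minus_exp_bounds[of "sqrt l * norm x"] assms by simp_all
    have "\<bar>regk_grad l x $ i\<bar> \<le> norm (regk_grad l x)" by (rule component_le_norm_cart)
    also have "norm (regk_grad l x) = \<bar>?N\<bar> / (4 * pi * ?r\<^sup>2)"
      using r by (simp add: regk_grad_def field_simps eval_nat_numeral)
    also have "\<dots> \<le> ?N / ?r\<^sup>2"
      unfolding abs_of_nonneg[OF N(1)]
      using N(1) r pi_gt3 mult_right_mono[of 1 "4 * pi" "?r\<^sup>2"] by (intro divide_left_mono) auto
    finally have 1: "\<bar>regk_grad l x $ i\<bar> \<le> ?N / ?r\<^sup>2" .
    have "?N / ?r\<^sup>2 \<le> l"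
      using N(3) r assms by (simp add: divide_simps power_mult_distrib)
    with 1 have a: "\<bar>regk_grad l x $ i\<bar> \<le> l" by linarith
    have "?N / ?r\<^sup>2 \<le> 1 / ?r\<^sup>2"
      using N(2) by (intro divide_right_mono) auto
    with 1 have b: "\<bar>regk_grad l x $ i\<bar> \<le> 1 / ?r\<^sup>2" by linarith
    have a2: "(regk_grad l x $ i)\<^sup>2 \<le> l\<^sup>2" using a assms by (metis abs_le_square_iff abs_of_nonneg)
    have b2: "(regk_grad l x $ i)\<^sup>2 \<le> (1 / ?r\<^sup>2)\<^sup>2"
      using b by (metis abs_le_square_iff abs_of_nonneg zero_le_divide_1_iff zero_le_power2)
    show ?thesis
    proof (cases "?r \<le> 1")
      case True
      have r2: "?r\<^sup>2 \<le> 1" using True r by (simp add: power_le_one)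
      have "?r\<^sup>2 * (1 + ?r\<^sup>2) \<le> 1 * 2" using r2 by (intro mult_mono) auto
      then have "1 \<le> 2 * dominating x" using r by (simp add: dominating_def divide_simps add_pos_pos)
      then have "l\<^sup>2 * 1 \<le> l\<^sup>2 * (2 * dominating x)" by (intro mult_left_mono) auto
      moreover have "2 * (l\<^sup>2 + 1) * dominating x = l\<^sup>2 * (2 * dominating x) + 2 * dominating x" by (simp add: algebra_simps)
      ultimately show ?thesis using a2 dominating_nonneg[of x] by linarith
    next
      case False
      have r2: "1 \<le> ?r\<^sup>2" using False by (simp add: one_le_power)
      have "?r\<^sup>2 * (1 + ?r\<^sup>2) \<le> ?r\<^sup>2 * (2 * ?r\<^sup>2)" using r2 by (intro mult_left_mono) auto
      then have "(1 / ?r\<^sup>2)\<^sup>2 \<le> 2 * dominating x"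
        using r by (simp add: dominating_def divide_simps add_pos_pos power2_eq_square)
      moreover have "0 \<le> 2 * l\<^sup>2 * dominating x" by simp
      moreover have "2 * (l\<^sup>2 + 1) * dominating x = 2 * l\<^sup>2 * dominating x + 2 * dominating x" by (simp add: algebra_simps)
      ultimately show ?thesis using b2 by linarith
    qed
  qed (simp add: regk_grad_def)
  then have "integrable lborel (\<lambda>x. (regk_grad l x $ i)\<^sup>2)"
    by (intro Bochner_Integration.integrable_bound[OF integrable_mult_right[OF dominating_integrable, of "2 * (l\<^sup>2 + 1)"]])
       (auto intro!: AE_I2 intro: order_trans[OF _ abs_ge_self])
  then show ?thesis by (simp add: square_integrable_def)
qed

text \<open>The regularisation of |x| is used again, now without a point mass in the limit: the
  profile and its gradient stay bounded by k and k^2, so the test function alone provides the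
  majorant.\<close>

lemma regk_weak_gradient_at_0:
  assumes "l \<ge> 0" and \<phi>: "test_function \<phi>"
  shows "(\<integral>x. regk l x * partial i \<phi> x \<partial>lborel) = - (\<integral>x. regk_grad l x $ i * \<phi> x \<partial>lborel)"
proof -
  define k where "k = sqrt l"
  have k: "k \<ge> 0" using assms by (auto simp: k_def)
  define e where "e n = 1 / real (Suc n)" for n
  have e: "e n > 0" for n by (auto simp: e_def)
  have e0: "e \<longlonglongrightarrow> 0"
    unfolding e_def using LIMSEQ_inverse_real_of_nat by (simp add: inverse_eq_divide)
  let ?r = "\<lambda>n. reg_norm (e n)"
  note rb = reg_norm_bounds[OF e]
  define f where "f s = (exp (- (k * s)) - 1) / (4 * pi * s)" for s
  define f1 where "f1 s = (1 - exp (- (k * s)) * (1 + k * s)) / (4 * pi * s ^ 3)" for s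
  have df: "(f has_real_derivative s * f1 s) (at s)" if "s > 0" for s
    unfolding f_def f1_def using that
    by (auto intro!: derivative_eq_intros simp: field_simps eval_nat_numeral)
  have cf1: "continuous_on {0<..} f1"
    unfolding f1_def by (intro continuous_intros) auto
  have cf: "continuous_on {0<..} f"
    unfolding f_def by (intro continuous_intros) auto
  have [measurable]: "\<phi> \<in> borel_measurable borel" "partial i \<phi> \<in> borel_measurable borel"
    using \<phi> test_partial test_measurable by auto
  have [measurable]: "(\<lambda>x. f (?r n x)) \<in> borel_measurable borel" "(\<lambda>x. f1 (?r n x)) \<in> borel_measurable borel" for n
    by (intro borel_measurable_continuous_onI continuous_on_reg_norm e cf cf1)+
  have eq: "(\<integral>x. f (?r n x) * partial i \<phi> x \<partial>lborel) = - (\<integral>x. f1 (?r n x) * x $ i * \<phi> x \<partial>lborel)" for n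
    by (rule reg_radial_gradient(3)[OF e \<phi> df cf1])
  have fb: "\<bar>f s\<bar> \<le> k" "\<bar>f1 s * s\<bar> \<le> k\<^sup>2" if s: "s > 0" for s
  proof -
    have t: "k * s \<ge> 0" using k s by simp
    have "\<bar>f s\<bar> = \<bar>exp (- (k * s)) - 1\<bar> / (4 * pi * s)" using s by (simp add: f_def abs_mult)
    also have "\<dots> \<le> (k * s) / (1 * s)"
      using one_minus_exp_bounds(1)[OF t] s pi_gt3 by (intro frac_le mult_right_mono) auto
    finally show "\<bar>f s\<bar> \<le> k" using s by simp
    have "\<bar>f1 s * s\<bar> = (1 - exp (- (k * s)) * (1 + k * s)) / (4 * pi * s\<^sup>2)"
      using s one_minus_exp_bounds(2)[OF t] by (simp add: f1_def abs_mult power2_eq_square power3_eq_cube)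
    also have "\<dots> \<le> (k * s)\<^sup>2 / (1 * s\<^sup>2)"
      using one_minus_exp_bounds(4)[OF t] s pi_gt3 by (intro frac_le mult_right_mono) auto
    finally show "\<bar>f1 s * s\<bar> \<le> k\<^sup>2" using s by (simp add: power_mult_distrib)
  qed
  have ne: "AE x in lborel. x \<noteq> (0::R3)" by (rule AE_lborel_singleton)
  have rlim: "(\<lambda>n. ?r n x) \<longlonglongrightarrow> norm x" for x by (rule reg_norm_tendsto[OF e0])
  have "(\<lambda>n. \<integral>x. f (?r n x) * partial i \<phi> x \<partial>lborel) \<longlonglongrightarrow> (\<integral>x. regk l x * partial i \<phi> x \<partial>lborel)"
  proof (rule integral_dominated_convergence[where w = "\<lambda>x. k * \<bar>partial i \<phi> x\<bar>"])
    show "AE x in lborel. (\<lambda>n. f (?r n x) * partial i \<phi> x) \<longlonglongrightarrow> regk l x * partial i \<phi> x"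
      using ne
    proof eventually_elim
      case (elim x)
      have r: "regk l x = (exp (- (k * norm x)) - 1) / (4 * pi * norm x)"
        using elim by (simp add: regk_nonzero k_def)
      show ?case unfolding f_def r using elim by (intro tendsto_intros rlim) auto
    qed
    show "AE x in lborel. norm (f (?r n x) * partial i \<phi> x) \<le> k * \<bar>partial i \<phi> x\<bar>" for n
      using fb(1)[OF rb(1)] by (intro AE_I2) (simp add: abs_mult mult_right_mono)
    show "integrable lborel (\<lambda>x. k * \<bar>partial i \<phi> x\<bar>)"
      by (intro integrable_mult_right integrable_abs test_integrable test_partial \<phi>)
  qed measurable
  moreover have "(\<lambda>n. \<integral>x. f1 (?r n x) * x $ i * \<phi> x \<partial>lborel) \<longlonglongrightarrow> (\<integral>x. regk_grad l x $ i * \<phi> x \<partial>lborel)"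
  proof (rule integral_dominated_convergence[where w = "\<lambda>x. k\<^sup>2 * \<bar>\<phi> x\<bar>"])
    show "AE x in lborel. (\<lambda>n. f1 (?r n x) * x $ i * \<phi> x) \<longlonglongrightarrow> regk_grad l x $ i * \<phi> x"
      using ne
    proof eventually_elim
      case (elim x)
      have r: "regk_grad l x $ i = (1 - exp (- (k * norm x)) * (1 + k * norm x)) / (4 * pi * norm x ^ 3) * x $ i"
        by (simp add: regk_grad_def k_def)
      show ?case unfolding f1_def r using elim by (intro tendsto_intros rlim) auto
    qed
    show "AE x in lborel. norm (f1 (?r n x) * x $ i * \<phi> x) \<le> k\<^sup>2 * \<bar>\<phi> x\<bar>" for n
    proof (rule AE_I2)
      fix x
      have "\<bar>f1 (?r n x) * x $ i\<bar> \<le> \<bar>f1 (?r n x)\<bar> * \<bar>?r n x\<bar>"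
        unfolding abs_mult
        by (intro mult_left_mono) (use component_le_norm_cart[of x i] rb(2)[of x n] in auto)
      also have "\<dots> \<le> k\<^sup>2" using fb(2)[OF rb(1), of n x] by (simp add: abs_mult)
      finally show "norm (f1 (?r n x) * x $ i * \<phi> x) \<le> k\<^sup>2 * \<bar>\<phi> x\<bar>"
        unfolding real_norm_def abs_mult[of _ "\<phi> x"] by (rule mult_right_mono) simp
    qed
    show "integrable lborel (\<lambda>x. k\<^sup>2 * \<bar>\<phi> x\<bar>)"
      by (intro integrable_mult_right integrable_abs test_integrable \<phi>)
  qed measurable
  ultimately show ?thesis
    unfolding eq using LIMSEQ_unique tendsto_minus by blast
qed

lemma regk_shift_continuous: "continuous_on UNIV (\<lambda>x. regk l (x - y))"
  by (rule continuous_on_compose2[OF regk_continuous]) (auto intro!: continuous_intros)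

lemma regk_weak_derivative:
  assumes "l \<ge> 0"
  shows "weak_derivative [i] (\<lambda>x. regk l (x - y)) (\<lambda>x. regk_grad l (x - y) $ i)"
  unfolding weak_derivative_def
proof (intro conjI allI impI)
  show "locally_integrable (\<lambda>x. regk l (x - y))"
    by (intro continuous_locally_integrable regk_shift_continuous)
  show "locally_integrable (\<lambda>x. regk_grad l (x - y) $ i)"
    using square_integrable_locally[OF square_integrable_shift[OF regk_grad_square_integrable[OF assms]]] .
  fix \<phi> assume \<phi>: "test_function \<phi>"
  have [measurable]: "\<phi> \<in> borel_measurable borel" "partial i \<phi> \<in> borel_measurable borel"
    using \<phi> test_partial test_measurable by auto
  have "(\<integral>x. regk l (x - y) * partial i \<phi> x \<partial>lborel) = (\<integral>x. regk l (y + x - y) * partial i \<phi> (y + x) \<partial>lborel)"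
    by (rule lborel_integral_shift[symmetric]) measurable
  also have "\<dots> = - (\<integral>x. regk_grad l x $ i * \<phi> (y + x) \<partial>lborel)"
    using regk_weak_gradient_at_0[OF assms test_shift[OF \<phi>, of y], of i] by (simp add: partial_shift[OF \<phi>])
  also have "(\<integral>x. regk_grad l x $ i * \<phi> (y + x) \<partial>lborel) = (\<integral>x. regk_grad l (x - y) $ i * \<phi> x \<partial>lborel)"
    by (subst (2) lborel_integral_shift[of _ y, symmetric]) simp_all
  finally show "(\<integral>x. regk l (x - y) * partials [i] \<phi> x \<partial>lborel)
     = (- 1) ^ length [i] * (\<integral>x. regk_grad l (x - y) $ i * \<phi> x \<partial>lborel)"
    by (simp add: partials_Cons)
qed

lemma kern_shift_locally_integrable: "l \<ge> 0 \<Longrightarrow> locally_integrable (\<lambda>x. kern l (x - y))"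
  by (intro locally_integrable_shift kern_locally_integrable)

text \<open>Subtract the fundamental-solution identities for the parameters l and 0: the point
  masses cancel.\<close>

lemma regk_weak_laplacian:
  assumes "l \<ge> 0"
  shows "weak_laplacian (\<lambda>x. regk l (x - y)) (\<lambda>x. l * kern l (x - y))"
  unfolding weak_laplacian_def
proof (intro conjI allI impI)
  show "locally_integrable (\<lambda>x. regk l (x - y))"
    by (intro continuous_locally_integrable regk_shift_continuous)
  show "locally_integrable (\<lambda>x. l * kern l (x - y))"
    by (intro locally_integrable_cmult kern_shift_locally_integrable assms)
  fix \<phi> assume \<phi>: "test_function \<phi>"
  note lap = test_laplace[OF \<phi>]
  have [measurable]: "\<phi> \<in> borel_measurable borel" "laplace \<phi> \<in> borel_measurable borel"
    using \<phi> lap test_measurable by auto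
  have int: "integrable lborel (\<lambda>x. kern m (x - y) * \<psi> x)" if "m \<ge> 0" "test_function \<psi>" for m \<psi>
    by (intro integrable_locally_mult_test kern_shift_locally_integrable that)
  have a: "\<phi> y = m * (\<integral>x. kern m (x - y) * \<phi> x \<partial>lborel) - (\<integral>x. kern m (x - y) * laplace \<phi> x \<partial>lborel)"
    if "m \<ge> 0" for m
    using fundamental_solution[OF that \<phi>, of y] int[OF that \<phi>] int[OF that lap]
    by (simp add: right_diff_distrib mult.left_commute)
  have "(\<integral>x. regk l (x - y) * laplace \<phi> x \<partial>lborel) = (\<integral>x. kern l (x - y) * laplace \<phi> x - kern 0 (x - y) * laplace \<phi> x \<partial>lborel)"
  proof (rule integral_cong_AE)
    show "AE x in lborel. regk l (x - y) * laplace \<phi> x = kern l (x - y) * laplace \<phi> x - kern 0 (x - y) * laplace \<phi> x"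
      using regk_AE[of l y] by eventually_elim (simp add: left_diff_distrib)
  qed measurable
  also have "\<dots> = (\<integral>x. kern l (x - y) * laplace \<phi> x \<partial>lborel) - (\<integral>x. kern 0 (x - y) * laplace \<phi> x \<partial>lborel)"
    by (intro Bochner_Integration.integral_diff int assms lap) auto
  also have "\<dots> = l * (\<integral>x. kern l (x - y) * \<phi> x \<partial>lborel)"
    using a[OF assms] a[of 0] by simp
  also have "\<dots> = (\<integral>x. l * kern l (x - y) * \<phi> x \<partial>lborel)"
    by (subst integral_mult_right_zero[symmetric]) (simp only: mult.assoc)
  finally show "(\<integral>x. regk l (x - y) * laplace \<phi> x \<partial>lborel) = (\<integral>x. l * kern l (x - y) * \<phi> x \<partial>lborel)" .
qed

subsection \<open>Linearity of weak derivatives\<close>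

lemma weak_derivative_add:
  assumes "weak_derivative is u g" "weak_derivative is v h"
  shows "weak_derivative is (\<lambda>x. u x + v x) (\<lambda>x. g x + h x)"
  using assms unfolding weak_derivative_def
  by (auto simp: distrib_right distrib_left locally_integrable_add integrable_locally_mult_test test_partials)

lemma weak_derivative_cmult:
  assumes "weak_derivative is u g"
  shows "weak_derivative is (\<lambda>x. c * u x) (\<lambda>x. c * g x)"
  using assms unfolding weak_derivative_def
  by (auto simp: locally_integrable_cmult mult.assoc)

lemma weak_derivative_zero: "weak_derivative is (\<lambda>x. 0) (\<lambda>x. 0)"
  unfolding weak_derivative_def by (auto intro: continuous_locally_integrable)

lemma weak_derivative_sum:
  assumes "\<And>j. j \<in> I \<Longrightarrow> weak_derivative is (u j) (g j)"
  shows "weak_derivative is (\<lambda>x. \<Sum>j\<in>I. u j x) (\<lambda>x. \<Sum>j\<in>I. g j x)"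
  using assms by (induction I rule: infinite_finite_induct) (auto simp: weak_derivative_zero weak_derivative_add)

lemma weak_laplacian_add:
  assumes "weak_laplacian u g" "weak_laplacian v h"
  shows "weak_laplacian (\<lambda>x. u x + v x) (\<lambda>x. g x + h x)"
  using assms unfolding weak_laplacian_def
  by (auto simp: distrib_right locally_integrable_add integrable_locally_mult_test test_laplace)

lemma weak_laplacian_cmult:
  assumes "weak_laplacian u g"
  shows "weak_laplacian (\<lambda>x. c * u x) (\<lambda>x. c * g x)"
  using assms unfolding weak_laplacian_def
  by (auto simp: locally_integrable_cmult mult.assoc)

lemma weak_laplacian_zero: "weak_laplacian (\<lambda>x. 0) (\<lambda>x. 0)"
  unfolding weak_laplacian_def by (auto intro: continuous_locally_integrable)

lemma weak_laplacian_sum: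
  assumes "\<And>j. j \<in> I \<Longrightarrow> weak_laplacian (u j) (g j)"
  shows "weak_laplacian (\<lambda>x. \<Sum>j\<in>I. u j x) (\<lambda>x. \<Sum>j\<in>I. g j x)"
  using assms by (induction I rule: infinite_finite_induct) (auto simp: weak_laplacian_zero weak_laplacian_add)

lemma integral_cong_AE_mult:
  fixes u v :: "R3 \<Rightarrow> real"
  assumes "u \<in> borel_measurable borel" "v \<in> borel_measurable borel" "\<phi> \<in> borel_measurable borel"
    and "AE x in lborel. u x = v x"
  shows "(\<integral>x. u x * \<phi> x \<partial>lborel) = (\<integral>x. v x * \<phi> x \<partial>lborel)"
proof (rule integral_cong_AE)
  show "AE x in lborel. u x * \<phi> x = v x * \<phi> x" using assms(4) by eventually_elim simp
qed (use assms in auto)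

lemma weak_derivative_cong_AE:
  assumes "weak_derivative is u g" "locally_integrable v" "AE x in lborel. u x = v x"
  shows "weak_derivative is v g"
  using assms integral_cong_AE_mult[of u v] unfolding weak_derivative_def
  by (auto simp: locally_integrable_def test_measurable test_partials)

lemma weak_laplacian_cong_AE:
  assumes "weak_laplacian u g" "locally_integrable v" "locally_integrable h"
    "AE x in lborel. u x = v x" "AE x in lborel. g x = h x"
  shows "weak_laplacian v h"
  using assms integral_cong_AE_mult[of u v] integral_cong_AE_mult[of g h] unfolding weak_laplacian_def
  by (auto simp: locally_integrable_def test_measurable test_laplace)

text \<open>The set of disagreement is open, and a nonempty open set contains a ball of positive
  volume. It gives access to the values at the points of \<open>Y\<close>, which almost everywhere
  equality does not see.\<close>

lemma continuous_AE_eq: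
  fixes f g :: "R3 \<Rightarrow> real"
  assumes "continuous_on UNIV f" "continuous_on UNIV g" "AE x in lborel. f x = g x"
  shows "f = g"
proof
  fix y
  show "f y = g y"
  proof (rule ccontr)
    assume "f y \<noteq> g y"
    have "open {x. f x \<noteq> g x}"
      using assms(1,2) by (intro open_Collect_neq) auto
    moreover have "y \<in> {x. f x \<noteq> g x}" using \<open>f y \<noteq> g y\<close> by simp
    ultimately obtain e where e: "e > 0" "ball y e \<subseteq> {x. f x \<noteq> g x}"
      by (rule openE)
    obtain N where N0: "\<And>x. x \<in> space lborel - N \<Longrightarrow> f x = g x" and N1: "N \<in> null_sets lborel"
      using AE_E3[OF assms(3)] by metis
    have N: "{x. f x \<noteq> g x} \<subseteq> N" using N0 by auto
    have "emeasure lborel (ball y e) \<le> emeasure lborel N"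
      using order_trans[OF e(2) N] null_setsD2[OF N1] by (rule emeasure_mono)
    also have "\<dots> = 0" using N1 by (rule null_setsD1)
    finally show False using e(1) unit_ball_vol_pos[of 3] by (simp add: emeasure_ball)
  qed
qed

section \<open>Monotone relations in finite dimension\<close>

text \<open>Otherwise the barycentric map with weights \<open>max 0 ((b + N x) \<bullet> (x - a))\<close> has a Brouwer fixed
  point in the convex hull of the first components, and there the weighted mean of the positive
  numbers \<open>(b + N x) \<bullet> (x - a)\<close> is nonpositive by monotonicity.\<close>

lemma monotone_inequality_finite:
  fixes S :: "('a::euclidean_space \<times> 'a) set" and N :: "'a \<Rightarrow> 'a"
  assumes fin: "finite S" and ne: "S \<noteq> {}"
    and mono: "\<And>p q. p \<in> S \<Longrightarrow> q \<in> S \<Longrightarrow> 0 \<le> (snd p - snd q) \<bullet> (fst p - fst q)"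
    and contN: "continuous_on UNIV N"
  shows "\<exists>x. \<forall>p\<in>S. (snd p + N x) \<bullet> (x - fst p) \<le> 0"
proof (rule ccontr)
  assume "\<not> ?thesis"
  then have ex: "\<And>x. \<exists>p\<in>S. (snd p + N x) \<bullet> (x - fst p) > 0" by (meson not_le)
  define g where "g p x = (snd p + N x) \<bullet> (x - fst p)" for p x
  define c where "c p x = max 0 (g p x)" for p x
  define P where "P x = (\<Sum>p\<in>S. c p x)" for x
  have c0: "c p x \<ge> 0" for p x by (simp add: c_def)
  have P0: "P x > 0" for x
  proof -
    obtain p where "p \<in> S" "g p x > 0" using ex unfolding g_def by blast
    then show ?thesis unfolding P_def using fin c0 by (intro sum_pos2[of S p]) (auto simp: c_def)
  qed
  have contc: "continuous_on UNIV (c p)" for p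
    unfolding c_def g_def by (intro continuous_intros contN)
  define F where "F x = (\<Sum>p\<in>S. (c p x / P x) *\<^sub>R fst p)" for x
  let ?K = "convex hull (fst ` S)"
  have "continuous_on ?K F"
    unfolding F_def P_def
    by (intro continuous_intros continuous_on_subset[OF contc]) (use P0 in \<open>auto simp: P_def less_imp_neq[symmetric]\<close>)
  moreover have "F \<in> ?K \<rightarrow> ?K"
    unfolding F_def
  proof (intro Pi_I convex_sum fin convex_convex_hull)
    show "(\<Sum>p\<in>S. c p x / P x) = 1" for x
      using P0[of x] by (simp add: sum_divide_distrib[symmetric] P_def[symmetric])
  qed (auto simp: c0 P0 less_imp_le intro!: hull_inc)
  moreover have "compact ?K" using fin by (simp add: finite_imp_compact_convex_hull)
  ultimately obtain x where x: "F x = x"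
    using brouwer[of ?K F] ne by (auto simp: convex_convex_hull)
  define w where "w p = c p x / P x" for p
  have w0: "w p \<ge> 0" for p using c0 P0[of x] by (simp add: w_def)
  have w1: "(\<Sum>p\<in>S. w p) = 1"
    using P0[of x] by (simp add: w_def sum_divide_distrib[symmetric] P_def[symmetric])
  have xw: "x = (\<Sum>p\<in>S. w p *\<^sub>R fst p)" using x by (simp add: F_def w_def)
  have "0 < (\<Sum>p\<in>S. w p * g p x)"
  proof -
    obtain p where p: "p \<in> S" "g p x > 0" using ex unfolding g_def by blast
    have "0 \<le> w q * g q x" for q
      using P0[of x] by (cases "g q x \<ge> 0") (auto simp: w_def c_def)
    moreover have "0 < w p * g p x" using p P0[of x] by (simp add: w_def c_def)
    ultimately show ?thesis using p fin by (intro sum_pos2[of S p]) auto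
  qed
  also have "(\<Sum>p\<in>S. w p * g p x) = (\<Sum>p\<in>S. w p * (snd p \<bullet> (x - fst p)))"
  proof -
    \<comment> \<open>The common vector \<open>N x\<close> drops out because x is the weighted mean
      of the first components.\<close>
    have "(\<Sum>p\<in>S. w p * (N x \<bullet> (x - fst p))) = N x \<bullet> ((\<Sum>p\<in>S. w p) *\<^sub>R x - (\<Sum>p\<in>S. w p *\<^sub>R fst p))"
      by (simp add: inner_sum_right inner_diff_right sum_subtractf sum_distrib_right scaleR_sum_left right_diff_distrib)
    also have "\<dots> = 0" using w1 xw by simp
    finally show ?thesis by (simp add: g_def inner_add_left distrib_left sum.distrib)
  qed
  also have "\<dots> = (\<Sum>p\<in>S. \<Sum>q\<in>S. w p * w q * (snd p \<bullet> (fst q - fst p)))"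
  proof (rule sum.cong[OF refl])
    fix p :: "'a \<times> 'a"
    have "x - fst p = (\<Sum>q\<in>S. w q *\<^sub>R (fst q - fst p))"
      by (simp add: scaleR_diff_right sum_subtractf scaleR_sum_left[symmetric] w1 flip: xw)
    then show "w p * (snd p \<bullet> (x - fst p)) = (\<Sum>q\<in>S. w p * w q * (snd p \<bullet> (fst q - fst p)))"
      by (simp add: inner_sum_right sum_distrib_left mult.assoc)
  qed
  finally have pos: "0 < (\<Sum>p\<in>S. \<Sum>q\<in>S. w p * w q * (snd p \<bullet> (fst q - fst p)))" (is "0 < ?A") .
  \<comment> \<open>Symmetrisation: adding the sum with p and q exchanged produces the monotonicity
    expression with a negative sign.\<close>
  have "?A = (\<Sum>p\<in>S. \<Sum>q\<in>S. w p * w q * (snd q \<bullet> (fst p - fst q)))"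
    by (subst sum.swap) (simp add: mult.commute)
  then have "2 * ?A = (\<Sum>p\<in>S. \<Sum>q\<in>S. w p * w q * (snd p \<bullet> (fst q - fst p)) + w p * w q * (snd q \<bullet> (fst p - fst q)))"
    by (simp add: sum.distrib)
  also have "\<dots> = (\<Sum>p\<in>S. \<Sum>q\<in>S. - (w p * w q * ((snd p - snd q) \<bullet> (fst p - fst q))))"
    by (intro sum.cong refl) (simp add: inner_diff_left inner_diff_right algebra_simps)
  also have "\<dots> \<le> 0"
    using mono w0 by (intro sum_nonpos) auto
  finally show False using pos by simp
qed

text \<open>Each pair of \<Theta> defines a closed set of admissible x, and finite intersections of
  these sets are nonempty. Strong monotonicity of \<open>N\<close> makes a single such set bounded,
  so compactness reaches all of \<Theta>.\<close>

lemma monotone_inequality: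
  fixes \<Theta> :: "('a::euclidean_space \<times> 'a) set" and N :: "'a \<Rightarrow> 'a"
  assumes ne: "\<Theta> \<noteq> {}"
    and mono: "\<And>p q. p \<in> \<Theta> \<Longrightarrow> q \<in> \<Theta> \<Longrightarrow> 0 \<le> (snd p - snd q) \<bullet> (fst p - fst q)"
    and contN: "continuous_on UNIV N"
    and c: "c > 0" "\<And>x y. c * (norm (x - y))\<^sup>2 \<le> (N x - N y) \<bullet> (x - y)"
  shows "\<exists>x. \<forall>p\<in>\<Theta>. (snd p + N x) \<bullet> (x - fst p) \<le> 0"
proof -
  define C where "C p = {x. (snd p + N x) \<bullet> (x - fst p) \<le> 0}" for p
  have closed: "closed (C p)" for p
    unfolding C_def by (intro closed_Collect_le continuous_intros contN)
  obtain p0 where p0: "p0 \<in> \<Theta>" using ne by auto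
  have "bounded (C p0)"
  proof (rule boundedI)
    fix x assume "x \<in> C p0"
    then have "(snd p0 + N x) \<bullet> (x - fst p0) \<le> 0" by (simp add: C_def)
    let ?b = "snd p0 + N (fst p0)" and ?d = "x - fst p0"
    have "c * (norm ?d)\<^sup>2 \<le> (N x - N (fst p0)) \<bullet> ?d" by (rule c)
    also have "\<dots> \<le> - (?b \<bullet> ?d)"
      using \<open>(snd p0 + N x) \<bullet> (x - fst p0) \<le> 0\<close> by (simp add: inner_add_left inner_diff_left)
    also have "\<dots> \<le> norm ?b * norm ?d" using Cauchy_Schwarz_ineq2[of ?b ?d] by linarith
    finally have 1: "c * (norm ?d)\<^sup>2 \<le> norm ?b * norm ?d" .
    have "norm ?d \<le> norm ?b / c"
    proof (cases "?d = 0")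
      case False
      then have "c * norm ?d \<le> norm ?b" using 1 by (simp add: power2_eq_square)
      then show ?thesis using c(1) by (simp add: pos_le_divide_eq mult.commute)
    qed (use c(1) in simp)
    then show "norm x \<le> norm (fst p0) + norm ?b / c"
      using norm_triangle_ineq[of "fst p0" ?d] by simp
  qed
  then have comp: "compact (C p0)" using closed by (simp add: compact_eq_bounded_closed)
  have "C p0 \<inter> (\<Inter>p\<in>\<Theta>. C p) \<noteq> {}"
  proof (rule compact_imp_fip_image[OF comp closed])
    fix I' assume I': "finite I'" "I' \<subseteq> \<Theta>"
    have "\<exists>x. \<forall>p\<in>insert p0 I'. (snd p + N x) \<bullet> (x - fst p) \<le> 0"
      using I' p0 by (intro monotone_inequality_finite contN mono) auto
    then show "C p0 \<inter> (\<Inter>p\<in>I'. C p) \<noteq> {}" by (auto simp: C_def)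
  qed
  then show ?thesis by (auto simp: C_def)
qed

section \<open>Quadratic forms of symmetric matrices\<close>

lemma symmetric_matrix_inner:
  fixes A :: "real^'n^'n"
  assumes "\<And>i j. A $ i $ j = A $ j $ i"
  shows "x \<bullet> (A *v y) = y \<bullet> (A *v x)"
proof -
  have "x \<bullet> (A *v y) = (\<Sum>i\<in>UNIV. \<Sum>j\<in>UNIV. x $ i * (A $ i $ j * y $ j))"
    by (simp add: inner_vec_def matrix_vector_mult_def sum_distrib_left)
  also have "\<dots> = (\<Sum>j\<in>UNIV. \<Sum>i\<in>UNIV. y $ j * (A $ j $ i * x $ i))"
    by (subst sum.swap) (simp add: assms mult_ac)
  finally show ?thesis by (simp add: inner_vec_def matrix_vector_mult_def sum_distrib_left)
qed

lemma continuous_quadratic_form: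
  fixes A :: "real^'n^'n"
  shows "continuous_on S (\<lambda>x. x \<bullet> (A *v x))"
  by (intro continuous_on_inner continuous_on_id linear_continuous_on linear_linear[THEN iffD2] matrix_vector_mul_linear)

lemma quadratic_form_sphere_min:
  fixes A :: "real^'n^'n"
  obtains v where "norm v = 1" "\<And>x. (v \<bullet> (A *v v)) * (norm x)\<^sup>2 \<le> x \<bullet> (A *v x)"
proof -
  have "sphere 0 1 \<noteq> ({} :: (real^'n) set)"
    by (metis empty_iff mem_sphere_0 norm_axis_1)
  then obtain v :: "real^'n" where v: "norm v = 1" "\<And>y. norm y = 1 \<Longrightarrow> v \<bullet> (A *v v) \<le> y \<bullet> (A *v y)"
    using continuous_attains_inf[OF compact_sphere _ continuous_quadratic_form, of 0 1 A] by auto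
  have "(v \<bullet> (A *v v)) * (norm x)\<^sup>2 \<le> x \<bullet> (A *v x)" for x
  proof (cases "x = 0")
    case False
    let ?y = "(1 / norm x) *\<^sub>R x"
    have x: "x = norm x *\<^sub>R ?y" using False by simp
    have "v \<bullet> (A *v v) \<le> ?y \<bullet> (A *v ?y)" using False by (intro v(2)) simp
    then have "(norm x)\<^sup>2 * (v \<bullet> (A *v v)) \<le> (norm x)\<^sup>2 * (?y \<bullet> (A *v ?y))"
      by (intro mult_left_mono) auto
    also have "\<dots> = x \<bullet> (A *v x)"
      using False by (simp add: matrix_vector_mult_scaleR power2_eq_square)
    finally show ?thesis by (simp add: mult.commute)
  qed simp
  then show ?thesis using v(1) that by blast
qed

text \<open>A minimiser of the quadratic form on the sphere is an eigenvector, so the minimum m is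
  an eigenvalue and hence at least c.\<close>

lemma smallest_eigenvalue_bound:
  fixes A :: "real^'n^'n"
  assumes sym: "\<And>i j. A $ i $ j = A $ j $ i" and "smallest_eigenvalue A c"
  shows "c * (norm x)\<^sup>2 \<le> x \<bullet> (A *v x)"
proof -
  obtain v where v: "norm v = 1" "\<And>x. (v \<bullet> (A *v v)) * (norm x)\<^sup>2 \<le> x \<bullet> (A *v x)"
    using quadratic_form_sphere_min[of A] by blast
  define m where "m = v \<bullet> (A *v v)"
  define q where "q x = x \<bullet> (A *v x) - m * (x \<bullet> x)" for x
  have q0: "0 \<le> q x" for x using v(2)[of x] by (simp add: q_def m_def power2_norm_eq_inner)
  have qv: "q v = 0" using v(1) by (simp add: q_def m_def norm_eq_1)
  \<comment> \<open>The residual of the eigenvalue equation, used as direction of variation: the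
    linear term of \<open>q\<close> along it is the square of its norm.\<close>
  define h where "h = A *v v - m *\<^sub>R v"
  have "h \<bullet> h = 0"
  proof (rule quadratic_nonneg_imp_zero[OF q0[of h]])
    fix t
    have "q (v + t *\<^sub>R h) = q v + 2 * t * (h \<bullet> (A *v v) - m * (h \<bullet> v)) + t\<^sup>2 * q h"
      unfolding q_def matrix_vector_right_distrib matrix_vector_mult_scaleR
      using symmetric_matrix_inner[OF sym, of v h]
      by (simp add: inner_add_left inner_add_right inner_commute algebra_simps power2_eq_square)
    also have "h \<bullet> (A *v v) - m * (h \<bullet> v) = h \<bullet> h"
      by (simp add: h_def inner_diff_right)
    finally show "0 \<le> 2 * t * (h \<bullet> h) + t\<^sup>2 * q h" using q0[of "v + t *\<^sub>R h"] qv by simp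
  qed
  then have "A *v v = m *\<^sub>R v" by (simp add: h_def)
  then have "is_eigenvalue A m" using v(1) unfolding is_eigenvalue_def by (intro exI[of _ v]) auto
  then have "c \<le> m" using assms(2) by (simp add: smallest_eigenvalue_def)
  then have "c * (norm x)\<^sup>2 \<le> m * (norm x)\<^sup>2" by (intro mult_right_mono) auto
  also have "\<dots> \<le> x \<bullet> (A *v x)" using v(2) by (simp add: m_def)
  finally show ?thesis .
qed

section \<open>Maximal monotone relations and Minty's theorem\<close>

lemma maximal_monotone_nonempty:
  assumes "maximal_monotone_of_type \<omega> \<Theta>" shows "\<Theta> \<noteq> {}"
proof
  assume "\<Theta> = {}"
  moreover have "monotone_of_type \<omega> {(0, 0)}" by (simp add: monotone_of_type_def)
  ultimately show False using assms by (auto simp: maximal_monotone_of_type_def)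
qed

text \<open>A pair monotonically related to all of \<Theta> could otherwise be adjoined to it; this
  is the form in which maximality produces elements.\<close>

lemma maximal_monotoneD:
  assumes "maximal_monotone_of_type \<omega> \<Theta>"
    and rel: "\<And>\<zeta> \<zeta>'. (\<zeta>, \<zeta>') \<in> \<Theta> \<Longrightarrow> - \<omega> * (norm (x - \<zeta>))\<^sup>2 \<le> (y - \<zeta>') \<bullet> (x - \<zeta>)"
  shows "(x, y) \<in> \<Theta>"
proof (rule ccontr)
  assume "(x, y) \<notin> \<Theta>"
  then have "\<Theta> \<subset> insert (x, y) \<Theta>" by blast
  moreover have "monotone_of_type \<omega> (insert (x, y) \<Theta>)"
  proof -
    have "- \<omega> * (norm (\<zeta> - x))\<^sup>2 \<le> (\<zeta>' - y) \<bullet> (\<zeta> - x)" if "(\<zeta>, \<zeta>') \<in> \<Theta>" for \<zeta> \<zeta>'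
    proof -
      have "(\<zeta>' - y) \<bullet> (\<zeta> - x) = (y - \<zeta>') \<bullet> (x - \<zeta>)"
        by (simp add: inner_diff_left inner_diff_right)
      then show ?thesis using rel[OF that] by (simp add: norm_minus_commute)
    qed
    note sym = this
    have m: "monotone_of_type \<omega> \<Theta>" using assms(1) by (simp add: maximal_monotone_of_type_def)
    have "- \<omega> * (norm (fst p - fst q))\<^sup>2 \<le> (snd p - snd q) \<bullet> (fst p - fst q)"
      if pq: "p \<in> insert (x, y) \<Theta>" "q \<in> insert (x, y) \<Theta>" for p q
    proof -
      consider "p = (x, y)" "q = (x, y)" | "p = (x, y)" "q \<in> \<Theta>" | "p \<in> \<Theta>" "q = (x, y)" | "p \<in> \<Theta>" "q \<in> \<Theta>"
        using pq by blast
      then show ?thesis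
      proof cases
        case 1
        then show ?thesis by simp
      next
        case 2
        then show ?thesis using rel[of "fst q" "snd q"] by simp
      next
        case 3
        then show ?thesis using sym[of "fst p" "snd p"] by simp
      next
        case 4
        then show ?thesis using m unfolding monotone_of_type_def case_prod_beta by blast
      qed
    qed
    then show ?thesis unfolding monotone_of_type_def case_prod_beta by blast
  qed
  ultimately show False using assms(1) unfolding maximal_monotone_of_type_def by blast
qed

text \<open>The shift by \<omega> makes \<Theta> monotone and leaves \<open>A\<close> minus \<omega>
  strongly monotone, with the minimum of the form on the sphere as margin. A solution of the
  variational inequality for \<open>N\<close> is monotonically related to \<Theta>, hence belongs to
  it.\<close>

lemma minty:
  fixes A :: "real^'n^'n"
  assumes max: "maximal_monotone_of_type \<omega> \<Theta>"
    and pos: "\<And>x. x \<noteq> 0 \<Longrightarrow> \<omega> * (norm x)\<^sup>2 < x \<bullet> (A *v x)"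
  shows "\<exists>\<xi>. (\<xi>, w - A *v \<xi>) \<in> \<Theta>"
proof -
  obtain v where v: "norm v = 1" "\<And>x. (v \<bullet> (A *v v)) * (norm x)\<^sup>2 \<le> x \<bullet> (A *v x)"
    using quadratic_form_sphere_min[of A] by blast
  define c where "c = v \<bullet> (A *v v) - \<omega>"
  have "v \<noteq> 0" using v(1) by auto
  then have c: "c > 0" using pos[of v] v(1) by (simp add: c_def)
  define N where "N x = A *v x - \<omega> *\<^sub>R x - w" for x
  let ?T = "(\<lambda>p. (fst p, snd p + \<omega> *\<^sub>R fst p)) ` \<Theta>"
  have "\<exists>x. \<forall>p\<in>?T. (snd p + N x) \<bullet> (x - fst p) \<le> 0"
  proof (rule monotone_inequality[OF _ _ _ c])
    show "?T \<noteq> {}" using maximal_monotone_nonempty[OF max] by simp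
    show "continuous_on UNIV N"
      unfolding N_def by (intro continuous_intros linear_continuous_on linear_linear[THEN iffD2] matrix_vector_mul_linear)
    show "c * (norm (x - y))\<^sup>2 \<le> (N x - N y) \<bullet> (x - y)" for x y
    proof -
      define d where "d = x - y"
      have "N x - N y = A *v d - \<omega> *\<^sub>R d"
        by (simp add: d_def N_def matrix_vector_mult_diff_distrib scaleR_diff_right)
      then have "(N x - N y) \<bullet> d = d \<bullet> (A *v d) - \<omega> * (norm d)\<^sup>2"
        by (simp add: inner_diff_left inner_diff_right inner_commute power2_norm_eq_inner)
      then show ?thesis using v(2)[of d]
        unfolding d_def[symmetric] c_def left_diff_distrib by linarith
    qed
    fix p q assume "p \<in> ?T" "q \<in> ?T"
    then obtain a b a' b' where pq: "(a, b) \<in> \<Theta>" "p = (a, b + \<omega> *\<^sub>R a)" "(a', b') \<in> \<Theta>" "q = (a', b' + \<omega> *\<^sub>R a')"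
      by auto
    have "- \<omega> * (norm (a - a'))\<^sup>2 \<le> (b - b') \<bullet> (a - a')"
      using max pq(1,3) by (auto simp: maximal_monotone_of_type_def monotone_of_type_def)
    moreover have "(snd p - snd q) \<bullet> (fst p - fst q) = (b - b') \<bullet> (a - a') + \<omega> * ((a - a') \<bullet> (a - a'))"
      by (simp add: pq(2,4) inner_add_left inner_diff_left algebra_simps)
    ultimately show "0 \<le> (snd p - snd q) \<bullet> (fst p - fst q)" by (simp add: power2_norm_eq_inner)
  qed
  then obtain x where x: "\<And>p. p \<in> \<Theta> \<Longrightarrow> (snd p + \<omega> *\<^sub>R fst p + N x) \<bullet> (x - fst p) \<le> 0" by auto
  have "(x, w - A *v x) \<in> \<Theta>"
  proof (rule maximal_monotoneD[OF max])
    fix \<zeta> \<zeta>' assume "(\<zeta>, \<zeta>') \<in> \<Theta>"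
    from x[OF this] have "(\<zeta>' + \<omega> *\<^sub>R \<zeta> + N x) \<bullet> (x - \<zeta>) \<le> 0" by simp
    moreover have "\<zeta>' + \<omega> *\<^sub>R \<zeta> + N x = - (w - A *v x - \<zeta>') - \<omega> *\<^sub>R (x - \<zeta>)"
      by (simp add: N_def scaleR_diff_right)
    ultimately show "- \<omega> * (norm (x - \<zeta>))\<^sup>2 \<le> (w - A *v x - \<zeta>') \<bullet> (x - \<zeta>)"
      by (simp only: inner_diff_left[of "- (w - A *v x - \<zeta>')"] inner_minus_left inner_scaleR_left power2_norm_eq_inner)
  qed
  then show ?thesis by blast
qed

section \<open>Point interactions\<close>

text \<open>A pointwise representative of \<open>G Y l \<xi>\<close> that also makes sense at l = 0,
  where it is \<open>G0 Y \<xi>\<close>.\<close>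

definition point_potential :: "('n::finite \<Rightarrow> R3) \<Rightarrow> real \<Rightarrow> real^'n \<Rightarrow> R3 \<Rightarrow> real" where
  "point_potential Y l \<xi> x = (\<Sum>j\<in>UNIV. kern l (x - Y j) * \<xi> $ j)"

text \<open>The difference of the potentials for l and 0, extended continuously to the points of
  \<open>Y\<close>.\<close>

definition regular_potential :: "('n::finite \<Rightarrow> R3) \<Rightarrow> real \<Rightarrow> real^'n \<Rightarrow> R3 \<Rightarrow> real" where
  "regular_potential Y l \<xi> x = (\<Sum>j\<in>UNIV. \<xi> $ j * regk l (x - Y j))"

lemma G_eq: "G Y l \<xi> = abs_L2 (point_potential Y l \<xi>)"
  by (simp add: G_def point_potential_def[abs_def] kern_def)

lemma G0_eq: "G0 Y \<xi> = point_potential Y 0 \<xi>"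
  by (simp add: G0_def point_potential_def[abs_def] kern_0 sum_distrib_left)

lemma G_adjoint_eq: "G_adjoint Y l u = (\<chi> i. conv l (rep_L2 u) (Y i))"
  by (simp add: G_adjoint_def conv_def kern_def)

lemma point_potential_square_integrable:
  assumes "l > 0" shows "square_integrable (point_potential Y l \<xi>)"
proof -
  have "square_integrable (\<lambda>x. \<Sum>j\<in>I. kern l (x - Y j) * \<xi> $ j)" if "finite I" for I
    using that
    by (induction I)
       (auto simp: square_integrable_zero mult.commute[of _ "\<xi> $ _"] intro!: square_integrable_add
          square_integrable_scale square_integrable_shift kern_square_integrable assms)
  then show ?thesis unfolding point_potential_def[abs_def] by simp
qed

lemma point_potential_locally_integrable: "l \<ge> 0 \<Longrightarrow> locally_integrable (point_potential Y l \<xi>)"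
  unfolding point_potential_def[abs_def] mult.commute[of _ "\<xi> $ _"]
  by (intro locally_integrable_sum locally_integrable_cmult kern_shift_locally_integrable)

lemma regular_potential_continuous: "continuous_on UNIV (regular_potential Y l \<xi>)"
  unfolding regular_potential_def[abs_def] by (intro continuous_intros regk_shift_continuous)

lemma regular_potential_AE: "AE x in lborel. regular_potential Y l \<xi> x = point_potential Y l \<xi> x - point_potential Y 0 \<xi> x"
proof -
  have "AE x in lborel. \<forall>j. regk l (x - Y j) = kern l (x - Y j) - kern 0 (x - Y j)"
    using regk_AE[of l] by (simp add: AE_finite_all[of UNIV, simplified])
  then show ?thesis
  proof eventually_elim
    case (elim x)
    show ?case
      by (simp only: regular_potential_def point_potential_def elim[rule_format] right_diff_distrib sum_subtractf mult.commute)
  qed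
qed

lemma regular_potential_weak_laplacian:
  assumes "l \<ge> 0" shows "weak_laplacian (regular_potential Y l \<xi>) (\<lambda>x. l * point_potential Y l \<xi> x)"
proof -
  have "weak_laplacian (\<lambda>x. \<Sum>j\<in>UNIV. \<xi> $ j * regk l (x - Y j)) (\<lambda>x. \<Sum>j\<in>UNIV. \<xi> $ j * (l * kern l (x - Y j)))"
    by (intro weak_laplacian_sum weak_laplacian_cmult regk_weak_laplacian assms)
  then show ?thesis
    by (simp add: regular_potential_def[abs_def] point_potential_def[abs_def] sum_distrib_left mult_ac)
qed

section \<open>The interaction matrix as point values of potentials\<close>

lemma M_matrix_entry:
  "M_matrix Y l $ i $ j = (if i = j then sqrt l / (4 * pi) else - kern l (Y i - Y j))"
  by (simp add: M_matrix_def kern_def)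

lemma M_matrix_symmetric: "M_matrix Y l $ i $ j = M_matrix Y l $ j $ i"
  by (simp add: M_matrix_def norm_minus_commute)

text \<open>The value \<open>- sqrt l / (4 * pi)\<close> of the regular kernel at the origin
  supplies the diagonal, and kernel differences between distinct points the rest. Injectivity of
  \<open>Y\<close> separates the two cases.\<close>

lemma regular_potential_at:
  assumes "inj Y"
  shows "regular_potential Y l \<xi> (Y i) = (M_matrix Y 0 *v \<xi> - M_matrix Y l *v \<xi>) $ i"
proof -
  have "\<xi> $ j * regk l (Y i - Y j) = M_matrix Y 0 $ i $ j * \<xi> $ j - M_matrix Y l $ i $ j * \<xi> $ j" for j
  proof (cases "i = j")
    case True
    then show ?thesis by (simp add: M_matrix_entry regk_def)
  next
    case False
    then have "Y i - Y j \<noteq> 0" using assms by (auto dest: injD)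
    then show ?thesis using False by (simp add: M_matrix_entry regk_def algebra_simps)
  qed
  then show ?thesis
    by (simp add: regular_potential_def matrix_vector_mult_def sum_subtractf[symmetric])
qed

text \<open>Removing the singularity at \<open>Y i\<close> leaves kernels centred at the other
  points, continuous there. Their sum is minus the i-th entry of
  \<open>M_matrix Y 0 *v \<xi>\<close>, since that matrix has zero diagonal.\<close>

lemma tau_tilde_eq:
  assumes "inj Y" "continuous_on UNIV u"
  shows "tau_tilde Y \<xi> (\<lambda>x. u x + G0 Y \<xi> x) = (\<chi> i. u (Y i)) - M_matrix Y 0 *v \<xi>"
proof -
  have "Lim (at (Y i)) (\<lambda>x. u x + G0 Y \<xi> x - 1 / (4 * pi) * (\<xi> $ i / norm (x - Y i)))
     = u (Y i) - (M_matrix Y 0 *v \<xi>) $ i" for i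
  proof (rule tendsto_Lim)
    have eq: "u x + G0 Y \<xi> x - 1 / (4 * pi) * (\<xi> $ i / norm (x - Y i))
        = u x + (\<Sum>j\<in>UNIV - {i}. kern 0 (x - Y j) * \<xi> $ j)" for x
    proof -
      have "G0 Y \<xi> x = kern 0 (x - Y i) * \<xi> $ i + (\<Sum>j\<in>UNIV - {i}. kern 0 (x - Y j) * \<xi> $ j)"
        unfolding G0_eq point_potential_def by (rule sum.remove) auto
      then show ?thesis by (simp add: kern_0)
    qed
    have "isCont (\<lambda>x. u x + (\<Sum>j\<in>UNIV - {i}. kern 0 (x - Y j) * \<xi> $ j)) (Y i)"
    proof (intro continuous_intros)
      show "isCont u (Y i)" using assms(2) by (simp add: continuous_on_eq_continuous_at)
      fix j assume "j \<in> UNIV - {i}"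
      then have "Y i \<noteq> Y j" using assms(1) by (auto dest: injD)
      then show "isCont (\<lambda>x. kern 0 (x - Y j)) (Y i)"
        unfolding kern_0 by (intro continuous_intros) auto
    qed
    then have "((\<lambda>x. u x + (\<Sum>j\<in>UNIV - {i}. kern 0 (x - Y j) * \<xi> $ j)) \<longlongrightarrow>
        u (Y i) + (\<Sum>j\<in>UNIV - {i}. kern 0 (Y i - Y j) * \<xi> $ j)) (at (Y i))"
      by (simp add: isCont_def)
    moreover have "(M_matrix Y 0 *v \<xi>) $ i = - (\<Sum>j\<in>UNIV - {i}. kern 0 (Y i - Y j) * \<xi> $ j)"
    proof -
      have "(M_matrix Y 0 *v \<xi>) $ i = M_matrix Y 0 $ i $ i * \<xi> $ i + (\<Sum>j\<in>UNIV - {i}. M_matrix Y 0 $ i $ j * \<xi> $ j)"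
        unfolding matrix_vector_mult_def by (simp add: sum.remove[of UNIV i])
      also have "\<dots> = (\<Sum>j\<in>UNIV - {i}. - (kern 0 (Y i - Y j) * \<xi> $ j))"
        by (simp add: M_matrix_entry)
      finally show ?thesis by (simp add: sum_negf)
    qed
    ultimately show "((\<lambda>x. u x + G0 Y \<xi> x - 1 / (4 * pi) * (\<xi> $ i / norm (x - Y i))) \<longlongrightarrow>
        u (Y i) - (M_matrix Y 0 *v \<xi>) $ i) (at (Y i))"
      unfolding eq by simp
  qed simp
  then show ?thesis by (simp add: tau_tilde_def vec_eq_iff)
qed

subsection \<open>The defect vectors\<close>

text \<open>The equation (l - \<Delta>) G \<xi> = sum of \<xi>_j times the point mass at
  \<open>Y j\<close>, in tested form.\<close>

lemma G_helmholtz: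
  assumes "l > 0" and \<phi>: "test_function \<phi>"
  shows "inner (G Y l \<xi>) (abs_L2 (helmholtz l \<phi>)) = (\<Sum>j\<in>UNIV. \<xi> $ j * \<phi> (Y j))"
proof -
  have int: "integrable lborel (\<lambda>x. kern l (x - y) * helmholtz l \<phi> x)" for y
    by (intro conv_integrable assms test_square_integrable test_helmholtz)
  have "inner (G Y l \<xi>) (abs_L2 (helmholtz l \<phi>)) = (\<integral>x. point_potential Y l \<xi> x * helmholtz l \<phi> x \<partial>lborel)"
    unfolding G_eq by (intro inner_abs_L2 point_potential_square_integrable assms test_square_integrable test_helmholtz)
  also have "\<dots> = (\<integral>x. (\<Sum>j\<in>UNIV. \<xi> $ j * (kern l (x - Y j) * helmholtz l \<phi> x)) \<partial>lborel)"
    by (simp add: point_potential_def sum_distrib_left sum_distrib_right mult_ac)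
  also have "\<dots> = (\<Sum>j\<in>UNIV. \<xi> $ j * (\<integral>x. kern l (x - Y j) * helmholtz l \<phi> x \<partial>lborel))"
    using int by (simp add: Bochner_Integration.integral_sum)
  also have "\<dots> = (\<Sum>j\<in>UNIV. \<xi> $ j * \<phi> (Y j))"
    using fundamental_solution[of l \<phi>] assms by (simp add: helmholtz_def)
  finally show ?thesis .
qed

lemma inner_G:
  assumes "l > 0"
  shows "inner F (G Y l \<xi>) = \<xi> \<bullet> G_adjoint Y l F"
proof -
  have int: "integrable lborel (\<lambda>x. kern l (x - y) * rep_L2 F x)" for y
    by (intro conv_integrable assms square_integrable_rep)
  have "inner F (G Y l \<xi>) = (\<integral>x. rep_L2 F x * point_potential Y l \<xi> x \<partial>lborel)"
    unfolding G_eq by (intro inner_rep_abs point_potential_square_integrable assms)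
  also have "\<dots> = (\<integral>x. (\<Sum>j\<in>UNIV. \<xi> $ j * (kern l (x - Y j) * rep_L2 F x)) \<partial>lborel)"
    by (simp add: point_potential_def sum_distrib_left mult_ac)
  also have "\<dots> = (\<Sum>j\<in>UNIV. \<xi> $ j * (\<integral>x. kern l (x - Y j) * rep_L2 F x \<partial>lborel))"
    using int by (simp add: Bochner_Integration.integral_sum)
  finally show ?thesis by (simp add: G_adjoint_eq inner_vec_def conv_def)
qed

lemma G_diff:
  assumes "l > 0"
  shows "G Y l (\<xi> - \<zeta>) = G Y l \<xi> - G Y l \<zeta>"
proof -
  have "point_potential Y l (\<xi> - \<zeta>) = (\<lambda>x. 1 * point_potential Y l \<xi> x + (- 1) * point_potential Y l \<zeta> x)"
    by (simp add: point_potential_def fun_eq_iff sum_subtractf[symmetric] right_diff_distrib)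
  then show ?thesis
    unfolding G_eq
    using abs_L2_lin[OF point_potential_square_integrable[OF assms, of Y \<xi>] point_potential_square_integrable[OF assms, of Y \<zeta>], of 1 "-1"]
    by simp
qed

lemma G_adjoint_diff:
  assumes "l > 0"
  shows "G_adjoint Y l (F - H) = G_adjoint Y l F - G_adjoint Y l H"
  using conv_inner[OF assms] by (simp add: G_adjoint_eq vec_eq_iff inner_diff_right)

text \<open>Test functions concentrating at \<open>Y i\<close> tend to \<open>0\<close> in the mean square sense but keep the value \<open>1\<close>
  at \<open>Y i\<close>.\<close>

lemma delta_combination_not_L2:
  assumes "inj Y" and e: "\<And>\<phi>. test_function \<phi> \<Longrightarrow> inner e (abs_L2 \<phi>) = (\<Sum>j\<in>UNIV. \<eta> $ j * \<phi> (Y j))"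
  shows "\<eta> = 0" "e = 0"
proof -
  have "\<eta> $ i = 0" for i
  proof -
    define \<phi> where "\<phi> n x = cutoff (- (real (Suc n) *\<^sub>R Y i) + real (Suc n) *\<^sub>R x)" for n x
    have \<phi>: "test_function (\<phi> n)" for n
      unfolding \<phi>_def by (intro test_affine test_cutoff) simp
    have \<phi>_alt: "\<phi> n x = cutoff (real (Suc n) *\<^sub>R (x - Y i))" for n x
      unfolding \<phi>_def by (simp only: scaleR_diff_right) simp
    have zero: "\<phi> n x = 0" if "1 < real (Suc n) * norm (x - Y i)" for n x
      using that by (simp add: \<phi>_alt cutoff_def bump_0_eq_0_iff one_le_power)
    obtain B R where B: "B \<ge> 0" "\<And>x. \<bar>cutoff x\<bar> \<le> B * indicator (cball 0 R) x"
      using test_bound[OF test_cutoff] by metis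
    have B': "\<bar>cutoff x\<bar> \<le> B" for x using B(2)[of x] B(1) by (cases "x \<in> cball 0 R") auto
    have ev0: "\<forall>\<^sub>F n in sequentially. \<phi> n x = 0" if "x \<noteq> Y i" for x
    proof -
      have "norm (x - Y i) > 0" using that by simp
      then obtain n0 where n0: "1 / norm (x - Y i) < real n0" using reals_Archimedean2 by blast
      have "\<phi> n x = 0" if "n \<ge> n0" for n
      proof (rule zero)
        have "1 / norm (x - Y i) < real (Suc n)" using n0 that by linarith
        then show "1 < real (Suc n) * norm (x - Y i)" using \<open>norm (x - Y i) > 0\<close> by (simp add: divide_less_eq)
      qed
      then show ?thesis by (auto simp: eventually_sequentially)
    qed
    let ?R = "norm (Y i) + 1"
    have "(\<lambda>n. \<integral>x. rep_L2 e x * \<phi> n x \<partial>lborel) \<longlonglongrightarrow> (\<integral>x. 0 \<partial>(lborel :: R3 measure))"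
    proof (rule integral_dominated_convergence[where w = "\<lambda>x. B * \<bar>rep_L2 e x * indicator (cball 0 ?R) x\<bar>"])
      show "integrable lborel (\<lambda>x. B * \<bar>rep_L2 e x * indicator (cball 0 ?R) x\<bar>)"
        by (intro integrable_mult_right integrable_abs locally_integrable_ball square_integrable_locally square_integrable_rep)
      show "(\<lambda>x. rep_L2 e x * \<phi> n x) \<in> borel_measurable lborel" for n
        using test_measurable[OF \<phi>] by simp
      show "AE x in lborel. (\<lambda>n. rep_L2 e x * \<phi> n x) \<longlonglongrightarrow> 0"
        using AE_lborel_singleton[of "Y i"]
      proof eventually_elim
        case (elim x)
        from ev0[OF elim] show ?case by (intro tendsto_eventually) (auto elim: eventually_mono)
      qed
      show "AE x in lborel. norm (rep_L2 e x * \<phi> n x) \<le> B * \<bar>rep_L2 e x * indicator (cball 0 ?R) x\<bar>" for n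
      proof (rule AE_I2)
        fix x
        show "norm (rep_L2 e x * \<phi> n x) \<le> B * \<bar>rep_L2 e x * indicator (cball 0 ?R) x\<bar>"
        proof (cases "norm x \<le> ?R")
          case True
          have "\<bar>rep_L2 e x\<bar> * \<bar>\<phi> n x\<bar> \<le> \<bar>rep_L2 e x\<bar> * B"
            unfolding \<phi>_alt by (intro mult_left_mono B') auto
          then show ?thesis using True by (simp add: abs_mult mult.commute)
        next
          case False
          then have "1 < norm (x - Y i)" using norm_triangle_sub[of x "Y i"] by simp
          also have "\<dots> \<le> real (Suc n) * norm (x - Y i)" using mult_right_mono[of 1 "real (Suc n)" "norm (x - Y i)"] by simp
          finally show ?thesis using zero B(1) by simp
        qed
      qed
    qed simp
    moreover have "\<forall>\<^sub>F n in sequentially. (\<integral>x. rep_L2 e x * \<phi> n x \<partial>lborel) = \<eta> $ i"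
    proof -
      have "\<forall>\<^sub>F n in sequentially. \<forall>j\<in>UNIV - {i}. \<phi> n (Y j) = 0"
      proof (intro eventually_ball_finite ballI ev0)
        fix j assume "j \<in> UNIV - {i}"
        then show "Y j \<noteq> Y i" using assms(1) by (auto dest: injD)
      qed simp
      then show ?thesis
      proof eventually_elim
        case (elim n)
        have "(\<integral>x. rep_L2 e x * \<phi> n x \<partial>lborel) = (\<Sum>j\<in>UNIV. \<eta> $ j * \<phi> n (Y j))"
          using e[OF \<phi>] inner_rep_abs[OF test_square_integrable[OF \<phi>], of e n] by simp
        also have "\<dots> = \<eta> $ i * \<phi> n (Y i) + (\<Sum>j\<in>UNIV - {i}. \<eta> $ j * \<phi> n (Y j))"
          by (rule sum.remove) auto
        also have "\<dots> = \<eta> $ i" using elim by (simp add: \<phi>_alt cutoff_0)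
        finally show ?case .
      qed
    qed
    then have "(\<lambda>n. \<integral>x. rep_L2 e x * \<phi> n x \<partial>lborel) \<longlonglongrightarrow> \<eta> $ i"
      by (rule tendsto_eventually)
    ultimately have "\<eta> $ i = (\<integral>x. 0 \<partial>(lborel :: R3 measure))" using LIMSEQ_unique by blast
    then show ?thesis by simp
  qed
  then show \<eta>: "\<eta> = 0" by (simp add: vec_eq_iff)
  show "e = 0" by (rule L2_zero_if_orthogonal_test) (simp add: e \<eta>)
qed

text \<open>Applying l - \<Delta> would make the combination of point masses with weights \<eta>
  equal to the L2 function e. Consequences are that \<open>G\<close> has trivial kernel and that its
  range meets that of \<open>Res\<close> only in 0.\<close>

lemma Res_eq_G:
  assumes "inj Y" "l > 0" "Res l e = G Y l \<eta>"
  shows "\<eta> = 0" "e = 0"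
  using delta_combination_not_L2[OF assms(1), of e \<eta>] G_helmholtz[OF assms(2), of _ Y \<eta>]
    Res_weak[OF assms(2), of _ e] assms(3) by auto

text \<open>Both potentials have the same point masses, independent of the spectral parameter; they
  cancel when tested, leaving an L2 right-hand side.\<close>

lemma G_resolvent_identity:
  assumes "l > 0" "\<mu> > 0"
  shows "G Y l \<xi> - G Y \<mu> \<xi> = Res l (- (l - \<mu>) *\<^sub>R G Y \<mu> \<xi>)"
proof (rule Res_unique[OF assms(1)])
  fix \<phi> assume \<phi>: "test_function \<phi>"
  show "inner (G Y l \<xi> - G Y \<mu> \<xi>) (abs_L2 (helmholtz l \<phi>)) = inner (- (l - \<mu>) *\<^sub>R G Y \<mu> \<xi>) (abs_L2 \<phi>)"
    using G_helmholtz[OF assms(1) \<phi>, of Y \<xi>] G_helmholtz[OF assms(2) \<phi>, of Y \<xi>]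
    unfolding abs_helmholtz[OF \<phi>] inner_diff_left inner_diff_right inner_scaleR_left inner_scaleR_right
      minus_diff_eq left_diff_distrib right_diff_distrib
    by linarith
qed

text \<open>The resolvent identity for \<open>G\<close>, read pointwise at \<open>Y i\<close>: its
  left side is a difference of regular potentials, whose values are matrix entries, and its right
  side is a continuous convolution.\<close>

lemma M_matrix_diff:
  assumes "inj Y" "l > 0" "\<mu> > 0"
  shows "M_matrix Y l *v \<xi> - M_matrix Y \<mu> *v \<xi> = (l - \<mu>) *\<^sub>R G_adjoint Y l (G Y \<mu> \<xi>)"
proof -
  let ?F = "- (l - \<mu>) *\<^sub>R G Y \<mu> \<xi>"
  have "AE x in lborel. rep_L2 (G Y l \<xi> - G Y \<mu> \<xi>) x = point_potential Y l \<xi> x - point_potential Y \<mu> \<xi> x"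
  proof -
    have "G Y l \<xi> - G Y \<mu> \<xi> = abs_L2 (\<lambda>x. point_potential Y l \<xi> x - point_potential Y \<mu> \<xi> x)"
      unfolding G_eq
      using abs_L2_lin[OF point_potential_square_integrable[OF assms(2), of Y \<xi>] point_potential_square_integrable[OF assms(3), of Y \<xi>], of 1 "-1"]
      by simp
    then show ?thesis
      by (simp only: rep_abs_L2 square_integrable_diff point_potential_square_integrable assms)
  qed
  moreover have "AE x in lborel. rep_L2 (G Y l \<xi> - G Y \<mu> \<xi>) x = conv l (rep_L2 ?F) x"
    unfolding G_resolvent_identity[OF assms(2,3)] Res_def
    by (intro rep_abs_L2 conv_L2 assms square_integrable_rep)
  ultimately have "AE x in lborel. regular_potential Y l \<xi> x - regular_potential Y \<mu> \<xi> x = conv l (rep_L2 ?F) x"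
    using regular_potential_AE[of Y l \<xi>] regular_potential_AE[of Y \<mu> \<xi>] by eventually_elim simp
  then have eq: "(\<lambda>x. regular_potential Y l \<xi> x - regular_potential Y \<mu> \<xi> x) = conv l (rep_L2 ?F)"
    by (intro continuous_AE_eq continuous_on_diff regular_potential_continuous conv_continuous assms)
  have "(M_matrix Y \<mu> *v \<xi> - M_matrix Y l *v \<xi>) $ i = - (l - \<mu>) * conv l (rep_L2 (G Y \<mu> \<xi>)) (Y i)" for i
    using fun_cong[OF eq, of "Y i"] unfolding regular_potential_at[OF assms(1)] conv_inner[OF assms(2)] by simp
  then show ?thesis
    by (simp add: vec_eq_iff G_adjoint_eq algebra_simps)
qed

text \<open>Expressing \<open>G Y \<mu> \<xi>\<close> through \<open>G Y l \<xi>\<close> and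
  \<open>Res \<mu>\<close> isolates a gain in terms of \<open>G Y l \<xi>\<close> alone, whose norm
  does not depend on \<mu> and survives the limit to 0.\<close>

lemma M_matrix_positive_diff:
  assumes "inj Y" "0 < \<mu>" "\<mu> \<le> l"
  shows "\<xi> \<bullet> (M_matrix Y \<mu> *v \<xi>) + (l - \<mu>) * (norm (G Y l \<xi>))\<^sup>2 \<le> \<xi> \<bullet> (M_matrix Y l *v \<xi>)"
proof -
  have l: "l > 0" using assms by simp
  have "\<xi> \<bullet> (M_matrix Y l *v \<xi>) - \<xi> \<bullet> (M_matrix Y \<mu> *v \<xi>) = (l - \<mu>) * (\<xi> \<bullet> G_adjoint Y l (G Y \<mu> \<xi>))"
    unfolding inner_diff_right[symmetric] M_matrix_diff[OF assms(1) l assms(2)] by simp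
  also have "\<xi> \<bullet> G_adjoint Y l (G Y \<mu> \<xi>) = inner (G Y \<mu> \<xi>) (G Y l \<xi>)"
    by (rule inner_G[OF l, symmetric])
  also have "G Y \<mu> \<xi> = G Y l \<xi> + (l - \<mu>) *\<^sub>R Res \<mu> (G Y l \<xi>)"
  proof -
    have "G Y \<mu> \<xi> - G Y l \<xi> = (l - \<mu>) *\<^sub>R Res \<mu> (G Y l \<xi>)"
      unfolding G_resolvent_identity[OF assms(2) l] minus_diff_eq by (rule linear_cmul[OF Res_linear[OF assms(2)]])
    then show ?thesis by (metis add.commute diff_add_cancel)
  qed
  finally have "\<xi> \<bullet> (M_matrix Y l *v \<xi>) - \<xi> \<bullet> (M_matrix Y \<mu> *v \<xi>)
      = (l - \<mu>) * ((norm (G Y l \<xi>))\<^sup>2 + (l - \<mu>) * inner (Res \<mu> (G Y l \<xi>)) (G Y l \<xi>))"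
    by (simp add: inner_add_left power2_norm_eq_inner)
  moreover have "(l - \<mu>) * (norm (G Y l \<xi>))\<^sup>2 \<le> (l - \<mu>) * ((norm (G Y l \<xi>))\<^sup>2 + (l - \<mu>) * inner (Res \<mu> (G Y l \<xi>)) (G Y l \<xi>))"
    using assms Res_positive[OF assms(2)] by (intro mult_left_mono) (auto intro!: mult_nonneg_nonneg)
  ultimately show ?thesis by linarith
qed

text \<open>The comparison is available for positive \<mu> only, so \<mu> = 0 is reached as a limit
  of matrix entries. The inequality stays strict because \<open>G Y l \<xi>\<close> is a nonzero
  element of L2.\<close>

lemma M_matrix_positive:
  assumes "inj Y" "l > 0" "\<xi> \<noteq> 0"
  shows "\<xi> \<bullet> (M_matrix Y 0 *v \<xi>) < \<xi> \<bullet> (M_matrix Y l *v \<xi>)"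
proof -
  define \<mu> where "\<mu> n = l / real (Suc n)" for n
  have \<mu>: "0 < \<mu> n" "\<mu> n \<le> l" for n using assms(2) by (auto simp: \<mu>_def field_simps)
  have \<mu>0: "\<mu> \<longlonglongrightarrow> 0"
    unfolding \<mu>_def using tendsto_mult[OF tendsto_const LIMSEQ_inverse_real_of_nat, of l] by (simp add: divide_inverse)
  have cont: "(\<lambda>n. M_matrix Y (\<mu> n) $ i $ j) \<longlonglongrightarrow> M_matrix Y 0 $ i $ j" for i j
  proof (cases "i = j")
    case False
    then have "Y i \<noteq> Y j" using assms(1) by (auto dest: injD)
    then have "(\<lambda>n. - kern (\<mu> n) (Y i - Y j)) \<longlonglongrightarrow> - kern 0 (Y i - Y j)"
      unfolding kern_def by (intro tendsto_intros \<mu>0) auto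
    then show ?thesis using False by (simp add: M_matrix_entry)
  next
    case True
    have "(\<lambda>n. sqrt (\<mu> n) / (4 * pi)) \<longlonglongrightarrow> sqrt 0 / (4 * pi)"
      by (intro tendsto_intros \<mu>0) auto
    then show ?thesis using True by (simp add: M_matrix_entry)
  qed
  have "(\<lambda>n. \<xi> \<bullet> (M_matrix Y (\<mu> n) *v \<xi>)) \<longlonglongrightarrow> \<xi> \<bullet> (M_matrix Y 0 *v \<xi>)"
    unfolding inner_vec_def matrix_vector_mult_def by (simp, intro tendsto_intros cont)
  then have "(\<lambda>n. \<xi> \<bullet> (M_matrix Y (\<mu> n) *v \<xi>) + (l - \<mu> n) * (norm (G Y l \<xi>))\<^sup>2)
      \<longlonglongrightarrow> \<xi> \<bullet> (M_matrix Y 0 *v \<xi>) + (l - 0) * (norm (G Y l \<xi>))\<^sup>2"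
    by (intro tendsto_add tendsto_mult tendsto_diff tendsto_const \<mu>0)
  then have "\<xi> \<bullet> (M_matrix Y 0 *v \<xi>) + (l - 0) * (norm (G Y l \<xi>))\<^sup>2 \<le> \<xi> \<bullet> (M_matrix Y l *v \<xi>)"
    by (rule LIMSEQ_le_const2) (use M_matrix_positive_diff[OF assms(1) \<mu>] in blast)
  moreover have "G Y l \<xi> \<noteq> 0"
    using Res_eq_G(1)[OF assms(1,2), of 0 \<xi>] assms(3) linear_0[OF Res_linear[OF assms(2)]] by auto
  then have "0 < (l - 0) * (norm (G Y l \<xi>))\<^sup>2" using assms(2) by simp
  ultimately show ?thesis by linarith
qed

subsection \<open>The resolvent formula\<close>

lemma Res_weak_laplacian:
  assumes "l > 0"
  shows "weak_laplacian (rep_L2 (Res l f)) (rep_L2 (l *\<^sub>R Res l f - f))"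
  unfolding weak_laplacian_rep_iff
proof (intro allI impI)
  fix \<phi> assume \<phi>: "test_function \<phi>"
  then show "inner (Res l f) (abs_L2 (laplace \<phi>)) = inner (l *\<^sub>R Res l f - f) (abs_L2 \<phi>)"
    using Res_weak[OF assms \<phi>, of f] by (simp add: abs_helmholtz inner_diff_left inner_diff_right)
qed

lemma rep_Res_AE:
  assumes "l > 0" shows "AE x in lborel. rep_L2 (Res l f) x = conv l (rep_L2 f) x"
  unfolding Res_def by (intro rep_abs_L2 conv_L2 assms square_integrable_rep)

text \<open>The contributions l Res f - f and l G \<xi> combine to l u - f for u = Res f + G \<xi>,
  which is what the equation (operator + l) u = f demands.\<close>

lemma regular_part_weak_laplacian:
  assumes "l > 0"
  shows "weak_laplacian (\<lambda>x. conv l (rep_L2 f) x + regular_potential Y l \<xi> x) (rep_L2 (l *\<^sub>R (Res l f + G Y l \<xi>) - f))"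
proof -
  have 1: "weak_laplacian (conv l (rep_L2 f)) (rep_L2 (l *\<^sub>R Res l f - f))"
    by (rule weak_laplacian_cong_AE[OF Res_weak_laplacian[OF assms] _ _ rep_Res_AE[OF assms]])
       (auto intro!: square_integrable_locally square_integrable_rep conv_L2 assms)
  have "weak_laplacian (\<lambda>x. conv l (rep_L2 f) x + regular_potential Y l \<xi> x)
     (\<lambda>x. rep_L2 (l *\<^sub>R Res l f - f) x + l * point_potential Y l \<xi> x)"
    using assms by (intro weak_laplacian_add 1 regular_potential_weak_laplacian) simp
  then show ?thesis
  proof (rule weak_laplacian_cong_AE)
    show "locally_integrable (\<lambda>x. conv l (rep_L2 f) x + regular_potential Y l \<xi> x)"
      by (intro locally_integrable_add continuous_locally_integrable regular_potential_continuous conv_continuous assms)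
    show "locally_integrable (rep_L2 (l *\<^sub>R (Res l f + G Y l \<xi>) - f))"
      by (intro square_integrable_locally square_integrable_rep)
    have e: "l *\<^sub>R (Res l f + G Y l \<xi>) - f = (l *\<^sub>R Res l f - f) + l *\<^sub>R G Y l \<xi>"
      by (simp add: scaleR_add_right)
    have "AE x in lborel. rep_L2 (l *\<^sub>R (Res l f + G Y l \<xi>) - f) x
        = rep_L2 (l *\<^sub>R Res l f - f) x + rep_L2 (l *\<^sub>R G Y l \<xi>) x"
      unfolding e by (rule rep_add_AE)
    moreover have "AE x in lborel. rep_L2 (G Y l \<xi>) x = point_potential Y l \<xi> x"
      unfolding G_eq by (intro rep_abs_L2 point_potential_square_integrable assms)
    ultimately show "AE x in lborel. rep_L2 (l *\<^sub>R Res l f - f) x + l * point_potential Y l \<xi> x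
        = rep_L2 (l *\<^sub>R (Res l f + G Y l \<xi>) - f) x"
      using rep_scale_AE[of l "G Y l \<xi>"] by eventually_elim simp
  qed simp
qed

text \<open>Boundedness comes from \<open>conv_bound\<close> and \<open>regk_bound\<close>; the
  square integrable gradient is the weak gradient of \<open>Res l f\<close> provided by H2
  regularity plus the explicit gradients of the regular kernels.\<close>

lemma regular_part_H2_tilde:
  assumes "l > 0"
  shows "(\<lambda>x. conv l (rep_L2 f) x + regular_potential Y l \<xi> x) \<in> H2_tilde"
proof -
  let ?u = "\<lambda>x. conv l (rep_L2 f) x + regular_potential Y l \<xi> x"
  have l0: "l \<ge> 0" using assms by simp
  have "?u \<in> bcontfun"
    unfolding bcontfun_def
  proof (intro CollectI conjI)
    show "continuous_on UNIV ?u"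
      by (intro continuous_intros regular_potential_continuous conv_continuous assms)
    show "bounded (range ?u)"
    proof (rule boundedI)
      fix v assume "v \<in> range ?u"
      then obtain x where v: "v = ?u x" by auto
      have "\<bar>regular_potential Y l \<xi> x\<bar> \<le> (\<Sum>j\<in>UNIV. \<bar>\<xi> $ j * regk l (x - Y j)\<bar>)"
        unfolding regular_potential_def by (rule sum_abs)
      also have "\<dots> \<le> (\<Sum>j\<in>UNIV. \<bar>\<xi> $ j\<bar> * (sqrt l / (4 * pi)))"
        unfolding abs_mult by (intro sum_mono mult_left_mono regk_bound l0) auto
      finally show "norm v \<le> norm (abs_L2 (kern l)) * norm f + (\<Sum>j\<in>UNIV. \<bar>\<xi> $ j\<bar> * (sqrt l / (4 * pi)))"
        unfolding v real_norm_def using conv_bound[OF assms, of f x]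
        by (intro order_trans[OF abs_triangle_ineq] add_mono)
    qed
  qed
  moreover have "\<exists>g :: R3 \<Rightarrow> real^3. (\<forall>i. weak_derivative [i] ?u (\<lambda>x. g x $ i)) \<and> square_integrable (\<lambda>x. norm (g x))"
  proof -
    have "\<exists>g. weak_derivative [i] (rep_L2 (Res l f)) (rep_L2 g)" for i
      using Res_H2[OF assms, of f] by (simp add: H2_def)
    then obtain w where w: "\<And>i. weak_derivative [i] (rep_L2 (Res l f)) (rep_L2 (w i))" by metis
    have w': "weak_derivative [i] (conv l (rep_L2 f)) (rep_L2 (w i))" for i
      by (rule weak_derivative_cong_AE[OF w _ rep_Res_AE[OF assms]])
         (intro square_integrable_locally conv_L2 assms square_integrable_rep)
    define h where "h i x = rep_L2 (w i) x + (\<Sum>j\<in>UNIV. \<xi> $ j * regk_grad l (x - Y j) $ i)" for i x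
    have "square_integrable (\<lambda>x. \<Sum>j\<in>I. \<xi> $ j * regk_grad l (x - Y j) $ i)" if "finite I" for I i
      using that
      by induction (auto simp: square_integrable_zero intro!: square_integrable_add square_integrable_scale
          square_integrable_shift[OF regk_grad_square_integrable] l0)
    then have hsq: "square_integrable (h i)" for i
      unfolding h_def[abs_def] by (intro square_integrable_add square_integrable_rep) simp
    define g where "g x = (\<chi> i. h i x)" for x
    have "weak_derivative [i] ?u (\<lambda>x. g x $ i)" for i
      unfolding g_def h_def regular_potential_def vec_lambda_beta
      by (intro weak_derivative_add w' weak_derivative_sum weak_derivative_cmult regk_weak_derivative l0)
    moreover have "square_integrable (\<lambda>x. norm (g x))"
    proof -
      have n: "(norm (g x))\<^sup>2 = (\<Sum>i\<in>UNIV. (h i x)\<^sup>2)" for x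
        unfolding power2_norm_eq_inner inner_vec_def by (simp add: g_def power2_eq_square)
      have n': "norm (g x) = sqrt (\<Sum>i\<in>UNIV. (h i x)\<^sup>2)" for x
        unfolding n[symmetric] by simp
      have [measurable]: "h i \<in> borel_measurable borel" for i
        using hsq[of i] by (simp add: square_integrable_def)
      show ?thesis
        unfolding square_integrable_def n
      proof
        show "(\<lambda>x. norm (g x)) \<in> borel_measurable lborel" unfolding n' by measurable
        show "integrable lborel (\<lambda>x. \<Sum>i\<in>UNIV. (h i x)\<^sup>2)"
          using hsq by (intro Bochner_Integration.integrable_sum) (simp add: square_integrable_def)
      qed
    qed
    ultimately show ?thesis by blast
  qed
  moreover have "\<exists>h. square_integrable h \<and> weak_laplacian ?u h"
    using regular_part_weak_laplacian[OF assms] square_integrable_rep by blast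
  ultimately show ?thesis by (simp add: H2_tilde_def)
qed

lemma tau_tilde_regular_part:
  assumes "inj Y" "l > 0"
  shows "tau_tilde Y \<xi> (\<lambda>x. conv l (rep_L2 f) x + regular_potential Y l \<xi> x + G0 Y \<xi> x) = G_adjoint Y l f - M_matrix Y l *v \<xi>"
proof -
  have "continuous_on UNIV (\<lambda>x. conv l (rep_L2 f) x + regular_potential Y l \<xi> x)"
    by (intro continuous_intros regular_potential_continuous conv_continuous assms)
  from tau_tilde_eq[OF assms(1) this, of \<xi>] show ?thesis
    by (simp add: regular_potential_at[OF assms(1)] G_adjoint_eq vec_eq_iff)
qed

text \<open>An arbitrary decomposition of u is forced into the explicit one by uniqueness for the
  Helmholtz equation; conversely the explicit functions satisfy every condition in the definition of
  the operator.\<close>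

lemma resolvent_Theta_iff:
  assumes "inj Y" "l > 0"
  shows "(f, u) \<in> resolvent (neg_laplacian_Theta Y \<Theta>) l \<longleftrightarrow>
    (\<exists>\<xi>. u = Res l f + G Y l \<xi> \<and> (\<xi>, G_adjoint Y l f - M_matrix Y l *v \<xi>) \<in> \<Theta>)"
proof
  assume "(f, u) \<in> resolvent (neg_laplacian_Theta Y \<Theta>) l"
  then obtain h u\<^sub>0 \<xi> where f: "f = - h + l *\<^sub>R u" and u0: "u\<^sub>0 \<in> H2_tilde"
    and u: "AE x in lborel. rep_L2 u x = u\<^sub>0 x + G0 Y \<xi> x"
    and \<Theta>: "(\<xi>, tau_tilde Y \<xi> (\<lambda>x. u\<^sub>0 x + G0 Y \<xi> x)) \<in> \<Theta>"
    and h: "weak_laplacian u\<^sub>0 (rep_L2 h)"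
    by (auto simp: resolvent_def rel_add_def graph_of_def neg_laplacian_Theta_def)
  \<comment> \<open>\<open>u\<^sub>0\<close> is not assumed square integrable, so uniqueness is
    applied to the L2 remainder \<open>w\<close>, which agrees almost everywhere with
    \<open>u\<^sub>0\<close> minus the regular potential.\<close>
  define w where "w = u - G Y l \<xi>"
  have gm [measurable]: "point_potential Y l \<xi> \<in> borel_measurable borel" "point_potential Y 0 \<xi> \<in> borel_measurable borel"
    using point_potential_locally_integrable[of l Y \<xi>] point_potential_locally_integrable[of 0 Y \<xi>] assms by (auto simp: locally_integrable_def)
  have u0c: "continuous_on UNIV u\<^sub>0" using u0 by (simp add: H2_tilde_def bcontfun_def)
  have [measurable]: "u\<^sub>0 \<in> borel_measurable borel" by (rule borel_measurable_continuous_onI[OF u0c])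
  have [measurable]: "regular_potential Y l \<xi> \<in> borel_measurable borel" by (rule borel_measurable_continuous_onI[OF regular_potential_continuous])
  have wAE: "AE x in lborel. rep_L2 w x = u\<^sub>0 x - regular_potential Y l \<xi> x"
  proof -
    have "u = w + G Y l \<xi>" by (simp add: w_def)
    then have "AE x in lborel. rep_L2 u x = rep_L2 w x + rep_L2 (G Y l \<xi>) x" using rep_add_AE by simp
    moreover have "AE x in lborel. rep_L2 (G Y l \<xi>) x = point_potential Y l \<xi> x"
      unfolding G_eq by (intro rep_abs_L2 point_potential_square_integrable assms)
    ultimately show ?thesis using u regular_potential_AE[of Y l \<xi>] by eventually_elim (simp add: G0_eq)
  qed
  have w: "w = Res l f"
  proof (rule Res_unique[OF assms(2)])
    fix \<phi> assume \<phi>: "test_function \<phi>"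
    note t = \<phi> test_laplace[OF \<phi>]
    note li = continuous_locally_integrable[OF u0c] continuous_locally_integrable[OF regular_potential_continuous]
    have l0: "l \<ge> 0" using assms by simp
    have "inner w (abs_L2 (laplace \<phi>)) = (\<integral>x. rep_L2 w x * laplace \<phi> x \<partial>lborel)"
      by (intro inner_rep_abs test_square_integrable t)
    also have "\<dots> = (\<integral>x. (u\<^sub>0 x - regular_potential Y l \<xi> x) * laplace \<phi> x \<partial>lborel)"
      by (rule integral_cong_AE_mult[OF _ _ test_measurable[OF t(2)] wAE]) measurable
    also have "\<dots> = (\<integral>x. u\<^sub>0 x * laplace \<phi> x \<partial>lborel) - (\<integral>x. regular_potential Y l \<xi> x * laplace \<phi> x \<partial>lborel)"
      unfolding left_diff_distrib by (intro Bochner_Integration.integral_diff integrable_locally_mult_test li t)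
    also have "\<dots> = (\<integral>x. rep_L2 h x * \<phi> x \<partial>lborel) - (\<integral>x. l * point_potential Y l \<xi> x * \<phi> x \<partial>lborel)"
      using h regular_potential_weak_laplacian[OF l0, of Y \<xi>] \<phi> by (simp add: weak_laplacian_def)
    also have "\<dots> = inner h (abs_L2 \<phi>) - l * inner (G Y l \<xi>) (abs_L2 \<phi>)"
    proof -
      have "inner (G Y l \<xi>) (abs_L2 \<phi>) = (\<integral>x. point_potential Y l \<xi> x * \<phi> x \<partial>lborel)"
        unfolding G_eq by (intro inner_abs_L2 point_potential_square_integrable assms test_square_integrable \<phi>)
      then show ?thesis
        by (simp add: inner_rep_abs[OF test_square_integrable[OF \<phi>]] mult.assoc)
    qed
    finally have "inner w (abs_L2 (laplace \<phi>)) = inner h (abs_L2 \<phi>) - l * inner (G Y l \<xi>) (abs_L2 \<phi>)" .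
    then show "inner w (abs_L2 (helmholtz l \<phi>)) = inner f (abs_L2 \<phi>)"
      unfolding abs_helmholtz[OF \<phi>] f w_def inner_diff_left inner_diff_right inner_add_left inner_minus_left
        inner_scaleR_left inner_scaleR_right right_diff_distrib by linarith
  qed
  have "AE x in lborel. u\<^sub>0 x = conv l (rep_L2 f) x + regular_potential Y l \<xi> x"
    using wAE rep_Res_AE[OF assms(2), of f] unfolding w by eventually_elim simp
  \<comment> \<open>Equality everywhere, by continuity, is what allows the trace to be computed from
    the right-hand side.\<close>
  then have "u\<^sub>0 = (\<lambda>x. conv l (rep_L2 f) x + regular_potential Y l \<xi> x)"
    by (intro continuous_AE_eq u0c continuous_intros regular_potential_continuous conv_continuous assms)
  then have tau: "tau_tilde Y \<xi> (\<lambda>x. u\<^sub>0 x + G0 Y \<xi> x) = G_adjoint Y l f - M_matrix Y l *v \<xi>"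
    using tau_tilde_regular_part[OF assms] by simp
  have "u = Res l f + G Y l \<xi>" unfolding w[symmetric] w_def by simp
  then show "\<exists>\<xi>. u = Res l f + G Y l \<xi> \<and> (\<xi>, G_adjoint Y l f - M_matrix Y l *v \<xi>) \<in> \<Theta>"
    using \<Theta>[unfolded tau] by blast
next
  assume "\<exists>\<xi>. u = Res l f + G Y l \<xi> \<and> (\<xi>, G_adjoint Y l f - M_matrix Y l *v \<xi>) \<in> \<Theta>"
  then obtain \<xi> where u: "u = Res l f + G Y l \<xi>" and \<Theta>: "(\<xi>, G_adjoint Y l f - M_matrix Y l *v \<xi>) \<in> \<Theta>" by blast
  let ?u0 = "\<lambda>x. conv l (rep_L2 f) x + regular_potential Y l \<xi> x"
  have "AE x in lborel. rep_L2 (G Y l \<xi>) x = point_potential Y l \<xi> x"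
    unfolding G_eq by (intro rep_abs_L2 point_potential_square_integrable assms)
  with rep_add_AE[of "Res l f" "G Y l \<xi>"] rep_Res_AE[OF assms(2), of f] regular_potential_AE[of Y l \<xi>]
  have "AE x in lborel. rep_L2 u x = ?u0 x + G0 Y \<xi> x"
    unfolding u by eventually_elim (simp add: G0_eq)
  moreover have "weak_laplacian ?u0 (rep_L2 (l *\<^sub>R u - f))"
    unfolding u by (rule regular_part_weak_laplacian[OF assms(2)])
  moreover have "(\<xi>, tau_tilde Y \<xi> (\<lambda>x. ?u0 x + G0 Y \<xi> x)) \<in> \<Theta>"
    using \<Theta> tau_tilde_regular_part[OF assms] by simp
  ultimately have "(u, - (l *\<^sub>R u - f)) \<in> neg_laplacian_Theta Y \<Theta>"
    unfolding neg_laplacian_Theta_def using regular_part_H2_tilde[OF assms(2), of f Y \<xi>] by blast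
  moreover have "f = - (l *\<^sub>R u - f) + l *\<^sub>R u" by simp
  ultimately show "(f, u) \<in> resolvent (neg_laplacian_Theta Y \<Theta>) l"
    unfolding resolvent_def rel_add_def graph_of_def by blast
qed

section \<open>Properties of the operator and of the inverse relation\<close>

lemma in_resolvent: "(u, a) \<in> A \<Longrightarrow> (a + l *\<^sub>R u, u) \<in> resolvent A l"
  unfolding resolvent_def rel_add_def graph_of_def by blast

text \<open>Two values at the same u may come with different charges. Subtracting the two
  representations puts a resolvent value into the range of \<open>G\<close>, which forces both
  differences to vanish.\<close>

lemma neg_laplacian_Theta_single_valued:
  assumes "inj Y"
  shows "single_valued (neg_laplacian_Theta Y \<Theta>)"
proof (rule single_valuedI)
  fix u f g assume fg: "(u, f) \<in> neg_laplacian_Theta Y \<Theta>" "(u, g) \<in> neg_laplacian_Theta Y \<Theta>"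
  have l: "(1::real) > 0" by simp
  obtain \<xi> where \<xi>: "u = Res 1 (f + 1 *\<^sub>R u) + G Y 1 \<xi>"
    using in_resolvent[OF fg(1), of 1] unfolding resolvent_Theta_iff[OF assms l] by blast
  obtain \<zeta> where \<zeta>: "u = Res 1 (g + 1 *\<^sub>R u) + G Y 1 \<zeta>"
    using in_resolvent[OF fg(2), of 1] unfolding resolvent_Theta_iff[OF assms l] by blast
  have "Res 1 (f - g) = Res 1 (f + 1 *\<^sub>R u) - Res 1 (g + 1 *\<^sub>R u)"
    using linear_diff[OF Res_linear[OF l], of "f + 1 *\<^sub>R u" "g + 1 *\<^sub>R u"] by simp
  also have "\<dots> = (u - G Y 1 \<xi>) - (u - G Y 1 \<zeta>)"
    using \<xi> \<zeta> by (metis add_diff_cancel_right')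
  also have "\<dots> = G Y 1 (\<zeta> - \<xi>)" by (simp add: G_diff)
  finally have "f - g = 0" by (rule Res_eq_G(2)[OF assms l])
  then show "f = g" by simp
qed

lemma neg_laplacian_Theta_monotone:
  assumes inj: "inj Y" and \<gamma>: "smallest_eigenvalue (M_matrix Y 0) \<gamma>"
    and \<Theta>: "monotone_of_type \<gamma> \<Theta>"
    and uv: "(u, f) \<in> neg_laplacian_Theta Y \<Theta>" "(v, g) \<in> neg_laplacian_Theta Y \<Theta>"
  shows "0 \<le> inner (f - g) (u - v)"
proof -
  have nonneg: "0 \<le> inner (f - g) (u - v) + l * (norm (u - v))\<^sup>2" if l: "l > 0" for l
  proof -
    obtain \<xi> where \<xi>: "u = Res l (f + l *\<^sub>R u) + G Y l \<xi>"
      "(\<xi>, G_adjoint Y l (f + l *\<^sub>R u) - M_matrix Y l *v \<xi>) \<in> \<Theta>"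
      using in_resolvent[OF uv(1), of l] unfolding resolvent_Theta_iff[OF inj l] by blast
    obtain \<zeta> where \<zeta>: "v = Res l (g + l *\<^sub>R v) + G Y l \<zeta>"
      "(\<zeta>, G_adjoint Y l (g + l *\<^sub>R v) - M_matrix Y l *v \<zeta>) \<in> \<Theta>"
      using in_resolvent[OF uv(2), of l] unfolding resolvent_Theta_iff[OF inj l] by blast
    define F where "F = (f + l *\<^sub>R u) - (g + l *\<^sub>R v)"
    define \<eta> where "\<eta> = \<xi> - \<zeta>"
    have "u - v = (Res l (f + l *\<^sub>R u) + G Y l \<xi>) - (Res l (g + l *\<^sub>R v) + G Y l \<zeta>)"
      using \<xi>(1) \<zeta>(1) by simp
    also have "\<dots> = Res l F + G Y l \<eta>"
      by (simp add: F_def \<eta>_def G_diff[OF l] linear_diff[OF Res_linear[OF l]])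
    finally have d: "u - v = Res l F + G Y l \<eta>" .
    \<comment> \<open>The second components are the traces \<open>G_adjoint\<close> minus M_l
      applied to the charge, so the deficit allowed by type \<gamma> is compensated by the form of
      M_l, which is at least \<gamma> times the squared norm.\<close>
    have "- \<gamma> * (norm \<eta>)\<^sup>2 \<le> ((G_adjoint Y l (f + l *\<^sub>R u) - M_matrix Y l *v \<xi>) - (G_adjoint Y l (g + l *\<^sub>R v) - M_matrix Y l *v \<zeta>)) \<bullet> \<eta>"
      using \<Theta> \<xi>(2) \<zeta>(2) unfolding monotone_of_type_def \<eta>_def by blast
    also have "\<dots> = \<eta> \<bullet> G_adjoint Y l F - \<eta> \<bullet> (M_matrix Y l *v \<eta>)"
      by (simp add: F_def \<eta>_def G_adjoint_diff[OF l] matrix_vector_mult_diff_distrib inner_diff_left inner_diff_right inner_commute)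
    finally have "\<eta> \<bullet> (M_matrix Y l *v \<eta>) - \<gamma> * (norm \<eta>)\<^sup>2 \<le> \<eta> \<bullet> G_adjoint Y l F" by simp
    moreover have "\<gamma> * (norm \<eta>)\<^sup>2 \<le> \<eta> \<bullet> (M_matrix Y 0 *v \<eta>)"
      by (rule smallest_eigenvalue_bound[OF M_matrix_symmetric \<gamma>])
    moreover have "\<eta> \<bullet> (M_matrix Y 0 *v \<eta>) \<le> \<eta> \<bullet> (M_matrix Y l *v \<eta>)"
      using M_matrix_positive[OF inj l, of \<eta>] by (cases "\<eta> = 0") auto
    ultimately have "0 \<le> inner F (G Y l \<eta>)" unfolding inner_G[OF l] by linarith
    moreover have "0 \<le> inner F (Res l F)" using Res_positive[OF l, of F] by (simp add: inner_commute)
    ultimately have "0 \<le> inner F (u - v)" unfolding d inner_add_right by simp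
    also have "inner F (u - v) = inner (f - g) (u - v) + l * (norm (u - v))\<^sup>2"
    proof -
      have "F = (f - g) + l *\<^sub>R (u - v)" by (simp add: F_def scaleR_diff_right)
      then show ?thesis by (simp only: inner_add_left inner_scaleR_left power2_norm_eq_inner)
    qed
    finally show ?thesis .
  qed
  have "(\<lambda>n. inner (f - g) (u - v) + (1 / real (Suc n)) * (norm (u - v))\<^sup>2)
      \<longlonglongrightarrow> inner (f - g) (u - v) + 0 * (norm (u - v))\<^sup>2"
    using LIMSEQ_inverse_real_of_nat by (intro tendsto_intros) (simp add: inverse_eq_divide)
  then have "0 \<le> inner (f - g) (u - v) + 0 * (norm (u - v))\<^sup>2"
    by (rule LIMSEQ_le_const) (intro exI[of _ 0] allI impI nonneg, simp)
  then show ?thesis by simp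
qed

text \<open>Strict positivity of M_l - \<gamma> separates two solutions with the same right-hand
  side, and it is the hypothesis under which \<open>minty\<close> provides one.\<close>

lemma Theta_plus_M_inverse:
  assumes inj: "inj Y" and \<gamma>: "smallest_eigenvalue (M_matrix Y 0) \<gamma>"
    and \<Theta>: "maximal_monotone_of_type \<gamma> \<Theta>" and l: "l > 0"
  shows "everywhere_defined_map ((rel_add \<Theta> (graph_of (\<lambda>\<xi>. M_matrix Y l *v \<xi>)))\<inverse>)"
proof -
  have pos: "\<gamma> * (norm x)\<^sup>2 < x \<bullet> (M_matrix Y l *v x)" if "x \<noteq> 0" for x
    using smallest_eigenvalue_bound[OF M_matrix_symmetric \<gamma>, of x] M_matrix_positive[OF inj l that] by linarith
  have mem: "(w, \<xi>) \<in> (rel_add \<Theta> (graph_of (\<lambda>\<xi>. M_matrix Y l *v \<xi>)))\<inverse> \<longleftrightarrow> (\<xi>, w - M_matrix Y l *v \<xi>) \<in> \<Theta>" for w \<xi>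
    by (auto simp: rel_add_def graph_of_def intro: exI[of _ "w - M_matrix Y l *v \<xi>"])
  have "single_valued ((rel_add \<Theta> (graph_of (\<lambda>\<xi>. M_matrix Y l *v \<xi>)))\<inverse>)"
  proof (rule single_valuedI, unfold mem)
    fix w \<xi> \<zeta> assume a: "(\<xi>, w - M_matrix Y l *v \<xi>) \<in> \<Theta>" "(\<zeta>, w - M_matrix Y l *v \<zeta>) \<in> \<Theta>"
    have "- \<gamma> * (norm (\<xi> - \<zeta>))\<^sup>2 \<le> ((w - M_matrix Y l *v \<xi>) - (w - M_matrix Y l *v \<zeta>)) \<bullet> (\<xi> - \<zeta>)"
      using \<Theta> a unfolding maximal_monotone_of_type_def monotone_of_type_def by blast
    also have "(w - M_matrix Y l *v \<xi>) - (w - M_matrix Y l *v \<zeta>) = - (M_matrix Y l *v (\<xi> - \<zeta>))"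
      by (simp add: matrix_vector_mult_diff_distrib)
    also have "\<dots> \<bullet> (\<xi> - \<zeta>) = - ((\<xi> - \<zeta>) \<bullet> (M_matrix Y l *v (\<xi> - \<zeta>)))"
      by (simp only: inner_minus_left inner_minus_right inner_commute)
    finally have "(\<xi> - \<zeta>) \<bullet> (M_matrix Y l *v (\<xi> - \<zeta>)) \<le> \<gamma> * (norm (\<xi> - \<zeta>))\<^sup>2"
      by linarith
    then show "\<xi> = \<zeta>" using pos[of "\<xi> - \<zeta>"] by (metis not_less right_minus_eq)
  qed
  moreover have "Domain ((rel_add \<Theta> (graph_of (\<lambda>\<xi>. M_matrix Y l *v \<xi>)))\<inverse>) = UNIV"
  proof -
    have "\<exists>\<xi>. (w, \<xi>) \<in> (rel_add \<Theta> (graph_of (\<lambda>\<xi>. M_matrix Y l *v \<xi>)))\<inverse>" for w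
      unfolding mem by (rule minty[OF \<Theta> pos])
    then show ?thesis by blast
  qed
  ultimately show ?thesis by (simp add: everywhere_defined_map_def)
qed

theorem proposition5p1:
  fixes Y :: "'n::finite \<Rightarrow> real^3"
    and \<Theta> :: "((real^'n) \<times> (real^'n)) set"
    and \<gamma>\<^sub>0 :: real
  assumes "inj Y"
    and "smallest_eigenvalue (M_matrix Y 0) \<gamma>\<^sub>0"
    and "maximal_monotone_of_type \<gamma>\<^sub>0 \<Theta>"
  shows "maximal_monotone_operator (neg_laplacian_Theta Y \<Theta>) \<and>
    (\<forall>l>0.
       everywhere_defined_map ((rel_add \<Theta> (graph_of (\<lambda>\<xi>. M_matrix Y l *v \<xi>)))\<inverse>) \<and>
       everywhere_defined_map (resolvent (neg_laplacian_Theta Y \<Theta>) l) \<and>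
       resolvent (neg_laplacian_Theta Y \<Theta>) l =
         rel_add (resolvent neg_laplacian l)
           (graph_of (G_adjoint Y l) O
            (rel_add \<Theta> (graph_of (\<lambda>\<xi>. M_matrix Y l *v \<xi>)))\<inverse> O
            graph_of (G Y l)))"
proof -
  let ?A = "neg_laplacian_Theta Y \<Theta>"
  let ?B = "\<lambda>l. (rel_add \<Theta> (graph_of (\<lambda>\<xi>. M_matrix Y l *v \<xi>)))\<inverse>"
  have B: "everywhere_defined_map (?B l)" if "l > 0" for l
    using Theta_plus_M_inverse[OF assms that] .
  have memB: "(w, \<xi>) \<in> ?B l \<longleftrightarrow> (\<xi>, w - M_matrix Y l *v \<xi>) \<in> \<Theta>" for l w \<xi>
    by (auto simp: rel_add_def graph_of_def intro: exI[of _ "w - M_matrix Y l *v \<xi>"])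
  have iff: "(f, u) \<in> resolvent ?A l \<longleftrightarrow> (\<exists>\<xi>. u = Res l f + G Y l \<xi> \<and> (G_adjoint Y l f, \<xi>) \<in> ?B l)"
    if "l > 0" for l f u
    unfolding memB by (rule resolvent_Theta_iff[OF assms(1) that])
  have map: "everywhere_defined_map (resolvent ?A l)" if l: "l > 0" for l
  proof -
    have "\<exists>!\<xi>. (w, \<xi>) \<in> ?B l" for w
      using B[OF l] unfolding everywhere_defined_map_def single_valued_def by blast
    then obtain b where b: "\<And>w \<xi>. (w, \<xi>) \<in> ?B l \<longleftrightarrow> \<xi> = b w" by metis
    have "(f, u) \<in> resolvent ?A l \<longleftrightarrow> u = Res l f + G Y l (b (G_adjoint Y l f))" for f u
      unfolding iff[OF l] b by simp
    then show ?thesis unfolding everywhere_defined_map_def by (auto simp: single_valued_def)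
  qed
  have formula: "resolvent ?A l = rel_add (resolvent neg_laplacian l) (graph_of (G_adjoint Y l) O ?B l O graph_of (G Y l))"
    if l: "l > 0" for l
  proof (intro set_eqI)
    fix p :: "L2 \<times> L2"
    obtain f u where p: "p = (f, u)" by (cases p)
    show "p \<in> resolvent ?A l \<longleftrightarrow> p \<in> rel_add (resolvent neg_laplacian l) (graph_of (G_adjoint Y l) O ?B l O graph_of (G Y l))"
      unfolding p iff[OF l] resolvent_neg_laplacian[OF l] rel_add_def graph_of_def relcomp_unfold by blast
  qed
  have "maximal_monotone_operator ?A"
    unfolding maximal_monotone_operator_def
  proof (intro conjI)
    show "single_valued ?A" by (rule neg_laplacian_Theta_single_valued[OF assms(1)])
    have "monotone_of_type \<gamma>\<^sub>0 \<Theta>" using assms(3) by (simp add: maximal_monotone_of_type_def)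
    then show "\<forall>(u, f)\<in>?A. \<forall>(v, g)\<in>?A. (f - g) \<bullet> (u - v) \<ge> 0"
      using neg_laplacian_Theta_monotone[OF assms(1,2)] by blast
    \<comment> \<open>The range condition is checked at l = 1, where it says that the resolvent is
      defined everywhere.\<close>
    have "Range (rel_add ?A (graph_of (\<lambda>u. 1 *\<^sub>R u))) = Domain (resolvent ?A 1)"
      by (simp only: resolvent_def Domain_converse)
    also have "\<dots> = UNIV" using map[of 1] by (simp add: everywhere_defined_map_def)
    finally show "\<exists>l>0. Range (rel_add ?A (graph_of (\<lambda>u. l *\<^sub>R u))) = UNIV"
      by (intro exI[of _ 1]) simp
  qed
  then show ?thesis using B map formula by blast
qed

end
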